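(* Let $n\ge2$. For every integer $L$ with $n-1\le L\le\binom n2$, the largest value of $\sum_{k=1}^{n-1}e_k(A)$ among symmetric oscillatory matrices $A=U^T\Delta U$ of order $n$ (with $U$ unit upper triangular and $\Delta$ positive diagonal) satisfying $\ell(U)=L$ is $$\binom n2+n-1-L .$$ This maximum is attained by a symmetric integer matrix of determinant one.
   Context: All matrices are real. A matrix is totally nonnegative (TN) if all its minors are nonnegative and totally positive (TP) if all its minors are positive. A square TN matrix is oscillatory if some positive integer power of it is TP. For an oscillatory matrix $A$ of order $n$ and $1\le k\le n$, $e_k(A)=\min\{m\ge1:\text{all minors of order }k\text{ of }A^m\text{ are positive}\}$. For $1\le i<n$ and $a>0$, $x_i(a)=I+aE_{i,i+1}$, where $E_{ij}$ has a single nonzero entry one in position $(i,j)$; these are the positive elementary upper factors. For a unit upper triangular TN matrix $U$, $\ell(U)$ is the least number $s$ of factors in a representation $U=x_{q_1}(a_1)\cdots x_{q_s}(a_s)$ with all $a_j>0$ (every unit upper triangular TN matrix has such a representation). Every symmetric oscillatory matrix has a unique factorization $A=U^T\Delta U$ with $U$ unit upper triangular and $\Delta$ diagonal with positive diagonal entries, and $U$ is then TN. *)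

theory Defs
  imports Complex_Main "Jordan_Normal_Form.Determinant" "Jordan_Normal_Form.DL_Submatrix"
begin

text \<open>
  Matrices are those of \<^theory>\<open>Jordan_Normal_Form.Matrix\<close>, so rows, columns and the indices
  of elementary factors are counted from 0.
\<close>

definition minor :: "real mat \<Rightarrow> nat set \<Rightarrow> nat set \<Rightarrow> real" where
  "minor A I J = det (submatrix A I J)"

definition minors_of_order :: "nat \<Rightarrow> real mat \<Rightarrow> real set" where
  "minors_of_order k A =
     {minor A I J | I J. I \<subseteq> {..<dim_row A} \<and> J \<subseteq> {..<dim_col A} \<and> card I = k \<and> card J = k}"

definition totally_nonnegative :: "real mat \<Rightarrow> bool" where
  "totally_nonnegative A \<longleftrightarrow> (\<forall>k\<ge>1. \<forall>x\<in>minors_of_order k A. 0 \<le> x)"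

definition totally_positive :: "real mat \<Rightarrow> bool" where
  "totally_positive A \<longleftrightarrow> (\<forall>k\<ge>1. \<forall>x\<in>minors_of_order k A. 0 < x)"

definition oscillatory :: "real mat \<Rightarrow> bool" where
  "oscillatory A \<longleftrightarrow>
     square_mat A \<and> totally_nonnegative A \<and> (\<exists>m\<ge>1. totally_positive (A ^\<^sub>m m))"

text \<open>The set under the minimum is nonempty if \<open>A\<close> is oscillatory of order \<open>n\<close> and
  \<open>1 \<le> k \<le> n\<close>; otherwise the value may be meaningless.\<close>

definition minor_exponent :: "nat \<Rightarrow> real mat \<Rightarrow> nat" where
  "minor_exponent k A = (LEAST m. m \<ge> 1 \<and> (\<forall>x\<in>minors_of_order k (A ^\<^sub>m m). 0 < x))"

text \<open>\<open>elem_upper n i a\<close> is the order \<open>n\<close> matrix \<open>I + a E\<close>, where the single entry one of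
  \<open>E\<close> is in the 0-based position \<open>(i, i + 1)\<close>.\<close>

definition elem_upper :: "nat \<Rightarrow> nat \<Rightarrow> real \<Rightarrow> real mat" where
  "elem_upper n i a =
     1\<^sub>m n + a \<cdot>\<^sub>m mat n n (\<lambda>(r, c). if r = i \<and> c = i + 1 then 1 else 0)"

definition elem_upper_prod :: "nat \<Rightarrow> (nat \<times> real) list \<Rightarrow> real mat" where
  "elem_upper_prod n ps = foldr (\<lambda>(q, a) M. elem_upper n q a * M) ps (1\<^sub>m n)"

definition unit_upper_triangular :: "real mat \<Rightarrow> bool" where
  "unit_upper_triangular U \<longleftrightarrow>
     square_mat U \<and> upper_triangular U \<and> (\<forall>i<dim_row U. U $$ (i, i) = 1)"

definition positive_diagonal :: "real mat \<Rightarrow> bool" where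
  "positive_diagonal D \<longleftrightarrow>
     square_mat D \<and> diagonal_mat D \<and> (\<forall>i<dim_row D. 0 < D $$ (i, i))"

text \<open>Meaningful if \<open>U\<close> is unit upper triangular and totally nonnegative, since a
  representation then exists; the identity matrix is the empty product and has length 0.\<close>

definition factor_length :: "real mat \<Rightarrow> nat" where
  "factor_length U = (LEAST s. \<exists>ps. length ps = s \<and>
     (\<forall>(q, a)\<in>set ps. q + 1 < dim_row U \<and> 0 < a) \<and> U = elem_upper_prod (dim_row U) ps)"

text \<open>The factorization of a symmetric oscillatory matrix is unique, and its factor \<open>U\<close> is
  totally nonnegative, so the existential quantifier picks out the length of that factor.\<close>

definition sym_oscillatory_of_length :: "nat \<Rightarrow> nat \<Rightarrow> real mat set" where
  "sym_oscillatory_of_length n L =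
     {A \<in> carrier_mat n n. transpose_mat A = A \<and> oscillatory A \<and>
        (\<exists>U \<in> carrier_mat n n. \<exists>D \<in> carrier_mat n n.
           unit_upper_triangular U \<and> positive_diagonal D \<and>
           A = transpose_mat U * D * U \<and> factor_length U = L)}"

end

theory Submission
  imports Defs
begin

text \<open>
  Write a \<open>k\<close>-subset of the indices as a configuration of \<open>k\<close> particles. Multiplication by the
  elementary factor at \<open>i\<close> changes minors as if a particle at \<open>i\<close> could hop to a free site
  \<open>i + 1\<close>, and hops commute with reversed hops as relations, so the minors of order \<open>k\<close> of the \<open>m\<close>-th power
  of \<open>U\<^sup>T D U\<close> are all positive exactly when the greedy dynamics along \<open>m\<close> copies of a word of \<open>U\<close>
  moves the lowest configuration to the highest one. These dynamics are the left action of the 0-Hecke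
  monoid; let \<open>w\<^sub>m\<close> be the Demazure product of \<open>m\<close> copies of the word. Since the left and the
  right action commute, \<open>w\<^sub>m\<close> is turned into \<open>w\<^sub>m\<^sub>+\<^sub>1\<close> by multiplying on the other side,
  where each length-increasing step changes a single image \<open>w\<^sub>m({0, \<dots>, k - 1})\<close>. Hence the length grows
  at least by the number of \<open>k\<close> with exponent greater than \<open>m\<close>, and summing over \<open>m \<ge> 1\<close> bounds
  the sum of all \<open>e\<^sub>k - 1\<close> by \<open>n choose 2 - l(w\<^sub>1)\<close>.

  The word of \<open>U\<close> exists by Neville elimination after a perturbation and can be made reduced by
  commutation, merging and braid moves, so \<open>l(w\<^sub>1)\<close> is the number of factors. For the
  extremal matrices, following the lowest particle bounds every exponent from below.
\<close>

section \<open>Particle configurations\<close>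

text \<open>Commuting the hops turns the pattern of a power of \<open>A\<close> into reversed passes
  followed by equally many forward passes, so two configurations are related exactly when some
  common one reaches both. The lowest configuration is reached only from itself, hence the single
  minor with the first rows and the last columns decides whether all minors of that order are
  positive. The right action is needed because it localizes changes: the letter \<open>i\<close> can
  alter only the image of \<open>{..<Suc i}\<close>. While the exponent of \<open>k\<close> exceeds
  \<open>m\<close> the image of \<open>{..<k}\<close> must change in the next pass, since a greedy
  orbit that stalls once stalls for ever. For equality the lowest particle has to be slow. A
  descending pass through all letters moves it by one site; the other L - (n - 1) letters are
  crowded at the highest sites, where they help it only late. The number of factors is tied to the
  permutation from both sides: the positivity pattern of \<open>U\<close> determines the
  permutation, so no word of \<open>U\<close> is shorter than its number of inversions, and a normal
  form has exactly that many letters.\<close>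

definition shift :: "nat \<Rightarrow> nat set \<Rightarrow> nat set" where
  "shift i S = insert (Suc i) (S - {i})"

definition greedy :: "nat \<Rightarrow> nat set \<Rightarrow> nat set" where
  "greedy i S = (if i \<in> S \<and> Suc i \<notin> S then shift i S else S)"

text \<open>The identity is included because an elementary factor has unit diagonal: a particle may
  hop but need not, in contrast to \<open>greedy\<close>.\<close>

definition hop :: "nat \<Rightarrow> (nat set \<times> nat set) set" where
  "hop i = {(I, J). J = I \<or> i \<in> I \<and> Suc i \<notin> I \<and> J = shift i I}"

primrec hops :: "nat list \<Rightarrow> (nat set \<times> nat set) set" where
  "hops [] = Id"
| "hops (i # q) = hop i O hops q"

definition tail_card :: "nat set \<Rightarrow> nat \<Rightarrow> nat" where
  "tail_card S x = card (S \<inter> {x..})"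

text \<open>On sets of equal size this is the Gale order. Tail counts are convenient because a hop
  changes exactly one of them (\<open>tail_card_shift\<close>), so order arguments reduce to the
  tails at \<open>i\<close>, \<open>Suc i\<close> and \<open>Suc (Suc i)\<close>.\<close>

definition dominated :: "nat set \<Rightarrow> nat set \<Rightarrow> bool" where
  "dominated S T \<longleftrightarrow> (\<forall>x. tail_card S x \<le> tail_card T x)"

lemma tail_card_Suc:
  assumes "finite S"
  shows "tail_card S x = (if x \<in> S then 1 else 0) + tail_card S (Suc x)"
proof -
  have "S \<inter> {x..} = (if x \<in> S then {x} else {}) \<union> (S \<inter> {Suc x..})"
    by (auto simp: Suc_le_eq le_less)
  moreover have "card ({x} \<union> (S \<inter> {Suc x..})) = 1 + card (S \<inter> {Suc x..})"
    using assms by (subst card_Un_disjoint) auto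
  ultimately show ?thesis unfolding tail_card_def by auto
qed

lemma finite_shift [simp]: "finite (shift i S) = finite S"
  by (simp add: shift_def)

lemma finite_greedy [simp]: "finite (greedy i S) = finite S"
  by (simp add: greedy_def)

lemma finite_fold_greedy [simp]: "finite (fold greedy q S) = finite S"
  by (induction q arbitrary: S) auto

lemma card_shift: "finite S \<Longrightarrow> i \<in> S \<Longrightarrow> Suc i \<notin> S \<Longrightarrow> card (shift i S) = card S"
  unfolding shift_def by (metis DiffD1 Suc_inject card_Suc_Diff1 card_insert_disjoint finite_Diff)

lemma card_greedy [simp]: "finite S \<Longrightarrow> card (greedy i S) = card S"
  by (simp add: greedy_def card_shift)

lemma card_fold_greedy [simp]: "finite S \<Longrightarrow> card (fold greedy q S) = card S"
  by (induction q arbitrary: S) auto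

lemma shift_subset: "I \<subseteq> {..<n} \<Longrightarrow> Suc i < n \<Longrightarrow> shift i I \<subseteq> {..<n}"
  by (auto simp: shift_def)

lemma fold_greedy_subset:
  "S \<subseteq> {..<n} \<Longrightarrow> \<forall>i\<in>set q. Suc i < n \<Longrightarrow> fold greedy q S \<subseteq> {..<n}"
  by (induction q arbitrary: S) (auto simp: greedy_def shift_subset)

lemma tail_card_shift:
  assumes "finite S" "i \<in> S" "Suc i \<notin> S"
  shows "tail_card (shift i S) x = tail_card S x + (if x = Suc i then 1 else 0)"
proof -
  consider "x \<le> i" | "x = Suc i" | "x > Suc i" by linarith
  then show ?thesis
  proof cases
    case 1
    have eq: "shift i S \<inter> {x..} = shift i (S \<inter> {x..})" using 1 by (auto simp: shift_def)
    show ?thesis unfolding tail_card_def eq using 1 assms by (subst card_shift) auto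
  next
    case 2
    have "shift i S \<inter> {x..} = insert (Suc i) (S \<inter> {x..})" using 2 by (auto simp: shift_def)
    then show ?thesis unfolding tail_card_def using 2 assms by simp
  next
    case 3
    have "shift i S \<inter> {x..} = S \<inter> {x..}" using 3 by (auto simp: shift_def)
    then show ?thesis unfolding tail_card_def using 3 by simp
  qed
qed

lemma dominated_refl [simp]: "dominated S S"
  by (simp add: dominated_def)

lemma dominated_trans: "dominated S T \<Longrightarrow> dominated T R \<Longrightarrow> dominated S R"
  unfolding dominated_def using le_trans by blast

lemma dominated_antisym:
  assumes "finite S" "finite T" "dominated S T" "dominated T S"
  shows "S = T"
proof -
  have eq: "tail_card S x = tail_card T x" for x
    using assms(3,4) unfolding dominated_def by (simp add: le_antisym)
  show ?thesis
  proof (rule Set.set_eqI)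
    fix x
    show "x \<in> S \<longleftrightarrow> x \<in> T"
      using tail_card_Suc[OF assms(1), of x] tail_card_Suc[OF assms(2), of x] eq[of x] eq[of "Suc x"]
      by (auto split: if_splits)
  qed
qed

lemma dominated_greedy: "finite S \<Longrightarrow> dominated S (greedy i S)"
  by (auto simp: dominated_def greedy_def tail_card_shift)

text \<open>Only the tail at \<open>Suc i\<close> can grow. If \<open>S\<close> moves and
  \<open>T\<close> does not, then either \<open>i\<close> is missing from \<open>T\<close>, and its
  tail at \<open>Suc i\<close> equals the one at \<open>i\<close>, or \<open>Suc i\<close> is in
  \<open>T\<close>, and it is one more than the one at \<open>Suc (Suc i)\<close>. Both leave room
  for the increase.\<close>

lemma dominated_greedy_mono:
  assumes S: "finite S" and T: "finite T" and ST: "dominated S T"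
  shows "dominated (greedy i S) (greedy i T)"
  unfolding dominated_def
proof
  fix x
  note le = ST[unfolded dominated_def, rule_format]
  note eqs = tail_card_Suc[OF S, of i] tail_card_Suc[OF S, of "Suc i"]
    tail_card_Suc[OF T, of i] tail_card_Suc[OF T, of "Suc i"]
  show "tail_card (greedy i S) x \<le> tail_card (greedy i T) x"
    using eqs le[of i] le[of "Suc i"] le[of "Suc (Suc i)"] le[of x]
    by (auto simp: greedy_def tail_card_shift S T split: if_splits)
qed

lemma dominated_fold_greedy_mono:
  "finite S \<Longrightarrow> finite T \<Longrightarrow> dominated S T \<Longrightarrow> dominated (fold greedy q S) (fold greedy q T)"
proof (induction q arbitrary: S T)
  case (Cons i q)
  show ?case using Cons.IH[OF _ _ dominated_greedy_mono[OF Cons.prems]] Cons.prems by simp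
qed simp

lemma dominated_fold_greedy: "finite S \<Longrightarrow> dominated S (fold greedy q S)"
proof (induction q arbitrary: S)
  case (Cons i q)
  show ?case
    using dominated_trans[OF dominated_greedy[OF Cons.prems] Cons.IH[of "greedy i S"]] Cons.prems
    by simp
qed simp

lemma hop_dominated: "(I, J) \<in> hop i \<Longrightarrow> finite I \<Longrightarrow> dominated J (greedy i I)"
  by (auto simp: hop_def greedy_def dominated_def tail_card_shift)

lemma hop_finite: "(I, J) \<in> hop i \<Longrightarrow> finite J = finite I"
  by (auto simp: hop_def)

text \<open>Greedy runs are optimal: by monotonicity, declining a hop is never made up for
  later.\<close>

lemma hops_dominated:
  "(I, J) \<in> hops q \<Longrightarrow> finite I \<Longrightarrow> dominated J (fold greedy q I)"
proof (induction q arbitrary: I)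
  case (Cons i q)
  then obtain K where K: "(I, K) \<in> hop i" "(K, J) \<in> hops q" by auto
  have fK: "finite K" using K Cons.prems hop_finite by blast
  show ?case
    using Cons.IH[OF K(2) fK] dominated_fold_greedy_mono[OF fK _ hop_dominated[OF K(1)], of q]
      Cons.prems(2) dominated_trans by fastforce
qed simp

lemma hops_append: "hops (p @ q) = hops p O hops q"
  by (induction p) (auto simp: O_assoc)

lemma hops_fold_greedy: "(S, fold greedy q S) \<in> hops q"
proof (induction q arbitrary: S)
  case (Cons i q)
  have "(S, greedy i S) \<in> hop i" by (auto simp: hop_def greedy_def)
  then show ?case using Cons[of "greedy i S"] by auto
qed simp

text \<open>The lifting property of the Bruhat order for the parabolic quotient of \<open>k\<close>-subsets.\<close>

lemma hops_of_dominated: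
  assumes "finite J" "card J = k" "dominated J (fold greedy q {..<k})"
  shows "({..<k}, J) \<in> hops q"
  using assms
proof (induction q arbitrary: J rule: rev_induct)
  case Nil
  have "tail_card J k \<le> tail_card {..<k} k" using Nil by (auto simp: dominated_def)
  moreover have "{..<k} \<inter> {k..} = {}" by auto
  ultimately have "J \<inter> {k..} = {}" using Nil(1) by (simp add: tail_card_def)
  then have "J \<subseteq> {..<k}" by (auto simp: not_le[symmetric])
  then have "J = {..<k}" using Nil(2) by (simp add: card_subset_eq)
  then show ?case by simp
next
  case (snoc i q)
  define T where "T = fold greedy q {..<k}"
  have fT: "finite T" by (simp add: T_def)
  have JT: "tail_card J x \<le> tail_card (greedy i T) x" for x
    using snoc.prems(3) by (simp add: dominated_def T_def)
  note eqs = tail_card_Suc[OF fT, of i] tail_card_Suc[OF fT, of "Suc i"]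
    tail_card_Suc[OF snoc.prems(1), of i] tail_card_Suc[OF snoc.prems(1), of "Suc i"]
  show ?case
  proof (cases "Suc i \<in> J \<and> i \<notin> J")
    case True
    define J' where "J' = insert i (J - {Suc i})"
    have J': "finite J'" "i \<in> J'" "Suc i \<notin> J'" "shift i J' = J"
      using True snoc.prems(1) by (auto simp: J'_def shift_def)
    have "card J' = k" using card_shift[of J' i] J' snoc.prems(2) by simp
    moreover have "dominated J' T"
      unfolding dominated_def
    proof
      fix x
      have t: "tail_card J x = tail_card J' x + (if x = Suc i then 1 else 0)" for x
        using tail_card_shift[of J' i] J' by simp
      show "tail_card J' x \<le> tail_card T x"
        using JT[of x] t[of x] by (auto simp: greedy_def tail_card_shift fT split: if_splits)
    qed
    ultimately have "({..<k}, J') \<in> hops q" using snoc.IH[OF J'(1)] unfolding T_def by blast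
    moreover have "(J', J) \<in> hop i" using J' by (auto simp: hop_def)
    ultimately show ?thesis by (auto simp: hops_append)
  next
    case False
    \<comment> \<open>A move of \<open>T\<close> enlarges only its tail at \<open>Suc i\<close>. If
      \<open>Suc i\<close> is not in \<open>J\<close>, the tail of \<open>J\<close> there equals the
      one at \<open>Suc (Suc i)\<close>; if \<open>i\<close> is in \<open>J\<close>, it is one less
      than the one at \<open>i\<close>. The inequality at that neighbour suffices.\<close>
    have "dominated J T"
      unfolding dominated_def
    proof
      fix x
      show "tail_card J x \<le> tail_card T x"
        using JT[of x] JT[of i] JT[of "Suc i"] JT[of "Suc (Suc i)"] eqs False
        by (auto simp: greedy_def tail_card_shift fT split: if_splits)
    qed
    then have "({..<k}, J) \<in> hops q" using snoc.IH[OF snoc.prems(1,2)] unfolding T_def by blast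
    moreover have "(J, J) \<in> hop i" by (auto simp: hop_def)
    ultimately show ?thesis by (auto simp: hops_append)
  qed
qed

lemma dominated_top:
  assumes "J \<subseteq> {..<n}" "card J = k"
  shows "dominated J {n - k..<n}"
  unfolding dominated_def
proof
  fix x
  have fin: "finite J" using assms(1) finite_subset by blast
  have "card (J \<inter> {x..}) \<le> card ({x..<n})"
    by (rule card_mono) (use assms(1) in auto)
  moreover have "card (J \<inter> {x..}) \<le> k" using assms fin by (metis card_mono inf_le1)
  moreover have "{n - k..<n} \<inter> {x..} = {max x (n - k)..<n}" by auto
  moreover have "k \<le> n" using assms by (metis card_lessThan card_mono finite_lessThan)
  ultimately show "tail_card J x \<le> tail_card {n - k..<n} x"
    unfolding tail_card_def by (auto simp: max_def)
qed

section \<open>Exchange of hops with reversed hops, and powers of the pattern\<close>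

lemma hops_bottom:
  assumes "(I, {..<k}) \<in> hops q"
  shows "I = {..<k}"
  using assms
proof (induction q arbitrary: I)
  case (Cons i q)
  then have "(I, {..<k}) \<in> hop i" by auto
  moreover have False if "{..<k} = shift i I"
  proof -
    have "Suc i \<in> {..<k}" "i \<notin> {..<k}" unfolding that by (simp_all add: shift_def)
    then show False by simp
  qed
  ultimately show ?case by (auto simp: hop_def)
qed simp

text \<open>A diamond property: two different hops with a common target have a common source, and
  conversely, because they happen at disjoint pairs of sites.\<close>

lemma hop_comm_converse: "hop i O (hop j)\<inverse> = (hop j)\<inverse> O hop i"
proof (rule Set.set_eqI, clarify)
  fix I J
  show "(I, J) \<in> hop i O (hop j)\<inverse> \<longleftrightarrow> (I, J) \<in> (hop j)\<inverse> O hop i"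
  proof
    assume "(I, J) \<in> hop i O (hop j)\<inverse>"
    then obtain K where K: "(I, K) \<in> hop i" "(J, K) \<in> hop j" by auto
    show "(I, J) \<in> (hop j)\<inverse> O hop i"
    proof (cases "K = I \<or> K = J")
      case True
      then show ?thesis using K by (auto simp: hop_def)
    next
      case False
      then have I: "i \<in> I" "Suc i \<notin> I" "K = shift i I" and J: "j \<in> J" "Suc j \<notin> J" "K = shift j J"
        using K by (auto simp: hop_def)
      have IK: "I = insert i (K - {Suc i})" using I by (auto simp: shift_def)
      have JK: "J = insert j (K - {Suc j})" using J by (auto simp: shift_def)
      show ?thesis
      proof (cases "i = j")
        case True
        have "I = J" using IK JK True by simp
        then show ?thesis by (auto simp: hop_def)
      next
        case False
        \<comment> \<open>In \<open>K\<close> both vacated sites are empty and both new sites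
          occupied, so neither hop ends where the other starts. The hops are therefore independent,
          and \<open>M\<close> undoes both.\<close>
        have "i \<notin> K" "Suc i \<in> K" using I(3) by (simp_all add: shift_def)
        moreover have "j \<notin> K" "Suc j \<in> K" using J(3) by (simp_all add: shift_def)
        ultimately have K1: "i \<notin> K" "j \<notin> K" "Suc i \<in> K" "Suc j \<in> K" by simp_all
        then have K2: "i \<noteq> Suc j" "j \<noteq> Suc i" by metis+
        define M where "M = insert i (insert j (K - {Suc i} - {Suc j}))"
        have "j \<in> M" "Suc j \<notin> M" "i \<in> M" "Suc i \<notin> M"
          using K2 by (simp_all add: M_def)
        moreover have "I = shift j M" "J = shift i M"
          unfolding IK JK M_def shift_def using K1 K2 False by blast+
        ultimately have "(M, I) \<in> hop j" "(M, J) \<in> hop i" by (simp_all add: hop_def)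
        then show ?thesis by blast
      qed
    qed
  next
    assume "(I, J) \<in> (hop j)\<inverse> O hop i"
    then obtain M where M: "(M, I) \<in> hop j" "(M, J) \<in> hop i" by auto
    show "(I, J) \<in> hop i O (hop j)\<inverse>"
    proof (cases "M = I \<or> M = J")
      case True
      then show ?thesis using M by (auto simp: hop_def)
    next
      case False
      then have I: "j \<in> M" "Suc j \<notin> M" "I = shift j M" and J: "i \<in> M" "Suc i \<notin> M" "J = shift i M"
        using M by (auto simp: hop_def)
      show ?thesis
      proof (cases "i = j")
        case True
        have "I = J" using I J True by (auto simp: shift_def)
        then show ?thesis by (auto simp: hop_def)
      next
        case False
        have K2: "i \<noteq> Suc j" "j \<noteq> Suc i" using I J by metis+
        define K where "K = insert (Suc i) (insert (Suc j) (M - {i} - {j}))"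
        have "i \<in> I" "Suc i \<notin> I" "j \<in> J" "Suc j \<notin> J"
          using I J K2 False by (simp_all add: shift_def)
        moreover have "K = shift i I" "K = shift j J"
          unfolding I(3) J(3) K_def shift_def using I(1,2) J(1,2) K2 False by blast+
        ultimately have "(I, K) \<in> hop i" "(J, K) \<in> hop j" by (simp_all add: hop_def)
        then show ?thesis by blast
      qed
    qed
  qed
qed

lemma hops_comm_converse: "hops p O (hops q)\<inverse> = (hops q)\<inverse> O hops p"
proof -
  have 1: "hop i O (hops q)\<inverse> = (hops q)\<inverse> O hop i" for i
  proof (induction q)
    case (Cons j q)
    have "hop i O (hops (j # q))\<inverse> = (hop i O (hops q)\<inverse>) O (hop j)\<inverse>"
      by (simp add: converse_relcomp O_assoc)
    also have "\<dots> = (hops q)\<inverse> O (hop i O (hop j)\<inverse>)" by (simp add: Cons O_assoc)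
    also have "\<dots> = (hops (j # q))\<inverse> O hop i"
      by (simp add: hop_comm_converse converse_relcomp O_assoc)
    finally show ?case .
  qed simp
  show ?thesis
  proof (induction p)
    case (Cons i p)
    then show ?case by (metis 1 O_assoc hops.simps(2))
  qed simp
qed

text \<open>Used with the reversed word as \<open>S\<close> and the forward word as
  \<open>R\<close>: a path of \<open>m\<close> alternating passes becomes one long descent followed
  by one long ascent.\<close>

lemma relpow_relcomp_commute:
  assumes "R O S = S O R"
  shows "(S O R) ^^ m = S ^^ m O R ^^ m"
proof -
  have c: "R ^^ m O S = S O R ^^ m" for m
  proof (induction m)
    case (Suc m)
    have "R ^^ Suc m O S = R ^^ m O (R O S)" by (simp add: O_assoc)
    also have "\<dots> = (R ^^ m O S) O R" by (simp add: assms O_assoc)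
    also have "\<dots> = S O R ^^ Suc m" by (simp add: Suc O_assoc)
    finally show ?case .
  qed simp
  show ?thesis
  proof (induction m)
    case (Suc m)
    have "(S O R) ^^ Suc m = S ^^ m O (R ^^ m O S) O R" by (simp add: Suc O_assoc)
    also have "\<dots> = S ^^ Suc m O R ^^ Suc m" unfolding c by (simp add: O_assoc)
    finally show ?case .
  qed simp
qed

lemma hops_replicate: "hops (concat (replicate m q)) = hops q ^^ m"
  by (induction m) (auto simp: hops_append relpow_commute)

lemma fold_greedy_replicate: "fold greedy (concat (replicate m q)) = fold greedy q ^^ m"
  by (induction m) (auto simp: funpow_swap1)

lemma converse_relpow:
  fixes R :: "('a \<times> 'a) set"
  shows "(R\<inverse>) ^^ m = (R ^^ m)\<inverse>"
proof (induction m)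
  case (Suc m)
  have "(R\<inverse>) ^^ Suc m = (R O R ^^ m)\<inverse>" by (simp add: converse_relcomp Suc)
  then show ?case by (simp add: relpow_commute)
qed simp

text \<open>Every configuration lies below the highest one, so all are reachable from
  \<open>{..<k}\<close>; the path from \<open>I\<close> to \<open>J\<close> goes through it.\<close>

lemma all_pairs_related:
  assumes "(fold greedy q ^^ m) {..<k} = {n - k..<n}"
    and "I \<subseteq> {..<n}" "card I = k" "J \<subseteq> {..<n}" "card J = k"
  shows "(I, J) \<in> ((hops q)\<inverse> O hops q) ^^ m"
proof -
  have "({..<k}, K) \<in> hops q ^^ m" if "K \<subseteq> {..<n}" "card K = k" for K
    using hops_of_dominated[of K k "concat (replicate m q)"] that dominated_top[OF that] assms(1)
      finite_subset[OF that(1)]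
    by (simp add: hops_replicate fold_greedy_replicate)
  then show ?thesis
    using assms(2-) by (auto simp: relpow_relcomp_commute hops_comm_converse converse_relpow)
qed

text \<open>The turning point of the path reaches \<open>{..<k}\<close> by hops, so
  \<open>hops_bottom\<close> identifies it with \<open>{..<k}\<close>; domination by the greedy
  result does the rest.\<close>

lemma top_reached:
  assumes "({..<k}, {n - k..<n}) \<in> ((hops q)\<inverse> O hops q) ^^ m"
    and "k \<le> n" "\<forall>i\<in>set q. Suc i < n"
  shows "(fold greedy q ^^ m) {..<k} = {n - k..<n}"
proof -
  let ?Q = "concat (replicate m q)"
  obtain K where "(K, {..<k}) \<in> hops ?Q" "(K, {n - k..<n}) \<in> hops ?Q"
    using assms(1)
    by (auto simp: relpow_relcomp_commute hops_comm_converse converse_relpow hops_replicate)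
  then have "dominated {n - k..<n} (fold greedy ?Q {..<k})"
    using hops_bottom hops_dominated finite_lessThan by metis
  moreover have "dominated (fold greedy ?Q {..<k}) {n - k..<n}"
    by (rule dominated_top, rule fold_greedy_subset) (use assms in auto)
  ultimately have "fold greedy ?Q {..<k} = {n - k..<n}" by (simp add: dominated_antisym)
  then show ?thesis by (simp add: fold_greedy_replicate)
qed

section \<open>Demazure products and inversions\<close>

text \<open>Multiplication in the 0-Hecke monoid from the right: the values at positions
  \<open>i\<close> and \<open>Suc i\<close> are exchanged only if this creates an inversion.
  \<open>lstep\<close> is the left version, exchanging two consecutive values instead of two
  neighbouring positions.\<close>

definition rstep :: "nat \<Rightarrow> (nat \<Rightarrow> nat) \<Rightarrow> nat \<Rightarrow> nat" where
  "rstep i P = (if P i < P (Suc i) then P \<circ> Transposition.transpose i (Suc i) else P)"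

definition lstep :: "nat \<Rightarrow> (nat \<Rightarrow> nat) \<Rightarrow> nat \<Rightarrow> nat" where
  "lstep i P = (if inv_into UNIV P i < inv_into UNIV P (Suc i) then Transposition.transpose i (Suc i) \<circ> P else P)"

text \<open>The first letter acts last, so a prepended letter is a right step, while an appended
  letter is a left step (\<open>word_perm_eq_fold\<close>). Adding one more copy of a word can be
  read either way.\<close>

definition word_perm :: "nat list \<Rightarrow> nat \<Rightarrow> nat" where
  "word_perm q = foldr rstep q id"

text \<open>Permutations act on all naturals here; bounding the positions by \<open>n\<close> makes
  the set finite.\<close>

definition inversions :: "nat \<Rightarrow> (nat \<Rightarrow> nat) \<Rightarrow> (nat \<times> nat) set" where
  "inversions n P = {(a, b). a < b \<and> b < n \<and> P b < P a}"

lemma bij_rstep: "bij P \<Longrightarrow> bij (rstep i P)"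
  unfolding rstep_def by (auto intro: bij_comp)

lemma bij_lstep: "bij P \<Longrightarrow> bij (lstep i P)"
  unfolding lstep_def by (auto intro: bij_comp)

lemma transpose_Suc_less_iff:
  assumes "x \<noteq> y" "\<not> (x = i \<and> y = Suc i)" "\<not> (x = Suc i \<and> y = i)"
  shows "Transposition.transpose i (Suc i) x < Transposition.transpose i (Suc i) y \<longleftrightarrow> x < y"
  using assms by (auto simp: Transposition.transpose_def)

text \<open>Swapping neighbouring positions affects the comparison made by the left step only if the
  values \<open>j\<close> and \<open>Suc j\<close> sit exactly at these positions. In that case both
  steps perform the same exchange, and whichever comes second is idle.\<close>

lemma lstep_rstep_commute:
  assumes P: "bij P"
  shows "lstep j (rstep i P) = rstep i (lstep j P)"
proof -
  define a b where "a = inv_into UNIV P j" and "b = inv_into UNIV P (Suc j)"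
  let ?t = "Transposition.transpose i (Suc i)" and ?s = "Transposition.transpose j (Suc j)"
  have Pab: "P a = j" "P b = Suc j"
    using P by (simp_all add: a_def b_def bij_is_surj surj_f_inv_f)
  have eqP: "P x = P y \<longleftrightarrow> x = y" for x y using bij_is_inj[OF P] by (simp add: inj_eq)
  have invt: "inv_into UNIV (P \<circ> ?t) x = ?t (inv_into UNIV P x)" for x
    using P by (subst o_inv_distrib) auto
  have R: "rstep i P = (if P i < P (Suc i) then P \<circ> ?t else P)" by (simp add: rstep_def)
  have L: "lstep j P = (if a < b then ?s \<circ> P else P)" by (simp add: lstep_def a_def b_def)
  have LR: "lstep j (P \<circ> ?t) = (if ?t a < ?t b then ?s \<circ> (P \<circ> ?t) else P \<circ> ?t)"
    by (simp add: lstep_def invt a_def b_def)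
  have RL: "rstep i (?s \<circ> P) = (if ?s (P i) < ?s (P (Suc i)) then (?s \<circ> P) \<circ> ?t else ?s \<circ> P)"
    by (simp add: rstep_def)
  consider "a = i \<and> b = Suc i" | "a = Suc i \<and> b = i"
    | "\<not> (a = i \<and> b = Suc i)" "\<not> (a = Suc i \<and> b = i)" by blast
  then show ?thesis
  proof cases
    case 1
    have "P x = j \<longleftrightarrow> x = i" "P x = Suc j \<longleftrightarrow> x = Suc i" for x
      using Pab 1 eqP by metis+
    then have eq: "P \<circ> ?t = ?s \<circ> P" by (auto simp: fun_eq_iff Transposition.transpose_def)
    have "lstep j (P \<circ> ?t) = P \<circ> ?t" using 1 unfolding LR by simp
    moreover have "rstep i (?s \<circ> P) = ?s \<circ> P" using 1 Pab unfolding RL by auto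
    ultimately show ?thesis using 1 Pab eq unfolding R L by simp
  next
    case 2
    then have "P (Suc i) = j" "P i = Suc j" using Pab by auto
    then show ?thesis using 2 by (simp add: R L)
  next
    case 3
    have ab: "a \<noteq> b" using Pab by auto
    have 1: "?t a < ?t b \<longleftrightarrow> a < b" using 3 ab by (intro transpose_Suc_less_iff) auto
    have "P i \<noteq> P (Suc i)" by (simp add: eqP)
    moreover have "\<not> (P i = j \<and> P (Suc i) = Suc j)" "\<not> (P i = Suc j \<and> P (Suc i) = j)"
      using 3 Pab eqP by metis+
    ultimately have 2: "?s (P i) < ?s (P (Suc i)) \<longleftrightarrow> P i < P (Suc i)"
      by (intro transpose_Suc_less_iff) auto
    have "rstep i (lstep j P) = (if P i < P (Suc i) then lstep j P \<circ> ?t else lstep j P)"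
      unfolding L using 2 by (auto simp: RL R)
    moreover have "lstep j (rstep i P) = (if a < b then ?s \<circ> rstep i P else rstep i P)"
      unfolding R using 1 by (auto simp: LR L)
    ultimately show ?thesis by (simp add: L R comp_assoc)
  qed
qed

lemma fold_lstep_rstep:
  "bij P \<Longrightarrow> fold lstep q (rstep i P) = rstep i (fold lstep q P)"
  by (induction q arbitrary: P) (auto simp: lstep_rstep_commute bij_lstep)

lemma word_perm_eq_fold: "word_perm q = fold lstep q id"
proof (induction q)
  case (Cons i q)
  have "word_perm (i # q) = rstep i (word_perm q)" by (simp only: word_perm_def foldr.simps o_apply)
  also have "\<dots> = fold lstep q (rstep i id)" by (simp only: Cons fold_lstep_rstep[OF bij_id])
  also have "rstep i id = lstep i id" by (simp add: rstep_def lstep_def)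
  finally show ?case by (simp only: fold.simps o_apply)
qed (simp add: word_perm_def)

text \<open>If the value \<open>j\<close> stands before \<open>Suc j\<close>, an initial image
  containing \<open>Suc j\<close> also contains \<open>j\<close>, so the exchange is visible exactly
  when \<open>j\<close> can hop. If it stands after, an image containing \<open>j\<close> contains
  \<open>Suc j\<close>, and the greedy step is idle as well.\<close>

lemma lstep_image:
  assumes P: "bij P"
  shows "lstep j P ` {..<k} = greedy j (P ` {..<k})"
proof -
  define a b where "a = inv_into UNIV P j" and "b = inv_into UNIV P (Suc j)"
  let ?s = "Transposition.transpose j (Suc j)"
  have Pab: "P a = j" "P b = Suc j"
    using P by (simp_all add: a_def b_def bij_is_surj surj_f_inv_f)
  have eqP: "P x = P y \<longleftrightarrow> x = y" for x y using bij_is_inj[OF P] by (simp add: inj_eq)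
  have mem: "j \<in> P ` {..<k} \<longleftrightarrow> a < k" "Suc j \<in> P ` {..<k} \<longleftrightarrow> b < k"
    using Pab eqP by (metis imageE imageI lessThan_iff)+
  have L: "lstep j P = (if a < b then ?s \<circ> P else P)" by (simp add: lstep_def a_def b_def)
  have stay: "?s ` T = T" if "j \<in> T \<longleftrightarrow> Suc j \<in> T" for T
    using that by (rule transpose_image_eq)
  have move: "?s ` T = shift j T" if "j \<in> T" "Suc j \<notin> T" for T
    using that unfolding shift_def by (subst transpose_apply_first[symmetric]) 
      (auto simp: Transposition.transpose_def image_iff)
  show ?thesis
  proof (cases "a < b")
    case True
    then have "lstep j P ` {..<k} = ?s ` (P ` {..<k})" by (simp only: L if_True image_comp)
    also have "\<dots> = greedy j (P ` {..<k})"
    proof (cases "j \<in> P ` {..<k} \<and> Suc j \<notin> P ` {..<k}")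
      case True
      then show ?thesis using move unfolding greedy_def by metis
    next
      case False
      then have "j \<in> P ` {..<k} \<longleftrightarrow> Suc j \<in> P ` {..<k}" using mem \<open>a < b\<close> by auto
      then show ?thesis using stay False by (simp only: greedy_def if_False)
    qed
    finally show ?thesis .
  next
    case False
    then show ?thesis using mem by (auto simp: L greedy_def)
  qed
qed

lemma fold_lstep_image:
  "bij P \<Longrightarrow> fold lstep q P ` {..<k} = fold greedy q (P ` {..<k})"
  by (induction q arbitrary: P) (auto simp: lstep_image bij_lstep)

lemma word_perm_image: "word_perm q ` {..<k} = fold greedy q {..<k}"
  by (simp add: word_perm_eq_fold fold_lstep_image)

section \<open>Counting inversions along left and right steps\<close>

lemma finite_inversions [simp]: "finite (inversions n P)"
  by (rule finite_subset[of _ "{..<n} \<times> {..<n}"]) (auto simp: inversions_def)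

text \<open>Swapping the two positions carries old inversions injectively to new ones and never to
  the pair \<open>(i, Suc i)\<close>, which is a new inversion itself.\<close>

lemma card_inversions_rstep:
  assumes lt: "P i < P (Suc i)" and i: "Suc i < n"
  shows "Suc (card (inversions n P)) \<le> card (inversions n (rstep i P))"
proof -
  let ?t = "Transposition.transpose i (Suc i)"
  let ?f = "\<lambda>(a, b). (?t a, ?t b)"
  have R: "rstep i P = P \<circ> ?t" using lt by (simp add: rstep_def)
  have inj: "inj_on ?f (inversions n P)" by (auto simp: inj_on_def dest: injD[OF inj_transpose])
  have "?f ` inversions n P \<subseteq> inversions n (P \<circ> ?t) - {(i, Suc i)}"
  proof (clarify, intro DiffI)
    fix a b assume ab: "(a, b) \<in> inversions n P"
    then have lt': "a < b" "b < n" "P b < P a" by (auto simp: inversions_def)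
    have ne: "\<not> (a = i \<and> b = Suc i)" using lt' lt by auto
    have "?t a < ?t b" using lt' ne by (subst transpose_Suc_less_iff) auto
    moreover have "?t b < n" using i lt' by (auto simp: Transposition.transpose_def)
    ultimately show "(?t a, ?t b) \<in> inversions n (P \<circ> ?t)" using lt' by (simp add: inversions_def)
    show "(?t a, ?t b) \<notin> {(i, Suc i)}"
      using lt' by (auto simp: Transposition.transpose_def split: if_splits)
  qed
  then have "card (inversions n P) \<le> card (inversions n (P \<circ> ?t) - {(i, Suc i)})"
    using inj by (metis card_image card_mono finite_Diff finite_inversions)
  moreover have "(i, Suc i) \<in> inversions n (P \<circ> ?t)" using lt i by (simp add: inversions_def)
  ultimately show ?thesis unfolding R
    by (metis Suc_le_mono card_Suc_Diff1 finite_inversions)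
qed

text \<open>Exchanging consecutive values reverses the order of no other pair of values, so only the
  positions of \<open>j\<close> and \<open>Suc j\<close> can form a new inversion.\<close>

lemma card_inversions_lstep:
  assumes P: "bij P"
  shows "card (inversions n (lstep j P)) \<le> Suc (card (inversions n P))"
proof -
  let ?s = "Transposition.transpose j (Suc j)"
  have eqP: "P x = P y \<longleftrightarrow> x = y" for x y using bij_is_inj[OF P] by (simp add: inj_eq)
  have "inversions n (?s \<circ> P) \<subseteq> insert (inv_into UNIV P j, inv_into UNIV P (Suc j)) (inversions n P)"
  proof (rule subsetI)
    fix x assume "x \<in> inversions n (?s \<circ> P)"
    then obtain a b where x: "x = (a, b)" and lt: "a < b" "b < n" "?s (P b) < ?s (P a)"
      by (auto simp: inversions_def)
    show "x \<in> insert (inv_into UNIV P j, inv_into UNIV P (Suc j)) (inversions n P)"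
    proof (cases "P b < P a")
      case True
      then show ?thesis using lt x by (simp add: inversions_def)
    next
      case False
      have "P b \<noteq> P a" using lt(1) eqP by auto
      then have "P b = Suc j \<and> P a = j"
        using lt(3) False transpose_Suc_less_iff[of "P b" "P a" j] by (auto split: if_splits)
      then have "a = inv_into UNIV P j" "b = inv_into UNIV P (Suc j)"
        using bij_is_inj[OF P] by (metis inv_f_f)+
      then show ?thesis using x by simp
    qed
  qed
  then have "card (inversions n (?s \<circ> P)) \<le> card (insert (inv_into UNIV P j, inv_into UNIV P (Suc j)) (inversions n P))"
    by (intro card_mono) auto
  also have "\<dots> \<le> Suc (card (inversions n P))" by (rule card_insert_le_m1) auto
  finally show ?thesis by (simp add: lstep_def)
qed

lemma card_inversions_fold_lstep:
  "bij P \<Longrightarrow> card (inversions n (fold lstep q P)) \<le> length q + card (inversions n P)"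
proof (induction q arbitrary: P)
  case (Cons i q)
  show ?case
    using Cons.IH[OF bij_lstep[OF Cons.prems, of i]] card_inversions_lstep[OF Cons.prems, of n i]
    by simp
qed simp

lemma bij_word_perm: "bij (word_perm q)"
proof (induction q)
  case Nil
  show ?case by (simp add: word_perm_def bij_id[unfolded id_def])
next
  case (Cons i q)
  then show ?case unfolding word_perm_def foldr.simps o_apply by (rule bij_rstep)
qed

lemma card_inversions_word_perm_append:
  "card (inversions n (word_perm (p @ q))) \<le> card (inversions n (word_perm p)) + length q"
  using card_inversions_fold_lstep[OF bij_word_perm, of n q p] by (simp add: word_perm_eq_fold)

lemma card_inversions_word_perm: "card (inversions n (word_perm q)) \<le> length q"
proof -
  have "inversions n (word_perm []) = {}" by (auto simp: inversions_def word_perm_def)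
  then show ?thesis using card_inversions_word_perm_append[of n "[]" q] by simp
qed

text \<open>Unless the cut at \<open>k\<close> separates positions \<open>i\<close> and
  \<open>Suc i\<close>, swapping them permutes the initial segment.\<close>

lemma rstep_image:
  assumes "k \<noteq> Suc i"
  shows "rstep i P ` {..<k} = P ` {..<k}"
proof -
  have "Transposition.transpose i (Suc i) ` {..<k} = {..<k}"
    using assms by (intro transpose_image_eq) auto
  then have "(P \<circ> Transposition.transpose i (Suc i)) ` {..<k} = P ` {..<k}"
    by (metis image_comp)
  then show ?thesis by (simp only: rstep_def split: if_split) simp
qed

text \<open>Every step that is not idle changes exactly one of the initial images, so the number of
  changed images is at most the number of inversions gained.\<close>

lemma card_inversions_foldr_rstep:
  assumes "\<forall>i\<in>set q. Suc i < n"
  shows "card (inversions n P) + card {k \<in> {1..<n}. foldr rstep q P ` {..<k} \<noteq> P ` {..<k}}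
    \<le> card (inversions n (foldr rstep q P))"
  using assms
proof (induction q)
  case (Cons i q)
  let ?Q = "foldr rstep q P"
  let ?C = "\<lambda>R. {k \<in> {1..<n}. R ` {..<k} \<noteq> P ` {..<k}}"
  have IH: "card (inversions n P) + card (?C ?Q) \<le> card (inversions n ?Q)" using Cons by auto
  show ?case
  proof (cases "?Q i < ?Q (Suc i)")
    case True
    have "?C (rstep i ?Q) \<subseteq> insert (Suc i) (?C ?Q)" using rstep_image by blast
    then have "card (?C (rstep i ?Q)) \<le> card (insert (Suc i) (?C ?Q))" by (intro card_mono) auto
    also have "\<dots> \<le> Suc (card (?C ?Q))" by (rule card_insert_le_m1) auto
    finally show ?thesis using IH card_inversions_rstep[of ?Q i n] True Cons.prems by simp
  next
    case False
    then have "rstep i ?Q = ?Q" by (simp add: rstep_def)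
    then show ?thesis using IH by simp
  qed
qed simp

lemma card_pairs_less: "card {(a, b). a < b \<and> b < (n::nat)} = n choose 2"
proof (induction n)
  case (Suc n)
  have "{(a, b). a < b \<and> b < Suc n} = {(a, b). a < b \<and> b < n} \<union> (\<lambda>a. (a, n)) ` {..<n}"
    by (auto simp: less_Suc_eq)
  moreover have "finite {(a, b). a < b \<and> b < n}"
    by (rule finite_subset[of _ "{..<n} \<times> {..<n}"]) auto
  moreover have "card ((\<lambda>a. (a, n)) ` {..<n}) = n" by (subst card_image) (auto simp: inj_on_def)
  ultimately have "card {(a, b). a < b \<and> b < Suc n} = (n choose 2) + n"
    using Suc by (subst \<open>{(a, b). a < b \<and> b < Suc n} = _\<close>, subst card_Un_disjoint) auto
  then show ?case by (simp add: numeral_2_eq_2)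
qed simp

lemma card_inversions_le: "card (inversions n P) \<le> n choose 2"
  unfolding card_pairs_less[symmetric]
  by (rule card_mono, rule finite_subset[of _ "{..<n} \<times> {..<n}"]) (auto simp: inversions_def)

lemma card_inversions_longest:
  assumes "\<And>k. k \<le> n \<Longrightarrow> P ` {..<k} = {n - k..<n}" "inj P"
  shows "card (inversions n P) = n choose 2"
proof -
  have P: "P k = n - Suc k" if "k < n" for k
  proof -
    have "P k \<in> P ` {..<Suc k}" by simp
    moreover have "P k \<notin> P ` {..<k}" using assms(2) by (auto simp: inj_eq)
    ultimately show ?thesis using assms(1)[of k] assms(1)[of "Suc k"] that by auto
  qed
  have "inversions n P = {(a, b). a < b \<and> b < n}"
    using P by (auto simp: inversions_def)
  then show ?thesis by (simp add: card_pairs_less)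
qed

lemma fold_greedy_top:
  assumes "\<forall>i\<in>set q. Suc i < n" "k \<le> n"
  shows "fold greedy q {n - k..<n} = {n - k..<n}"
proof (rule dominated_antisym)
  show "dominated (fold greedy q {n - k..<n}) {n - k..<n}"
    by (rule dominated_top, rule fold_greedy_subset) (use assms in auto)
qed (auto intro: dominated_fold_greedy)

text \<open>Double counting: summing over \<open>m \<ge> 1\<close> the number of \<open>k\<close>
  with \<open>m < e k\<close> gives the sum of all \<open>e k - 1\<close>, while each such
  \<open>k\<close> accounts for a gain of one inversion in the step from \<open>m\<close> to
  \<open>Suc m\<close>, and the total is capped by \<open>n choose 2\<close>.\<close>

lemma sum_exponents_le:
  assumes q: "\<forall>i\<in>set q. Suc i < n"
    and pos: "\<And>k. k \<in> {1..<n} \<Longrightarrow> 1 \<le> e k"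
    and low: "\<And>k m. k \<in> {1..<n} \<Longrightarrow> 1 \<le> m \<Longrightarrow> m < e k \<Longrightarrow> (fold greedy q ^^ m) {..<k} \<noteq> {n - k..<n}"
    and fin: "\<And>k. k \<in> {1..<n} \<Longrightarrow> \<exists>m. (fold greedy q ^^ m) {..<k} = {n - k..<n}"
  shows "(\<Sum>k\<in>{1..<n}. e k) + card (inversions n (word_perm q)) \<le> (n choose 2) + (n - 1)"
proof -
  define w where "w m = word_perm (concat (replicate m q))" for m
  have w_Suc: "w (Suc m) = foldr rstep q (w m)" for m by (simp add: w_def word_perm_def)
  have w_image: "w m ` {..<k} = (fold greedy q ^^ m) {..<k}" for m k
    by (simp add: w_def word_perm_image fold_greedy_replicate)
  define N where "N m = {k \<in> {1..<n}. m < e k}" for m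
  have step: "card (inversions n (w m)) + card (N m) \<le> card (inversions n (w (Suc m)))"
    if m: "1 \<le> m" for m
  proof -
    have "N m \<subseteq> {k \<in> {1..<n}. foldr rstep q (w m) ` {..<k} \<noteq> w m ` {..<k}}"
    proof
      fix k assume "k \<in> N m"
      then have k: "k \<in> {1..<n}" and mk: "m < e k" by (auto simp: N_def)
      let ?g = "fold greedy q"
      have "(?g ^^ Suc m) {..<k} \<noteq> (?g ^^ m) {..<k}"
      proof
        assume stall: "(?g ^^ Suc m) {..<k} = (?g ^^ m) {..<k}"
        have const: "(?g ^^ (m + d)) {..<k} = (?g ^^ m) {..<k}" for d
          using stall by (induction d) auto
        obtain M where M: "(?g ^^ M) {..<k} = {n - k..<n}" using fin[OF k] by blast
        \<comment> \<open>The orbit stays at the top from time \<open>M\<close> on and, if stalled,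
          is constant from time \<open>m\<close> on. Comparison at time \<open>m + M\<close> puts
          the top already at time \<open>m\<close>, below the exponent.\<close>
        have top: "(?g ^^ (M + d)) {..<k} = {n - k..<n}" for d
          using M k fold_greedy_top[OF q, of k] by (induction d) auto
        have "(?g ^^ m) {..<k} = {n - k..<n}"
          using const[of M] top[of m] by (simp add: add.commute)
        then show False using low[OF k m mk] by blast
      qed
      then show "k \<in> {k \<in> {1..<n}. foldr rstep q (w m) ` {..<k} \<noteq> w m ` {..<k}}"
        using k by (simp flip: w_Suc add: w_image)
    qed
    then have "card (N m) \<le> card {k \<in> {1..<n}. foldr rstep q (w m) ` {..<k} \<noteq> w m ` {..<k}}"
      by (intro card_mono) auto
    then show ?thesis using card_inversions_foldr_rstep[OF q, of "w m"] by (simp add: w_Suc)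
  qed
  \<comment> \<open>The telescoping starts at the first copy, whose inversions are the term that
    survives in the final bound.\<close>
  have total: "card (inversions n (w 1)) + (\<Sum>m = 1..M. card (N m)) \<le> card (inversions n (w (Suc M)))" for M
  proof (induction M)
    case (Suc M)
    then show ?case using step[of "Suc M"] by simp
  qed simp
  \<comment> \<open>Chosen only as a common upper bound of the exponents, so that the sum over
    \<open>m\<close> up to \<open>M\<close> sees every pair with \<open>m < e k\<close>.\<close>
  define M where "M = (\<Sum>k\<in>{1..<n}. e k)"
  have eM: "e k \<le> M" if "k \<in> {1..<n}" for k unfolding M_def using that by (simp add: member_le_sum)
  have "(\<Sum>m = 1..M. card (N m)) = (\<Sum>m = 1..M. \<Sum>k\<in>{1..<n}. if m < e k then 1 else 0)"
    by (simp add: N_def sum.If_cases Int_def)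
  also have "\<dots> = (\<Sum>k\<in>{1..<n}. \<Sum>m = 1..M. if m < e k then 1 else 0)" by (rule sum.swap)
  also have "\<dots> = (\<Sum>k\<in>{1..<n}. e k - 1)"
  proof (rule sum.cong[OF refl])
    fix k assume k: "k \<in> {1..<n}"
    have "{1..M} \<inter> {m. m < e k} = {1..<e k}" using eM[OF k] by auto
    then show "(\<Sum>m = 1..M. if m < e k then 1 else 0) = e k - 1" by (simp add: sum.If_cases)
  qed
  finally have "(\<Sum>m = 1..M. card (N m)) = (\<Sum>k\<in>{1..<n}. e k - 1)" .
  moreover have "(\<Sum>k\<in>{1..<n}. e k) = (\<Sum>k\<in>{1..<n}. (e k - 1) + 1)"
  proof (rule sum.cong[OF refl])
    fix k assume "k \<in> {1..<n}"
    then show "e k = (e k - 1) + 1" using pos[of k] by simp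
  qed
  moreover have "(\<Sum>k\<in>{1..<n}. (e k - 1) + 1) = (\<Sum>k\<in>{1..<n}. e k - 1) + (n - 1)"
    by (subst sum.distrib) simp
  moreover have "card (inversions n (w 1)) = card (inversions n (word_perm q))" by (simp add: w_def)
  ultimately show ?thesis using total[of M] card_inversions_le[of n "w (Suc M)"] by linarith
qed

text \<open>The coset normal form of the symmetric group on \<open>j + 1\<close> points: for each
  letter one ascending run ending there, the run with the highest end first. The choice
  \<open>r = Suc j\<close> makes the run empty.\<close>

inductive normal_word :: "nat \<Rightarrow> nat list \<Rightarrow> bool" where
  "normal_word 0 []"
| "normal_word j q \<Longrightarrow> r \<le> Suc j \<Longrightarrow> normal_word (Suc j) ([r..<Suc j] @ q)"

text \<open>The letters act from \<open>j\<close> down to \<open>r\<close> and carry the value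
  \<open>Suc j\<close> leftwards. It exceeds every value it passes, so no step is idle and each
  letter adds an inversion.\<close>

lemma foldr_rstep_interval:
  assumes "r \<le> Suc j" "Suc j < n" "P (Suc j) = Suc j" "\<forall>a\<le>j. P a \<le> j"
  shows "let Q = foldr rstep [r..<Suc j] P in Q r = Suc j \<and> (\<forall>a<r. Q a = P a) \<and>
    (\<forall>a>Suc j. Q a = P a) \<and> (\<forall>a\<le>Suc j. Q a \<le> Suc j) \<and>
    card (inversions n P) + (Suc j - r) \<le> card (inversions n Q)"
  using assms(1)
proof (induction r rule: inc_induct)
  case base
  then show ?case using assms by (auto simp: le_Suc_eq)
next
  case (step r)
  let ?Q = "foldr rstep [Suc r..<Suc j] P"
  have eq: "foldr rstep [r..<Suc j] P = rstep r ?Q" using step(2) by (subst upt_rec) simp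
  have IH: "?Q (Suc r) = Suc j" "\<forall>a<Suc r. ?Q a = P a" "\<forall>a>Suc j. ?Q a = P a"
    "\<forall>a\<le>Suc j. ?Q a \<le> Suc j" "card (inversions n P) + (Suc j - Suc r) \<le> card (inversions n ?Q)"
    using step.IH by (auto simp: Let_def simp del: upt_Suc)
  have lt: "?Q r < ?Q (Suc r)" using IH assms(4) step(2) by (simp add: less_Suc_eq_le)
  then have R: "rstep r ?Q = ?Q \<circ> Transposition.transpose r (Suc r)" by (simp add: rstep_def)
  have "Suc (card (inversions n ?Q)) \<le> card (inversions n (rstep r ?Q))"
    using lt assms(2) step(2) by (intro card_inversions_rstep) auto
  moreover have "rstep r ?Q r = Suc j" "\<forall>a<r. rstep r ?Q a = P a" "\<forall>a>Suc j. rstep r ?Q a = P a"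
    "\<forall>a\<le>Suc j. rstep r ?Q a \<le> Suc j"
    using IH step(2) by (auto simp: R Transposition.transpose_def simp del: upt_Suc)
  ultimately show ?case unfolding Let_def eq using IH(5) step(2) by (auto simp del: upt_Suc)
qed

lemma normal_word_reduced:
  assumes "normal_word j q" "j < n"
  shows "length q \<le> card (inversions n (word_perm q)) \<and> (\<forall>a\<le>j. word_perm q a \<le> j) \<and>
    (\<forall>a>j. word_perm q a = a)"
  using assms
proof (induction rule: normal_word.induct)
  case (2 j q r)
  have "word_perm ([r..<Suc j] @ q) = foldr rstep [r..<Suc j] (word_perm q)"
    by (simp add: word_perm_def del: upt_Suc)
  then show ?case
    using 2 foldr_rstep_interval[of r j n "word_perm q"] by (auto simp: Let_def simp del: upt_Suc)
qed (simp add: word_perm_def)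

lemma normal_word_letters: "normal_word j q \<Longrightarrow> i \<in> set q \<Longrightarrow> i < j"
  by (induction rule: normal_word.induct) auto

section \<open>Minors and elementary factors\<close>

text \<open>Makes \<open>pick\<close> computable: any increasing enumeration with the right image is
  the one used by \<open>submatrix\<close>.\<close>

lemma pick_unique:
  assumes f: "strict_mono_on {..<k} f" and img: "f ` {..<k} = I" and r: "r < k"
  shows "pick I r = f r"
proof -
  have less: "f s < f r \<longleftrightarrow> s < r" if "s < k" for s
    using strict_mono_on_less[OF f] that r by simp
  have "{a \<in> I. a < f r} = f ` {..<r}" unfolding img[symmetric] using less r by force
  moreover have "inj_on f {..<r}"
    using strict_mono_on_imp_inj_on[OF f] r by (meson inj_on_subset lessThan_subset_iff less_imp_le)
  ultimately have "card {a \<in> I. a < f r} = r" by (simp add: card_image)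
  moreover have "f r \<in> I" using img r by blast
  ultimately show ?thesis using pick_card_in_set[of "f r" I] by simp
qed

lemma pick_strict_mono: "strict_mono_on {..<card I} (pick I)"
  by (auto simp: strict_mono_on_def intro: pick_mono_le)

lemma pick_image: "finite I \<Longrightarrow> pick I ` {..<card I} = I"
  by (intro card_subset_eq)
    (auto simp: card_image strict_mono_on_imp_inj_on[OF pick_strict_mono] intro: pick_in_set_le)

text \<open>By \<open>adj\<close> no index lies strictly between \<open>i\<close> and
  \<open>j\<close>, so \<open>j\<close> inherits the rank of \<open>i\<close>. This is why replacing
  a row index causes no sign in the minors.\<close>

lemma pick_replace:
  assumes fin: "finite I" and i: "i \<in> I" and j: "j \<notin> I"
    and adj: "\<And>x. x \<noteq> i \<Longrightarrow> x \<noteq> j \<Longrightarrow> x < i \<longleftrightarrow> x < j" and r: "r < card I"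
  shows "pick (insert j (I - {i})) r = (if pick I r = i then j else pick I r)"
proof (rule pick_unique[where f = "\<lambda>r. if pick I r = i then j else pick I r" and k = "card I"])
  have pI: "pick I s \<in> I" if "s < card I" for s using that by (rule pick_in_set_le)
  show "strict_mono_on {..<card I} (\<lambda>r. if pick I r = i then j else pick I r)"
  proof (rule strict_mono_onI)
    fix r s assume rs: "r \<in> {..<card I}" "s \<in> {..<card I}" "r < s"
    then have "pick I r < pick I s" by (auto intro: pick_mono_le)
    moreover have "pick I r \<noteq> j" "pick I s \<noteq> j" using pI rs j by auto
    ultimately show "(if pick I r = i then j else pick I r) < (if pick I s = i then j else pick I s)"
      using adj[of "pick I r"] adj[of "pick I s"] by (auto simp: nat_neq_iff)
  qed
  have "(\<lambda>x. if x = i then j else x) ` (pick I ` {..<card I}) = insert j (I - {i})"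
    unfolding pick_image[OF fin] using i by auto
  then show "(\<lambda>r. if pick I r = i then j else pick I r) ` {..<card I} = insert j (I - {i})"
    by (simp only: image_image)
qed (rule r)

lemma pick_interval: "r < k \<Longrightarrow> pick {s..<s + k} r = s + r"
proof (rule pick_unique[where f = "\<lambda>r. s + r" and k = k])
  show "(+) s ` {..<k} = {s..<s + k}"
    by (auto simp: image_iff) (metis add_diff_inverse_nat less_diff_conv2 not_less nat_add_left_cancel_less lessThan_iff)
qed (auto simp: strict_mono_on_def)

lemma pick_lessThan: "r < k \<Longrightarrow> pick {..<k} r = r"
  using pick_interval[of r k 0] by (simp add: lessThan_atLeast0)

lemma minor_eq_det:
  assumes "A \<in> carrier_mat n m" "I \<subseteq> {..<n}" "J \<subseteq> {..<m}" "card I = k" "card J = k"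
  shows "minor A I J = det (mat k k (\<lambda>(r, c). A $$ (pick I r, pick J c)))"
proof -
  have "{i. i < n \<and> i \<in> I} = I" "{j. j < m \<and> j \<in> J} = J" using assms by auto
  then show ?thesis using assms by (simp add: minor_def submatrix_def)
qed

lemma pick_less: "I \<subseteq> {..<n} \<Longrightarrow> r < card I \<Longrightarrow> pick I r < n"
  using pick_in_set_le by blast

lemma minor_transpose:
  assumes "A \<in> carrier_mat n m" "I \<subseteq> {..<n}" "J \<subseteq> {..<m}" "card I = card J"
  shows "minor (transpose_mat A) J I = minor A I J"
proof -
  have 1: "minor (transpose_mat A) J I
      = det (mat (card J) (card J) (\<lambda>(r, c). transpose_mat A $$ (pick J r, pick I c)))"
    by (rule minor_eq_det) (use assms in auto)
  have 2: "minor A I J = det (mat (card J) (card J) (\<lambda>(r, c). A $$ (pick I r, pick J c)))"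
    by (rule minor_eq_det) (use assms in auto)
  have "mat (card J) (card J) (\<lambda>(r, c). transpose_mat A $$ (pick J r, pick I c))
      = transpose_mat (mat (card J) (card J) (\<lambda>(r, c). A $$ (pick I r, pick J c)))"
    by (rule eq_matI) (use assms pick_less in auto)
  then show ?thesis unfolding 1 2 by (simp add: det_transpose[of _ "card J"])
qed

lemma det_mat_permutes:
  "det (mat k k (\<lambda>(r, c). F r c)) = (\<Sum>p | p permutes {0..<k}. signof p * (\<Prod>r = 0..<k. F r (p r)))"
proof -
  have "(\<Prod>r = 0..<k. mat k k (\<lambda>(r, c). F r c) $$ (r, p r)) = (\<Prod>r = 0..<k. F r (p r))"
    if "p permutes {0..<k}" for p
  proof (rule prod.cong[OF refl])
    fix r assume "r \<in> {0..<k}"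
    then have "r < k" "p r < k" using permutes_in_image[OF that, of r] by auto
    then show "mat k k (\<lambda>(r, c). F r c) $$ (r, p r) = F r (p r)" by simp
  qed
  then show ?thesis by (subst det_def'[of _ k]) (auto intro: sum.cong)
qed

lemma det_mat_row_add:
  fixes a :: "'a :: comm_ring_1"
  assumes "s < k"
  shows "det (mat k k (\<lambda>(r, c). F r c + (if r = s then a * v c else 0)))
    = det (mat k k (\<lambda>(r, c). F r c)) + a * det (mat k k (\<lambda>(r, c). if r = s then v c else F r c))"
proof -
  let ?P = "\<lambda>p. \<Prod>r\<in>{0..<k} - {s}. F r (p r)"
  have split: "(\<Prod>r = 0..<k. G r (p r)) = G s (p s) * ?P p"
    if "\<And>r c. r \<noteq> s \<Longrightarrow> G r c = F r c" for G p
  proof -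
    have "(\<Prod>r = 0..<k. G r (p r)) = G s (p s) * (\<Prod>r\<in>{0..<k} - {s}. G r (p r))"
      using assms by (intro prod.remove) auto
    also have "(\<Prod>r\<in>{0..<k} - {s}. G r (p r)) = ?P p"
      using that by (intro prod.cong) auto
    finally show ?thesis .
  qed
  have "(\<Prod>r = 0..<k. F r (p r) + (if r = s then a * v (p r) else 0))
      = (\<Prod>r = 0..<k. F r (p r)) + a * (\<Prod>r = 0..<k. if r = s then v (p r) else F r (p r))" for p
    using split[of "\<lambda>r c. F r c + (if r = s then a * v c else 0)" p] split[of F p]
      split[of "\<lambda>r c. if r = s then v c else F r c" p]
    by (simp add: algebra_simps)
  then have "det (mat k k (\<lambda>(r, c). F r c + (if r = s then a * v c else 0)))
    = (\<Sum>p | p permutes {0..<k}. signof p * (\<Prod>r = 0..<k. F r (p r))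
        + a * (signof p * (\<Prod>r = 0..<k. if r = s then v (p r) else F r (p r))))"
    unfolding det_mat_permutes by (intro sum.cong) (auto simp: algebra_simps)
  then show ?thesis unfolding det_mat_permutes by (simp only: sum.distrib sum_distrib_left)
qed

text \<open>Linearity in the changed row. If row \<open>j\<close> is selected too, the additional
  determinant has two equal rows and vanishes. With \<open>i\<close> and \<open>j\<close> adjacent
  in either order this covers upper factors and their transposes.\<close>

lemma minor_row_add:
  assumes B: "B \<in> carrier_mat n m" and B': "B' \<in> carrier_mat n m"
    and entries: "\<And>r c. r < n \<Longrightarrow> c < m \<Longrightarrow> B' $$ (r, c) = B $$ (r, c) + (if r = i then a * B $$ (j, c) else 0)"
    and ij: "i \<noteq> j" "i < n" "j < n" and adj: "\<And>x. x \<noteq> i \<Longrightarrow> x \<noteq> j \<Longrightarrow> x < i \<longleftrightarrow> x < j"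
    and I: "I \<subseteq> {..<n}" and J: "J \<subseteq> {..<m}" and card: "card I = k" "card J = k"
  shows "minor B' I J = minor B I J + (if i \<in> I \<and> j \<notin> I then a * minor B (insert j (I - {i})) J else 0)"
proof -
  have fI: "finite I" using I finite_subset by blast
  have B'_eq: "minor B' I J = det (mat k k (\<lambda>(r, c). B' $$ (pick I r, pick J c)))"
    by (rule minor_eq_det) fact+
  have B_eq: "minor B I J = det (mat k k (\<lambda>(r, c). B $$ (pick I r, pick J c)))"
    by (rule minor_eq_det) fact+
  have pI: "pick I r < n" if "r < k" for r using that pick_less[OF I] card by simp
  have pJ: "pick J c < m" if "c < k" for c using that pick_less[OF J] card by simp
  show ?thesis
  proof (cases "i \<in> I")
    case False
    have "pick I r \<noteq> i" if "r < k" for r using that False pick_in_set_le[of r I] card by auto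
    then have "mat k k (\<lambda>(r, c). B' $$ (pick I r, pick J c)) = mat k k (\<lambda>(r, c). B $$ (pick I r, pick J c))"
      by (intro cong_mat) (auto simp: entries pI pJ)
    then show ?thesis using False by (simp add: B'_eq B_eq)
  next
    case True
    have img: "pick I ` {..<k} = I" using pick_image[OF fI] card by simp
    have ex: "\<exists>r<k. pick I r = x" if "x \<in> I" for x
      using that img by (metis imageE lessThan_iff)
    obtain s where s: "s < k" "pick I s = i" using ex[OF True] by blast
    have inj: "inj_on (pick I) {..<k}"
      using strict_mono_on_imp_inj_on[OF pick_strict_mono[of I]] card by simp
    have row: "pick I r = i \<longleftrightarrow> r = s" if "r < k" for r
      using inj_onD[OF inj, of r s] s that by auto
    let ?C = "mat k k (\<lambda>(r, c). if r = s then B $$ (j, pick J c) else B $$ (pick I r, pick J c))"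
    have "mat k k (\<lambda>(r, c). B' $$ (pick I r, pick J c))
        = mat k k (\<lambda>(r, c). B $$ (pick I r, pick J c) + (if r = s then a * B $$ (j, pick J c) else 0))"
      by (intro cong_mat) (auto simp: entries pI pJ row)
    then have step: "minor B' I J = minor B I J + a * det ?C"
      using det_mat_row_add[OF s(1), of "\<lambda>r c. B $$ (pick I r, pick J c)" a "\<lambda>c. B $$ (j, pick J c)"]
      by (simp add: B'_eq B_eq)
    show ?thesis
    proof (cases "j \<in> I")
      case j: True
      obtain t where t: "t < k" "pick I t = j" using ex[OF j] by blast
      have "s \<noteq> t" using s t ij by auto
      moreover have "row ?C s = row ?C t"
        by (rule eq_vecI) (use s t \<open>s \<noteq> t\<close> in auto)
      ultimately have "det ?C = 0" using s t by (intro det_identical_rows[of _ k s t]) auto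
      then show ?thesis using step j by simp
    next
      case j: False
      let ?I = "insert j (I - {i})"
      have "card ?I = k" using card True j fI by (simp add: card_Diff_singleton) (metis card_gt_0_iff Suc_pred empty_iff)
      then have "minor B ?I J = det (mat k k (\<lambda>(r, c). B $$ (pick ?I r, pick J c)))"
        using B I J ij card by (intro minor_eq_det) auto
      also have "mat k k (\<lambda>(r, c). B $$ (pick ?I r, pick J c)) = ?C"
        by (intro cong_mat) (use pick_replace[OF fI True j adj] card row in auto)
      finally show ?thesis using step True j by simp
    qed
  qed
qed

lemma elem_upper_carrier [simp]: "elem_upper n i a \<in> carrier_mat n n"
  by (simp add: elem_upper_def)

lemma elem_upper_dim [simp]: "dim_row (elem_upper n i a) = n" "dim_col (elem_upper n i a) = n"
  by (simp_all add: elem_upper_def)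

lemma elem_upper_index:
  "r < n \<Longrightarrow> c < n \<Longrightarrow> elem_upper n i a $$ (r, c) = (if r = c then 1 else if r = i \<and> c = Suc i then a else 0)"
  by (simp add: elem_upper_def)

lemma elem_upper_mult_index:
  assumes "M \<in> carrier_mat n m" "r < n" "c < m" "Suc i < n"
  shows "(elem_upper n i a * M) $$ (r, c) = M $$ (r, c) + (if r = i then a * M $$ (Suc i, c) else 0)"
proof -
  have "(elem_upper n i a * M) $$ (r, c) = (\<Sum>l = 0..<n. elem_upper n i a $$ (r, l) * M $$ (l, c))"
    using assms by (simp add: scalar_prod_def)
  also have "\<dots> = (\<Sum>l = 0..<n. (if l = r then M $$ (r, c) else 0)
      + (if l = Suc i then (if r = i then a * M $$ (Suc i, c) else 0) else 0))"
    using assms by (intro sum.cong) (auto simp: elem_upper_index)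
  finally show ?thesis using assms by (simp add: sum.distrib)
qed

lemma transpose_elem_upper_mult_index:
  assumes "M \<in> carrier_mat n m" "r < n" "c < m" "Suc i < n"
  shows "(transpose_mat (elem_upper n i a) * M) $$ (r, c)
    = M $$ (r, c) + (if r = Suc i then a * M $$ (i, c) else 0)"
proof -
  have "(transpose_mat (elem_upper n i a) * M) $$ (r, c)
      = (\<Sum>l = 0..<n. elem_upper n i a $$ (l, r) * M $$ (l, c))"
    using assms by (simp add: scalar_prod_def)
  also have "\<dots> = (\<Sum>l = 0..<n. (if l = r then M $$ (r, c) else 0)
      + (if l = i then (if r = Suc i then a * M $$ (i, c) else 0) else 0))"
    using assms by (intro sum.cong) (auto simp: elem_upper_index)
  finally show ?thesis using assms by (simp add: sum.distrib)
qed

lemma mult_elem_upper_index: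
  assumes "M \<in> carrier_mat m n" "r < m" "c < n" "Suc i < n"
  shows "(M * elem_upper n i a) $$ (r, c) = M $$ (r, c) + (if c = Suc i then a * M $$ (r, i) else 0)"
proof -
  have "(M * elem_upper n i a) $$ (r, c) = (\<Sum>l = 0..<n. M $$ (r, l) * elem_upper n i a $$ (l, c))"
    using assms by (simp add: scalar_prod_def)
  also have "\<dots> = (\<Sum>l = 0..<n. (if l = c then M $$ (r, c) else 0)
      + (if l = i then (if c = Suc i then a * M $$ (r, i) else 0) else 0))"
    using assms by (intro sum.cong) (auto simp: elem_upper_index)
  finally show ?thesis using assms by (simp add: sum.distrib)
qed

lemma minor_elem_upper_mult:
  assumes B: "B \<in> carrier_mat n m" and i: "Suc i < n"
    and I: "I \<subseteq> {..<n}" and J: "J \<subseteq> {..<m}" and card: "card I = card J"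
  shows "minor (elem_upper n i a * B) I J
    = minor B I J + (if i \<in> I \<and> Suc i \<notin> I then a * minor B (shift i I) J else 0)"
  unfolding shift_def
  by (rule minor_row_add[of B n m]) (use assms in \<open>auto simp: elem_upper_mult_index simp del: index_mult_mat(1)\<close>)

lemma minor_transpose_elem_upper_mult:
  assumes B: "B \<in> carrier_mat n m" and i: "Suc i < n"
    and I: "I \<subseteq> {..<n}" and J: "J \<subseteq> {..<m}" and card: "card I = card J"
  shows "minor (transpose_mat (elem_upper n i a) * B) I J
    = minor B I J + (if Suc i \<in> I \<and> i \<notin> I then a * minor B (insert i (I - {Suc i})) J else 0)"
  by (rule minor_row_add[of B n m]) (use assms in \<open>auto simp: transpose_elem_upper_mult_index simp del: index_mult_mat(1)\<close>)

section \<open>Positivity patterns of the powers\<close>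

definition nonneg_minors :: "nat \<Rightarrow> nat \<Rightarrow> real mat \<Rightarrow> bool" where
  "nonneg_minors k n M \<longleftrightarrow>
     (\<forall>I J. I \<subseteq> {..<n} \<longrightarrow> J \<subseteq> {..<n} \<longrightarrow> card I = k \<longrightarrow> card J = k \<longrightarrow> 0 \<le> minor M I J)"

text \<open>Encoded as a relation so that, with nonnegative minors and hence no cancellation,
  multiplying matrices becomes composing relations.\<close>

definition pos_minors :: "nat \<Rightarrow> nat \<Rightarrow> real mat \<Rightarrow> (nat set \<times> nat set) set" where
  "pos_minors k n M =
     {(I, J). I \<subseteq> {..<n} \<and> J \<subseteq> {..<n} \<and> card I = k \<and> card J = k \<and> 0 < minor M I J}"

text \<open>Hides the parameters and keeps the word, since positivity patterns depend on the word
  alone.\<close>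

definition factored :: "nat \<Rightarrow> nat list \<Rightarrow> real mat \<Rightarrow> bool" where
  "factored n q U \<longleftrightarrow>
     (\<exists>ps. map fst ps = q \<and> (\<forall>p\<in>set ps. 0 < snd p) \<and> U = elem_upper_prod n ps)"

lemma elem_upper_prod_Nil [simp]: "elem_upper_prod n [] = 1\<^sub>m n"
  by (simp add: elem_upper_prod_def)

lemma elem_upper_prod_Cons [simp]:
  "elem_upper_prod n (p # ps) = elem_upper n (fst p) (snd p) * elem_upper_prod n ps"
  by (simp add: elem_upper_prod_def split: prod.split)

lemma elem_upper_prod_carrier [simp]: "elem_upper_prod n ps \<in> carrier_mat n n"
  by (induction ps) auto

lemma elem_upper_prod_append:
  "elem_upper_prod n (ps @ qs) = elem_upper_prod n ps * elem_upper_prod n qs"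
proof (induction ps)
  case Nil
  show ?case by (simp add: left_mult_one_mat[of _ n n])
next
  case (Cons p ps)
  then show ?case by (simp add: assoc_mult_mat[of _ n n _ n _ n])
qed

lemma factored_carrier: "factored n q U \<Longrightarrow> U \<in> carrier_mat n n"
  by (auto simp: factored_def)

lemma factored_Nil: "factored n [] U \<longleftrightarrow> U = 1\<^sub>m n"
  by (auto simp: factored_def)

lemma factored_Cons:
  "factored n (i # q) U \<longleftrightarrow> (\<exists>a M. 0 < a \<and> factored n q M \<and> U = elem_upper n i a * M)"
proof
  assume "factored n (i # q) U"
  then obtain ps where ps: "map fst ps = i # q" "\<forall>p\<in>set ps. 0 < snd p" "U = elem_upper_prod n ps"
    unfolding factored_def by metis
  then obtain p ps' where "ps = p # ps'" by (cases ps) auto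
  then show "\<exists>a M. 0 < a \<and> factored n q M \<and> U = elem_upper n i a * M"
    using ps unfolding factored_def
    by (intro exI[of _ "snd p"] exI[of _ "elem_upper_prod n ps'"]) auto
next
  assume "\<exists>a M. 0 < a \<and> factored n q M \<and> U = elem_upper n i a * M"
  then obtain a ps where "0 < a" "map fst ps = q" "\<forall>p\<in>set ps. 0 < snd p"
    "U = elem_upper n i a * elem_upper_prod n ps"
    by (auto simp: factored_def)
  then show "factored n (i # q) U"
    unfolding factored_def by (intro exI[of _ "(i, a) # ps"]) auto
qed

text \<open>A new minor is an old one plus a positive multiple of the minor after the hop. Both
  terms are nonnegative, so the sum is positive exactly when one of them is.\<close>

lemma pos_minors_hop:
  assumes B: "B \<in> carrier_mat n n" and i: "Suc i < n" and a: "0 < a" and nn: "nonneg_minors k n B"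
  shows "nonneg_minors k n (elem_upper n i a * B)"
    and "pos_minors k n (elem_upper n i a * B) = hop i O pos_minors k n B"
proof -
  have m: "minor (elem_upper n i a * B) I J
      = minor B I J + (if i \<in> I \<and> Suc i \<notin> I then a * minor B (shift i I) J else 0)"
    if "I \<subseteq> {..<n}" "J \<subseteq> {..<n}" "card I = k" "card J = k" for I J
    using that by (intro minor_elem_upper_mult[OF B i]) auto
  have ge: "0 \<le> minor B I J" if "I \<subseteq> {..<n}" "J \<subseteq> {..<n}" "card I = k" "card J = k" for I J
    using nn that by (simp add: nonneg_minors_def)
  have sh: "card (shift i I) = card I" if "I \<subseteq> {..<n}" "i \<in> I" "Suc i \<notin> I" for I
    using that card_shift finite_subset[OF that(1)] by auto
  have ge': "0 \<le> a * minor B (shift i I) J"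
    if "I \<subseteq> {..<n}" "J \<subseteq> {..<n}" "card I = k" "card J = k" "i \<in> I" "Suc i \<notin> I" for I J
    using that ge[of "shift i I" J] sh[of I] shift_subset[OF that(1) i] a by simp
  show "nonneg_minors k n (elem_upper n i a * B)"
    unfolding nonneg_minors_def using m ge ge' by (auto intro!: add_nonneg_nonneg)
  \<comment> \<open>The composed relation restricts only the middle set; this transfers size and
    range back to the row set before the hop.\<close>
  have preserved: "I \<subseteq> {..<n} \<and> card I = k" if "(I, K) \<in> hop i" "K \<subseteq> {..<n}" "card K = k" for I K
  proof (cases "K = I")
    case False
    then have I: "i \<in> I" "Suc i \<notin> I" "K = shift i I" using that by (auto simp: hop_def)
    then have "I \<subseteq> insert i K" by (auto simp: shift_def)
    then have "I \<subseteq> {..<n}" using that i by auto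
    then show ?thesis using sh I that by auto
  qed (use that in auto)
  show "pos_minors k n (elem_upper n i a * B) = hop i O pos_minors k n B"
  proof (rule Set.set_eqI, clarify)
    fix I J
    show "(I, J) \<in> pos_minors k n (elem_upper n i a * B) \<longleftrightarrow> (I, J) \<in> hop i O pos_minors k n B"
    proof
      assume "(I, J) \<in> pos_minors k n (elem_upper n i a * B)"
      then have IJ: "I \<subseteq> {..<n}" "J \<subseteq> {..<n}" "card I = k" "card J = k"
        and pos: "0 < minor B I J + (if i \<in> I \<and> Suc i \<notin> I then a * minor B (shift i I) J else 0)"
        by (auto simp: pos_minors_def m)
      show "(I, J) \<in> hop i O pos_minors k n B"
      proof (cases "0 < minor B I J")
        case True
        have "(I, I) \<in> hop i" by (simp add: hop_def)
        then show ?thesis using True IJ by (auto simp: pos_minors_def)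
      next
        case False
        then have I: "i \<in> I" "Suc i \<notin> I" "0 < a * minor B (shift i I) J"
          using pos by (auto split: if_splits)
        have "(I, shift i I) \<in> hop i" using I by (simp add: hop_def)
        moreover have "(shift i I, J) \<in> pos_minors k n B"
          using I IJ a sh[of I] shift_subset[OF IJ(1) i] by (simp add: pos_minors_def zero_less_mult_iff)
        ultimately show ?thesis by auto
      qed
    next
      assume "(I, J) \<in> hop i O pos_minors k n B"
      then obtain K where K: "(I, K) \<in> hop i" "K \<subseteq> {..<n}" "card K = k" "J \<subseteq> {..<n}" "card J = k"
        "0 < minor B K J" by (auto simp: pos_minors_def)
      have I: "I \<subseteq> {..<n}" "card I = k" using preserved[OF K(1-3)] by auto
      have "0 < minor (elem_upper n i a * B) I J"
      proof (cases "K = I")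
        case True
        then show ?thesis using K I m[of I J] ge'[of I J] by (auto intro: add_pos_nonneg)
      next
        case False
        then have "i \<in> I" "Suc i \<notin> I" "K = shift i I" using K by (auto simp: hop_def)
        then show ?thesis using K I m[of I J] ge[of I J] a by (auto intro: add_nonneg_pos)
      qed
      then show "(I, J) \<in> pos_minors k n (elem_upper n i a * B)" using I K by (simp add: pos_minors_def)
    qed
  qed
qed

lemma pos_minors_transpose_hop:
  assumes B: "B \<in> carrier_mat n n" and i: "Suc i < n" and a: "0 < a" and nn: "nonneg_minors k n B"
  shows "nonneg_minors k n (transpose_mat (elem_upper n i a) * B)"
    and "pos_minors k n (transpose_mat (elem_upper n i a) * B) = (hop i)\<inverse> O pos_minors k n B"
proof -
  let ?d = "\<lambda>I. insert i (I - {Suc i})"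
  have m: "minor (transpose_mat (elem_upper n i a) * B) I J
      = minor B I J + (if Suc i \<in> I \<and> i \<notin> I then a * minor B (?d I) J else 0)"
    if "I \<subseteq> {..<n}" "J \<subseteq> {..<n}" "card I = k" "card J = k" for I J
    using that by (intro minor_transpose_elem_upper_mult[OF B i]) auto
  have ge: "0 \<le> minor B I J" if "I \<subseteq> {..<n}" "J \<subseteq> {..<n}" "card I = k" "card J = k" for I J
    using nn that by (simp add: nonneg_minors_def)
  have sh: "card (?d I) = card I" if "I \<subseteq> {..<n}" "Suc i \<in> I" "i \<notin> I" for I
    using that finite_subset[OF that(1)]
    by (metis DiffD1 card_Suc_Diff1 card_insert_disjoint finite_Diff finite_lessThan)
  have sub: "?d I \<subseteq> {..<n}" if "I \<subseteq> {..<n}" for I using that i by auto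
  have ge': "0 \<le> a * minor B (?d I) J"
    if "I \<subseteq> {..<n}" "J \<subseteq> {..<n}" "card I = k" "card J = k" "Suc i \<in> I" "i \<notin> I" for I J
    using that ge[of "?d I" J] sh[of I] sub[OF that(1)] a by simp
  show "nonneg_minors k n (transpose_mat (elem_upper n i a) * B)"
    unfolding nonneg_minors_def using m ge ge' by (auto intro!: add_nonneg_nonneg)
  have hop: "(K, I) \<in> hop i \<longleftrightarrow> K = I \<or> Suc i \<in> I \<and> i \<notin> I \<and> K = ?d I" for I K
    unfolding hop_def shift_def by auto
  have preserved: "I \<subseteq> {..<n} \<and> card I = k" if "(K, I) \<in> hop i" "K \<subseteq> {..<n}" "card K = k" for I K
  proof (cases "K = I")
    case False
    then have I: "Suc i \<in> I" "i \<notin> I" "K = ?d I" using that hop by auto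
    then have "I \<subseteq> insert (Suc i) K" by auto
    then have "I \<subseteq> {..<n}" using that i by auto
    then show ?thesis using sh I that by auto
  qed (use that in auto)
  show "pos_minors k n (transpose_mat (elem_upper n i a) * B) = (hop i)\<inverse> O pos_minors k n B"
  proof (rule Set.set_eqI, clarify)
    fix I J
    show "(I, J) \<in> pos_minors k n (transpose_mat (elem_upper n i a) * B)
      \<longleftrightarrow> (I, J) \<in> (hop i)\<inverse> O pos_minors k n B"
    proof
      assume "(I, J) \<in> pos_minors k n (transpose_mat (elem_upper n i a) * B)"
      then have IJ: "I \<subseteq> {..<n}" "J \<subseteq> {..<n}" "card I = k" "card J = k"
        and pos: "0 < minor B I J + (if Suc i \<in> I \<and> i \<notin> I then a * minor B (?d I) J else 0)"
        by (auto simp: pos_minors_def m)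
      show "(I, J) \<in> (hop i)\<inverse> O pos_minors k n B"
      proof (cases "0 < minor B I J")
        case True
        have "(I, I) \<in> (hop i)\<inverse>" by (simp add: hop_def)
        then show ?thesis using True IJ by (auto simp: pos_minors_def)
      next
        case False
        then have I: "Suc i \<in> I" "i \<notin> I" "0 < a * minor B (?d I) J"
          using pos by (auto split: if_splits)
        have "(I, ?d I) \<in> (hop i)\<inverse>" using I hop by simp
        moreover have "(?d I, J) \<in> pos_minors k n B"
          using I IJ a sh[of I] sub[OF IJ(1)] by (simp add: pos_minors_def zero_less_mult_iff)
        ultimately show ?thesis by blast
      qed
    next
      assume "(I, J) \<in> (hop i)\<inverse> O pos_minors k n B"
      then obtain K where K: "(K, I) \<in> hop i" "K \<subseteq> {..<n}" "card K = k" "J \<subseteq> {..<n}" "card J = k"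
        "0 < minor B K J" by (auto simp: pos_minors_def)
      have I: "I \<subseteq> {..<n}" "card I = k" using preserved[OF K(1-3)] by auto
      have "0 < minor (transpose_mat (elem_upper n i a) * B) I J"
      proof (cases "K = I")
        case True
        then show ?thesis using K I m[of I J] ge'[of I J] by (auto intro: add_pos_nonneg)
      next
        case False
        then have "Suc i \<in> I" "i \<notin> I" "K = ?d I" using K hop by auto
        then show ?thesis using K I m[of I J] ge[of I J] a by (auto intro: add_nonneg_pos)
      qed
      then show "(I, J) \<in> pos_minors k n (transpose_mat (elem_upper n i a) * B)"
        using I K by (simp add: pos_minors_def)
    qed
  qed
qed

lemma diagonal_mult_index:
  assumes "D \<in> carrier_mat n n" "diagonal_mat D" "B \<in> carrier_mat n m" "r < n" "c < m"
  shows "(D * B) $$ (r, c) = D $$ (r, r) * B $$ (r, c)"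
proof -
  have "(D * B) $$ (r, c) = (\<Sum>l = 0..<n. D $$ (r, l) * B $$ (l, c))"
    using assms by (simp add: scalar_prod_def)
  also have "\<dots> = (\<Sum>l = 0..<n. if l = r then D $$ (r, r) * B $$ (r, c) else 0)"
    using assms by (intro sum.cong) (auto simp: diagonal_mat_def)
  finally show ?thesis using assms by simp
qed

lemma minor_diagonal_mult:
  assumes D: "D \<in> carrier_mat n n" "diagonal_mat D" and B: "B \<in> carrier_mat n m"
    and I: "I \<subseteq> {..<n}" and J: "J \<subseteq> {..<m}" and card: "card I = k" "card J = k"
  shows "minor (D * B) I J = (\<Prod>r = 0..<k. D $$ (pick I r, pick I r)) * minor B I J"
proof -
  have pI: "pick I r < n" if "r < k" for r using that pick_less[OF I] card by simp
  have pJ: "pick J c < m" if "c < k" for c using that pick_less[OF J] card by simp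
  have "minor (D * B) I J = det (mat k k (\<lambda>(r, c). (D * B) $$ (pick I r, pick J c)))"
    by (rule minor_eq_det) (use assms in auto)
  also have "mat k k (\<lambda>(r, c). (D * B) $$ (pick I r, pick J c))
      = mat k k (\<lambda>(r, c). D $$ (pick I r, pick I r) * B $$ (pick I r, pick J c))"
    by (intro cong_mat) (auto simp: diagonal_mult_index[OF D B] pI pJ simp del: index_mult_mat(1))
  also have "det \<dots> = (\<Prod>r = 0..<k. D $$ (pick I r, pick I r))
      * det (mat k k (\<lambda>(r, c). B $$ (pick I r, pick J c)))"
    by (simp add: det_mat_permutes prod.distrib sum_distrib_left mult.left_commute)
  also have "det (mat k k (\<lambda>(r, c). B $$ (pick I r, pick J c))) = minor B I J"
    by (rule minor_eq_det[symmetric]) (use assms in auto)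
  finally show ?thesis .
qed

lemma pos_minors_diagonal:
  assumes D: "D \<in> carrier_mat n n" "positive_diagonal D" and B: "B \<in> carrier_mat n n"
  shows "nonneg_minors k n B \<Longrightarrow> nonneg_minors k n (D * B)"
    and "pos_minors k n (D * B) = pos_minors k n B"
proof -
  have dD: "diagonal_mat D" and pD: "\<And>i. i < n \<Longrightarrow> 0 < D $$ (i, i)"
    using D by (auto simp: positive_diagonal_def)
  have scale: "\<exists>d>0. minor (D * B) I J = d * minor B I J"
    if "I \<subseteq> {..<n}" "J \<subseteq> {..<n}" "card I = k" "card J = k" for I J
  proof -
    have "0 < (\<Prod>r = 0..<k. D $$ (pick I r, pick I r))"
      by (intro prod_pos) (use pD pick_less[OF that(1)] that in auto)
    then show ?thesis using minor_diagonal_mult[OF D(1) dD B that(1,2,3,4)] by blast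
  qed
  show "nonneg_minors k n (D * B)" if "nonneg_minors k n B"
    unfolding nonneg_minors_def
  proof (intro allI impI)
    fix I J assume IJ: "I \<subseteq> {..<n}" "J \<subseteq> {..<n}" "card I = k" "card J = k"
    then have "0 \<le> minor B I J" using that by (simp add: nonneg_minors_def)
    then show "0 \<le> minor (D * B) I J" using scale[OF IJ] by auto
  qed
  have "0 < minor (D * B) I J \<longleftrightarrow> 0 < minor B I J"
    if "I \<subseteq> {..<n}" "J \<subseteq> {..<n}" "card I = k" "card J = k" for I J
    using scale[OF that] by (auto simp: zero_less_mult_iff)
  then show "pos_minors k n (D * B) = pos_minors k n B" unfolding pos_minors_def by auto
qed

lemma minor_one:
  assumes I: "I \<subseteq> {..<n}" and J: "J \<subseteq> {..<n}" and card: "card I = k" "card J = k"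
  shows "minor (1\<^sub>m n) I J = (if I = J then 1 else 0)"
proof -
  have pI: "pick I r < n" if "r < k" for r using that pick_less[OF I] card by simp
  have pJ: "pick J c < n" if "c < k" for c using that pick_less[OF J] card by simp
  have eq: "minor (1\<^sub>m n) I J = det (mat k k (\<lambda>(r, c). 1\<^sub>m n $$ (pick I r, pick J c)))"
    by (rule minor_eq_det) (use assms in auto)
  show ?thesis
  proof (cases "I = J")
    case True
    have "inj_on (pick I) {..<k}"
      using strict_mono_on_imp_inj_on[OF pick_strict_mono[of I]] card by simp
    then have "mat k k (\<lambda>(r, c). 1\<^sub>m n $$ (pick I r, pick J c)) = (1\<^sub>m k :: real mat)"
      by (intro eq_matI) (use True pJ in \<open>auto dest: inj_onD\<close>)
    then show ?thesis using eq True by simp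
  next
    case False
    have fin: "finite I" "finite J" using I J finite_subset by blast+
    then have "\<not> I \<subseteq> J" using False card card_subset_eq[OF fin(2), of I] by auto
    then obtain x where x: "x \<in> I" "x \<notin> J" by blast
    then have "x \<in> pick I ` {..<k}" using pick_image[OF fin(1)] card by simp
    then obtain s where s: "s < k" "pick I s = x" by auto
    \<comment> \<open>The row of the index \<open>x\<close> meets no column of \<open>J\<close> at
      the diagonal, so every Leibniz product has a zero factor.\<close>
    have "(\<Prod>r = 0..<k. 1\<^sub>m n $$ (pick I r, pick J (p r))) = (0::real)" if p: "p permutes {0..<k}" for p
    proof (rule prod_zero)
      have ps: "p s < k" using permutes_in_image[OF p, of s] s by simp
      then have "pick J (p s) \<noteq> x" using x pick_in_set_le[of "p s" J] card by auto
      then show "\<exists>r\<in>{0..<k}. 1\<^sub>m n $$ (pick I r, pick J (p r)) = (0::real)"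
        using s pI[OF s(1)] pJ[OF ps] by (intro bexI[of _ s]) auto
    qed simp
    then have "(\<Sum>p | p permutes {0..<k}. signof p * (\<Prod>r = 0..<k. 1\<^sub>m n $$ (pick I r, pick J (p r)))) = (0::real)"
      by (intro sum.neutral ballI) (simp only: mem_Collect_eq mult_zero_right)
    then show ?thesis unfolding eq det_mat_permutes using False by simp
  qed
qed

lemma pos_minors_factored:
  assumes "factored n q U" "\<forall>i\<in>set q. Suc i < n" "B \<in> carrier_mat n n" "nonneg_minors k n B"
  shows "nonneg_minors k n (U * B) \<and> pos_minors k n (U * B) = hops q O pos_minors k n B"
  using assms(1,2)
proof (induction q arbitrary: U)
  case Nil
  then show ?case using assms(3,4) by (simp add: factored_Nil)
next
  case (Cons i q)
  then obtain a M where a: "0 < a" and M: "factored n q M" and U: "U = elem_upper n i a * M"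
    by (auto simp: factored_Cons)
  have cM: "M \<in> carrier_mat n n" using M by (rule factored_carrier)
  have UB: "U * B = elem_upper n i a * (M * B)"
    unfolding U using cM assms(3) by (intro assoc_mult_mat[of _ n n _ n _ n]) auto
  have "nonneg_minors k n (M * B)" "pos_minors k n (M * B) = hops q O pos_minors k n B"
    using Cons.IH[OF M] Cons.prems by auto
  then show ?case
    using pos_minors_hop[of "M * B" n i a k] a cM assms(3) Cons.prems(2) by (simp add: UB O_assoc)
qed

lemma pos_minors_transpose_factored:
  assumes "factored n q U" "\<forall>i\<in>set q. Suc i < n" "B \<in> carrier_mat n n" "nonneg_minors k n B"
  shows "nonneg_minors k n (transpose_mat U * B) \<and>
    pos_minors k n (transpose_mat U * B) = (hops q)\<inverse> O pos_minors k n B"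
  using assms
proof (induction q arbitrary: U B)
  case Nil
  then show ?case by (simp add: factored_Nil)
next
  case (Cons i q)
  then obtain a M where a: "0 < a" and M: "factored n q M" and U: "U = elem_upper n i a * M"
    by (auto simp: factored_Cons)
  have cM: "M \<in> carrier_mat n n" using M by (rule factored_carrier)
  let ?y = "transpose_mat (elem_upper n i a)"
  have "transpose_mat U = transpose_mat M * ?y"
    unfolding U by (rule transpose_mult[of _ n n _ n]) (use cM in auto)
  then have UB: "transpose_mat U * B = transpose_mat M * (?y * B)"
    using cM Cons.prems(3) by (simp add: assoc_mult_mat[of _ n n _ n _ n])
  have yB: "?y * B \<in> carrier_mat n n" by (rule mult_carrier_mat[of _ n n]) (use Cons.prems in auto)
  have "Suc i < n" using Cons.prems by simp
  note step = pos_minors_transpose_hop[OF Cons.prems(3) this a Cons.prems(4)]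
  show ?case
    using Cons.IH[OF M _ yB step(1)] Cons.prems step(2) by (simp add: UB O_assoc converse_relcomp)
qed

text \<open>Serves both directions: for a given oscillatory matrix after its \<open>U\<close> has
  been factored, and for the extremal word, where oscillation is derived from the greedy
  dynamics.\<close>

locale symmetric_factorization =
  fixes n :: nat and q :: "nat list" and U D :: "real mat"
  assumes letters: "\<forall>i\<in>set q. Suc i < n" and U: "factored n q U"
    and D: "D \<in> carrier_mat n n" "positive_diagonal D"
begin

definition A :: "real mat" where "A = transpose_mat U * D * U"

lemma A_carrier [simp]: "A \<in> carrier_mat n n"
  unfolding A_def using factored_carrier[OF U] D by (metis mult_carrier_mat transpose_carrier_mat)

lemma pos_minors_mult:
  assumes B: "B \<in> carrier_mat n n" "nonneg_minors k n B"
  shows "nonneg_minors k n (A * B) \<and> pos_minors k n (A * B) = ((hops q)\<inverse> O hops q) O pos_minors k n B"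
proof -
  have cU: "U \<in> carrier_mat n n" using U by (rule factored_carrier)
  have cUt: "transpose_mat U \<in> carrier_mat n n" using cU by simp
  have cUB: "U * B \<in> carrier_mat n n" using cU B(1) by (rule mult_carrier_mat)
  have AB: "A * B = transpose_mat U * (D * (U * B))"
    unfolding A_def assoc_mult_mat[OF mult_carrier_mat[OF cUt D(1)] cU B(1)]
      assoc_mult_mat[OF cUt D(1) cUB] ..
  have 1: "nonneg_minors k n (U * B)" "pos_minors k n (U * B) = hops q O pos_minors k n B"
    using pos_minors_factored[OF U letters B] by auto
  have 2: "nonneg_minors k n (D * (U * B))" "pos_minors k n (D * (U * B)) = hops q O pos_minors k n B"
    using pos_minors_diagonal[OF D, of "U * B" k] 1 cU B by auto
  show ?thesis
    using pos_minors_transpose_factored[OF U letters _ 2(1)] cU B D 2(2)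
    by (simp add: AB O_assoc mult_carrier_mat[of _ n n _ n])
qed

text \<open>The extra factor \<open>B\<close> is what the induction needs, because one factor of the
  power is absorbed into it; the pattern of the power itself results from the identity
  matrix.\<close>

lemma pos_minors_pow:
  assumes B: "B \<in> carrier_mat n n" "nonneg_minors k n B"
  shows "nonneg_minors k n (A ^\<^sub>m m * B) \<and>
    pos_minors k n (A ^\<^sub>m m * B) = ((hops q)\<inverse> O hops q) ^^ m O pos_minors k n B"
  using B
proof (induction m arbitrary: B)
  case 0
  have "dim_row A = n" using A_carrier by (rule carrier_matD)
  then show ?case using 0 by simp
next
  case (Suc m)
  have "A ^\<^sub>m Suc m * B = A ^\<^sub>m m * (A * B)"
    using Suc.prems by (simp add: assoc_mult_mat[of _ n n _ n _ n] pow_carrier_mat)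
  then show ?case
    using Suc.IH[of "A * B"] pos_minors_mult[OF Suc.prems] Suc.prems
    by (simp add: O_assoc mult_carrier_mat[of _ n n _ n])
qed

lemma pos_minors_pow_iff:
  "nonneg_minors k n (A ^\<^sub>m m)"
  "(I, J) \<in> pos_minors k n (A ^\<^sub>m m) \<longleftrightarrow> (I, J) \<in> ((hops q)\<inverse> O hops q) ^^ m \<and>
     J \<subseteq> {..<n} \<and> card J = k \<and> I \<subseteq> {..<n} \<and> card I = k"
proof -
  have one: "nonneg_minors k n (1\<^sub>m n)" by (auto simp: nonneg_minors_def minor_one)
  have A1: "A ^\<^sub>m m * 1\<^sub>m n = A ^\<^sub>m m" by (rule right_mult_one_mat[of _ n n]) (simp add: pow_carrier_mat)
  show "nonneg_minors k n (A ^\<^sub>m m)" using pos_minors_pow[OF _ one, of m] A1 by simp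
  have "(I, J) \<in> pos_minors k n (1\<^sub>m n) \<longleftrightarrow> I = J \<and> J \<subseteq> {..<n} \<and> card J = k" for I J
  proof (cases "I \<subseteq> {..<n} \<and> J \<subseteq> {..<n} \<and> card I = k \<and> card J = k")
    case True
    then show ?thesis using minor_one[of I n J k] by (simp add: pos_minors_def)
  next
    case False
    then show ?thesis by (auto simp: pos_minors_def)
  qed
  then have "pos_minors k n (1\<^sub>m n) = {(I, J). I = J \<and> J \<subseteq> {..<n} \<and> card J = k}"
    by (intro subset_antisym subrelI) simp_all
  then have "pos_minors k n (A ^\<^sub>m m) = ((hops q)\<inverse> O hops q) ^^ m O {(I, J). I = J \<and> J \<subseteq> {..<n} \<and> card J = k}"
    using pos_minors_pow[OF _ one, of m] A1 by simp
  then have "(I, J) \<in> pos_minors k n (A ^\<^sub>m m) \<longleftrightarrow>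
      (I, J) \<in> ((hops q)\<inverse> O hops q) ^^ m \<and> J \<subseteq> {..<n} \<and> card J = k"
    unfolding relcomp_unfold by blast
  moreover have "(I, J) \<in> pos_minors k n (A ^\<^sub>m m) \<Longrightarrow> I \<subseteq> {..<n} \<and> card I = k"
    unfolding pos_minors_def by blast
  ultimately show "(I, J) \<in> pos_minors k n (A ^\<^sub>m m) \<longleftrightarrow> (I, J) \<in> ((hops q)\<inverse> O hops q) ^^ m \<and>
     J \<subseteq> {..<n} \<and> card J = k \<and> I \<subseteq> {..<n} \<and> card I = k"
    by blast
qed

lemma minors_of_order_pow:
  "(\<forall>x\<in>minors_of_order k (A ^\<^sub>m m). 0 < x) \<longleftrightarrow>
   (\<forall>I J. I \<subseteq> {..<n} \<and> J \<subseteq> {..<n} \<and> card I = k \<and> card J = k \<longrightarrow> (I, J) \<in> pos_minors k n (A ^\<^sub>m m))"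
proof -
  have dims: "dim_row (A ^\<^sub>m m) = n" "dim_col (A ^\<^sub>m m) = n"
    using pow_carrier_mat[OF A_carrier, of m] unfolding carrier_mat_def by blast+
  have "(\<forall>x\<in>minors_of_order k (A ^\<^sub>m m). 0 < x) \<longleftrightarrow>
      (\<forall>I J. I \<subseteq> {..<n} \<and> J \<subseteq> {..<n} \<and> card I = k \<and> card J = k \<longrightarrow> 0 < minor (A ^\<^sub>m m) I J)"
    unfolding minors_of_order_def dims by blast
  then show ?thesis unfolding pos_minors_def by blast
qed

text \<open>One direction inspects only the minor with the first rows and the last columns; the
  other joins any two configurations through the lowest one.\<close>

lemma minors_positive_iff:
  assumes k: "k \<le> n"
  shows "(\<forall>x\<in>minors_of_order k (A ^\<^sub>m m). 0 < x) \<longleftrightarrow> (fold greedy q ^^ m) {..<k} = {n - k..<n}"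
proof
  assume "\<forall>x\<in>minors_of_order k (A ^\<^sub>m m). 0 < x"
  then have "({..<k}, {n - k..<n}) \<in> pos_minors k n (A ^\<^sub>m m)"
    unfolding minors_of_order_pow by (elim allE[of _ "{..<k}"] allE[of _ "{n - k..<n}"] impE) (use k in auto)
  then show "(fold greedy q ^^ m) {..<k} = {n - k..<n}"
    using top_reached[OF _ k letters] by (simp add: pos_minors_pow_iff)
next
  assume "(fold greedy q ^^ m) {..<k} = {n - k..<n}"
  then show "\<forall>x\<in>minors_of_order k (A ^\<^sub>m m). 0 < x"
    unfolding minors_of_order_pow pos_minors_pow_iff using all_pairs_related by blast
qed

lemma minor_exponent_eq:
  assumes "k \<le> n"
  shows "minor_exponent k A = (LEAST m. m \<ge> 1 \<and> (fold greedy q ^^ m) {..<k} = {n - k..<n})"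
  unfolding minor_exponent_def minors_positive_iff[OF assms] ..

end

section \<open>Reduction of words\<close>

text \<open>Rewriting of words as inclusion of the sets of matrices they produce. One direction is
  enough to pass from a given word to a normal one.\<close>

definition word_le :: "nat \<Rightarrow> nat list \<Rightarrow> nat list \<Rightarrow> bool" where
  "word_le n p q \<longleftrightarrow> (\<forall>U. factored n p U \<longrightarrow> factored n q U)"

lemma word_le_refl [simp]: "word_le n q q"
  by (simp add: word_le_def)

lemma word_le_trans: "word_le n p q \<Longrightarrow> word_le n q r \<Longrightarrow> word_le n p r"
  by (simp add: word_le_def)

lemma word_le_prepend: "word_le n p q \<Longrightarrow> word_le n (w @ p) (w @ q)"
proof (induction w)
  case (Cons i w)
  then show ?case unfolding word_le_def append_Cons factored_Cons by metis
qed simp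

lemma elem_upper_mult_carrier: "M \<in> carrier_mat n m \<Longrightarrow> elem_upper n i a * M \<in> carrier_mat n m"
  by (rule mult_carrier_mat[OF elem_upper_carrier])

lemma elem_upper_mult_eqI:
  assumes "A \<in> carrier_mat n m" "B \<in> carrier_mat n m"
    and "\<And>r c. r < n \<Longrightarrow> c < m \<Longrightarrow> A $$ (r, c) = B $$ (r, c)"
  shows "A = B"
  using assms by (intro eq_matI) auto

lemma word_le_commute:
  assumes "Suc i < n" "Suc j < n" "Suc i < j \<or> Suc j < i"
  shows "word_le n (i # j # q) (j # i # q)"
  unfolding word_le_def
proof (intro allI impI)
  fix U assume "factored n (i # j # q) U"
  then obtain a b M where ab: "0 < a" "0 < b" and M: "factored n q M"
    and U: "U = elem_upper n i a * (elem_upper n j b * M)"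
    by (auto simp: factored_Cons)
  have cM: "M \<in> carrier_mat n n" using M by (rule factored_carrier)
  have "U = elem_upper n j b * (elem_upper n i a * M)"
    unfolding U
  proof (rule elem_upper_mult_eqI[of _ n n])
    fix r c assume "r < n" "c < n"
    then show "(elem_upper n i a * (elem_upper n j b * M)) $$ (r, c)
        = (elem_upper n j b * (elem_upper n i a * M)) $$ (r, c)"
      using assms cM by (auto simp: elem_upper_mult_index[of _ n n] elem_upper_mult_carrier simp del: index_mult_mat(1))
  qed (auto intro: elem_upper_mult_carrier cM)
  then show "factored n (j # i # q) U" unfolding factored_Cons using ab M by blast
qed

lemma word_le_merge:
  assumes "Suc i < n"
  shows "word_le n (i # i # q) (i # q)"
  unfolding word_le_def
proof (intro allI impI)
  fix U assume "factored n (i # i # q) U"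
  then obtain a b M where ab: "0 < a" "0 < b" and M: "factored n q M"
    and U: "U = elem_upper n i a * (elem_upper n i b * M)"
    by (auto simp: factored_Cons)
  have cM: "M \<in> carrier_mat n n" using M by (rule factored_carrier)
  have "U = elem_upper n i (a + b) * M"
    unfolding U
  proof (rule elem_upper_mult_eqI[of _ n n])
    fix r c assume "r < n" "c < n"
    then show "(elem_upper n i a * (elem_upper n i b * M)) $$ (r, c) = (elem_upper n i (a + b) * M) $$ (r, c)"
      using assms cM
      by (auto simp: elem_upper_mult_index[of _ n n] elem_upper_mult_carrier algebra_simps simp del: index_mult_mat(1))
  qed (auto intro: elem_upper_mult_carrier cM)
  then show "factored n (i # q) U" unfolding factored_Cons using ab M by (metis add_pos_pos)
qed

lemma word_le_braid:
  assumes "Suc (Suc i) < n"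
  shows "word_le n (Suc i # i # Suc i # q) (i # Suc i # i # q)"
  unfolding word_le_def
proof (intro allI impI)
  fix U assume "factored n (Suc i # i # Suc i # q) U"
  then obtain a b c M where abc: "0 < a" "0 < b" "0 < c" and M: "factored n q M"
    and U: "U = elem_upper n (Suc i) a * (elem_upper n i b * (elem_upper n (Suc i) c * M))"
    by (auto simp: factored_Cons)
  have cM: "M \<in> carrier_mat n n" using M by (rule factored_carrier)
  \<comment> \<open>Forced by comparing entries: the superdiagonal ones give
    \<open>p + s = b\<close> and the middle parameter \<open>a + c\<close>, the corner gives
    \<open>p * (a + c) = b * c\<close>.\<close>
  define p s where "p = b * c / (a + c)" and "s = a * b / (a + c)"
  have ac: "a + c \<noteq> 0" using abc by simp
  then have p: "p * (a + c) = b * c" by (simp add: p_def)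
  have ps: "p + s = b" unfolding p_def s_def add_divide_distrib[symmetric] using ac by (simp add: field_simps)
  have "U = elem_upper n i p * (elem_upper n (Suc i) (a + c) * (elem_upper n i s * M))"
    unfolding U
  proof (rule elem_upper_mult_eqI[of _ n n])
    fix r l assume rl: "r < n" "l < n"
    have 1: "b * c * M $$ (Suc (Suc i), l) = p * (a + c) * M $$ (Suc (Suc i), l)" using p by simp
    have 2: "b * M $$ (Suc i, l) = p * M $$ (Suc i, l) + s * M $$ (Suc i, l)"
      using ps by (simp add: distrib_right[symmetric])
    show "(elem_upper n (Suc i) a * (elem_upper n i b * (elem_upper n (Suc i) c * M))) $$ (r, l)
      = (elem_upper n i p * (elem_upper n (Suc i) (a + c) * (elem_upper n i s * M))) $$ (r, l)"
      using assms cM rl 1 2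
      by (auto simp: elem_upper_mult_index[of _ n n] elem_upper_mult_carrier algebra_simps simp del: index_mult_mat(1))
  qed (auto intro: elem_upper_mult_carrier cM)
  moreover have "0 < p" "0 < s" "0 < a + c" using abc by (simp_all add: p_def s_def)
  ultimately show "factored n (i # Suc i # i # q) U" unfolding factored_Cons using M by blast
qed

lemma word_le_commute_list:
  assumes "Suc i < n" "\<forall>l\<in>set w. Suc l < n \<and> (Suc i < l \<or> Suc l < i)"
  shows "word_le n (i # w @ q) (w @ i # q)"
  using assms(2)
proof (induction w)
  case (Cons l w)
  have "word_le n (i # l # w @ q) (l # i # w @ q)"
    using Cons.prems assms(1) by (intro word_le_commute) auto
  moreover have "word_le n ([l] @ i # w @ q) ([l] @ w @ i # q)"
    using Cons by (intro word_le_prepend) auto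
  ultimately show ?case using word_le_trans by fastforce
qed simp

text \<open>The letter \<open>i\<close> meets the leading run from \<open>r\<close>: below
  \<open>r - 1\<close> it commutes past the run into the tail, at \<open>r - 1\<close> it lengthens
  the run, at \<open>r\<close> it merges. Above \<open>r\<close> one braid move leaves the run
  intact and sends \<open>i - 1\<close> into the tail, where the induction hypothesis inserts
  it.\<close>

lemma normal_word_Cons:
  assumes "normal_word j q" "i < j" "j < n"
  shows "\<exists>q'. normal_word j q' \<and> word_le n (i # q) q'"
  using assms
proof (induction arbitrary: i rule: normal_word.induct)
  case (2 j q r)
  consider "Suc i < r" | "Suc i = r" | "i = r" | "r < i" by linarith
  then show ?case
  proof cases
    case 1
    then obtain q' where q': "normal_word j q'" "word_le n (i # q) q'"
      using "2.IH"[of i] "2.hyps" "2.prems" by auto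
    have "word_le n (i # [r..<Suc j] @ q) ([r..<Suc j] @ i # q)"
      using 1 "2.prems" by (intro word_le_commute_list) auto
    then show ?thesis
      using word_le_trans word_le_prepend[OF q'(2)] normal_word.intros(2)[OF q'(1) "2.hyps"(2)] by blast
  next
    case 2
    have "i # [r..<Suc j] @ q = [i..<Suc j] @ q"
      using 2 \<open>r \<le> Suc j\<close> by (subst (2) upt_conv_Cons) auto
    moreover have "normal_word (Suc j) ([i..<Suc j] @ q)"
      using "2.hyps" \<open>i < Suc j\<close> by (intro normal_word.intros) auto
    ultimately show ?thesis by (metis word_le_refl)
  next
    case 3
    have eq: "[r..<Suc j] @ q = r # [Suc r..<Suc j] @ q"
      using 3 \<open>i < Suc j\<close> by (subst upt_conv_Cons) auto
    have "word_le n (i # [r..<Suc j] @ q) ([r..<Suc j] @ q)"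
      unfolding eq using 3 "2.prems" by (auto intro: word_le_merge)
    then show ?thesis using normal_word.intros(2)[OF "2.hyps"] by blast
  next
    case 4
    then obtain l where i: "i = Suc l" and rl: "r \<le> l" by (cases i) auto
    have lj: "l < j" using i "2.prems" by simp
    have "[r..<Suc j] = [r..<l] @ [l..<Suc j]"
      using rl lj upt_add_eq_append[of r l "Suc j - l"] by simp
    also have "[l..<Suc j] = l # Suc l # [Suc (Suc l)..<Suc j]"
      using lj by (subst upt_conv_Cons, simp, subst upt_conv_Cons, auto)
    finally have eq: "[r..<Suc j] = [r..<l] @ l # Suc l # [Suc (Suc l)..<Suc j]" .
    obtain q' where q': "normal_word j q'" "word_le n (l # q) q'"
      using "2.IH"[of l] lj "2.prems" by auto
    have 1: "word_le n (Suc l # [r..<l] @ l # Suc l # [Suc (Suc l)..<Suc j] @ q)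
        ([r..<l] @ Suc l # l # Suc l # [Suc (Suc l)..<Suc j] @ q)"
      using lj "2.prems" by (intro word_le_commute_list) auto
    have 2: "word_le n ([r..<l] @ Suc l # l # Suc l # [Suc (Suc l)..<Suc j] @ q)
        ([r..<l] @ l # Suc l # l # [Suc (Suc l)..<Suc j] @ q)"
      using lj "2.prems" by (intro word_le_prepend word_le_braid) auto
    have "word_le n (l # [Suc (Suc l)..<Suc j] @ q) ([Suc (Suc l)..<Suc j] @ l # q)"
      using lj "2.prems" by (intro word_le_commute_list) auto
    from word_le_prepend[OF this, of "[r..<l] @ [l, Suc l]"]
    have 3: "word_le n ([r..<l] @ l # Suc l # l # [Suc (Suc l)..<Suc j] @ q) ([r..<Suc j] @ l # q)"
      by (simp add: eq del: upt_Suc)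
    have "word_le n (i # [r..<Suc j] @ q) ([r..<Suc j] @ q')"
      using word_le_trans[OF 1 word_le_trans[OF 2 word_le_trans[OF 3 word_le_prepend[OF q'(2)]]]]
      by (simp add: eq i del: upt_Suc)
    then show ?thesis using normal_word.intros(2)[OF q'(1) "2.hyps"(2)] by blast
  qed
qed simp

lemma normal_word_Nil: "normal_word j []"
proof (induction j)
  case (Suc j)
  then show ?case using normal_word.intros(2)[of j "[]" "Suc j"] by simp
qed (rule normal_word.intros)

lemma word_le_normal_word:
  assumes "j < n" "\<forall>i\<in>set q. i < j"
  shows "\<exists>q'. normal_word j q' \<and> word_le n q q'"
  using assms(2)
proof (induction q)
  case Nil
  then show ?case using normal_word_Nil word_le_refl by blast
next
  case (Cons i q)
  then obtain q' where q': "normal_word j q'" "word_le n q q'" by auto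
  then obtain q'' where q'': "normal_word j q''" "word_le n (i # q') q''"
    using normal_word_Cons[OF q'(1) _ assms(1), of i] Cons.prems by auto
  then have "word_le n (i # q) q''"
    using word_le_trans word_le_prepend[OF q'(2), of "[i]"] by simp
  then show ?case using q'' by blast
qed

section \<open>Factor length as a number of inversions\<close>

lemma factored_iff_exists_list:
  assumes "dim_row U = n"
  shows "(\<exists>q. length q = s \<and> (\<forall>i\<in>set q. Suc i < n) \<and> factored n q U) \<longleftrightarrow>
    (\<exists>ps. length ps = s \<and> (\<forall>(q, a)\<in>set ps. q + 1 < dim_row U \<and> 0 < a) \<and> U = elem_upper_prod (dim_row U) ps)"
proof
  assume "\<exists>q. length q = s \<and> (\<forall>i\<in>set q. Suc i < n) \<and> factored n q U"
  then obtain ps where "length ps = s" "\<forall>i\<in>set (map fst ps). Suc i < n"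
    "\<forall>p\<in>set ps. 0 < snd p" "U = elem_upper_prod n ps"
    unfolding factored_def by (metis length_map)
  then show "\<exists>ps. length ps = s \<and> (\<forall>(q, a)\<in>set ps. q + 1 < dim_row U \<and> 0 < a) \<and> U = elem_upper_prod (dim_row U) ps"
    using assms by (intro exI[of _ ps]) force
next
  assume "\<exists>ps. length ps = s \<and> (\<forall>(q, a)\<in>set ps. q + 1 < dim_row U \<and> 0 < a) \<and> U = elem_upper_prod (dim_row U) ps"
  then obtain ps where ps: "length ps = s" "\<forall>(q, a)\<in>set ps. q + 1 < n \<and> 0 < a" "U = elem_upper_prod n ps"
    using assms by auto
  have "length (map fst ps) = s" "\<forall>i\<in>set (map fst ps). Suc i < n" "\<forall>p\<in>set ps. 0 < snd p"
    using ps by force+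
  then show "\<exists>q. length q = s \<and> (\<forall>i\<in>set q. Suc i < n) \<and> factored n q U"
    using ps(3) unfolding factored_def by blast
qed

lemma factor_length_eq_Least:
  assumes "dim_row U = n"
  shows "factor_length U = (LEAST s. \<exists>q. length q = s \<and> (\<forall>i\<in>set q. Suc i < n) \<and> factored n q U)"
  unfolding factored_iff_exists_list[OF assms] factor_length_def ..

lemma factor_length_le:
  assumes "factored n q U" "\<forall>i\<in>set q. Suc i < n"
  shows "factor_length U \<le> length q"
proof -
  have "dim_row U = n" using factored_carrier[OF assms(1)] by auto
  then show ?thesis unfolding factor_length_eq_Least[OF \<open>dim_row U = n\<close>]
    using assms by (intro Least_le) blast
qed

text \<open>The greedy image is the largest column set whose minor with the first \<open>k\<close>
  rows of \<open>U\<close> is positive, and this description does not mention the word.\<close>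

lemma fold_greedy_unique:
  assumes "factored n p U" "factored n q U" "\<forall>i\<in>set p. Suc i < n" "\<forall>i\<in>set q. Suc i < n" "k \<le> n"
  shows "fold greedy p {..<k} = fold greedy q {..<k}"
proof -
  have one: "nonneg_minors k n (1\<^sub>m n)" by (auto simp: nonneg_minors_def minor_one)
  have cU: "U * 1\<^sub>m n = U"
    using factored_carrier[OF assms(1)] by (rule right_mult_one_mat)
  have dom: "dominated (fold greedy p {..<k}) (fold greedy q {..<k})"
    if pq: "factored n p U" "factored n q U" "\<forall>i\<in>set p. Suc i < n" "\<forall>i\<in>set q. Suc i < n" for p q
  proof -
    let ?J = "fold greedy p {..<k}"
    have J: "?J \<subseteq> {..<n}" "card ?J = k" using fold_greedy_subset[of "{..<k}" n p] pq assms(5) by auto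
    have "(?J, ?J) \<in> pos_minors k n (1\<^sub>m n)"
      using J by (simp add: pos_minors_def minor_one)
    then have "({..<k}, ?J) \<in> pos_minors k n U"
      using pos_minors_factored[OF pq(1,3) one_carrier_mat one] hops_fold_greedy cU by force
    then have "({..<k}, ?J) \<in> hops q O pos_minors k n (1\<^sub>m n)"
      using pos_minors_factored[OF pq(2,4) one_carrier_mat one] cU by simp
    then obtain K where K: "({..<k}, K) \<in> hops q" "(K, ?J) \<in> pos_minors k n (1\<^sub>m n)" by auto
    then have "K = ?J" using minor_one[of K n ?J k] by (auto simp: pos_minors_def split: if_splits)
    then show ?thesis using hops_dominated[OF K(1)] by simp
  qed
  show ?thesis
    using dom[OF assms(1-4)] dom[OF assms(2,1,4,3)] by (intro dominated_antisym) auto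
qed

text \<open>The value at \<open>k\<close> is the difference of two consecutive initial images, so
  these images determine the permutation below \<open>n\<close>.\<close>

lemma inversions_cong_images:
  assumes "inj P" "inj Q" "\<And>k. k \<le> n \<Longrightarrow> P ` {..<k} = Q ` {..<k}"
  shows "inversions n P = inversions n Q"
proof -
  have eq: "P k = Q k" if "k < n" for k
  proof -
    have "{P k} = P ` {..<Suc k} - P ` {..<k}" "{Q k} = Q ` {..<Suc k} - Q ` {..<k}"
      using assms(1,2) by (auto simp: lessThan_Suc inj_eq)
    moreover have "P ` {..<k} = Q ` {..<k}" "P ` {..<Suc k} = Q ` {..<Suc k}"
      using assms(3) that by auto
    ultimately show ?thesis by (metis the_elem_eq)
  qed
  show ?thesis unfolding inversions_def
  proof (rule Collect_cong, clarify)
    fix a b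
    show "(a < b \<and> b < n \<and> P b < P a) = (a < b \<and> b < n \<and> Q b < Q a)"
      using eq[of a] eq[of b] by auto
  qed
qed

text \<open>A shortest word of \<open>U\<close> has the same permutation as \<open>q\<close>, and a
  letter creates at most one inversion.\<close>

lemma factor_length_ge:
  assumes "factored n q U" "\<forall>i\<in>set q. Suc i < n"
  shows "card (inversions n (word_perm q)) \<le> factor_length U"
proof -
  have dim: "dim_row U = n" using factored_carrier[OF assms(1)] by auto
  obtain p where p: "length p = factor_length U" "\<forall>i\<in>set p. Suc i < n" "factored n p U"
    using LeastI[of "\<lambda>s. \<exists>q. length q = s \<and> (\<forall>i\<in>set q. Suc i < n) \<and> factored n q U" "length q"] assms
    unfolding factor_length_eq_Least[OF dim] by blast
  have "inversions n (word_perm q) = inversions n (word_perm p)"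
    using fold_greedy_unique[OF assms(1) p(3) assms(2) p(2)] bij_word_perm
    by (intro inversions_cong_images) (auto simp: word_perm_image bij_is_inj)
  then show ?thesis using card_inversions_word_perm[of n p] p(1) by simp
qed

lemma factored_reduced:
  assumes "0 < n" "factored n p U" "\<forall>i\<in>set p. Suc i < n"
  obtains q where "factored n q U" "\<forall>i\<in>set q. Suc i < n" "factor_length U = card (inversions n (word_perm q))"
proof -
  have "\<forall>i\<in>set p. i < n - 1" using assms(3) by auto
  then obtain q where q: "normal_word (n - 1) q" "word_le n p q"
    using word_le_normal_word[of "n - 1" n p] assms(1) by auto
  have U: "factored n q U" using q(2) assms(2) by (simp add: word_le_def)
  have letters: "\<forall>i\<in>set q. Suc i < n" using normal_word_letters[OF q(1)] by fastforce
  have "length q \<le> card (inversions n (word_perm q))"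
    using normal_word_reduced[OF q(1), of n] assms(1) by simp
  then have "factor_length U = card (inversions n (word_perm q))"
    using factor_length_le[OF U letters] factor_length_ge[OF U letters] by simp
  then show ?thesis using that U letters by blast
qed

section \<open>Factorization of totally nonnegative matrices\<close>

text \<open>A reduced word of the longest permutation of the last \<open>d\<close> sites. Later
  blocks start at lower sites, so enlarging \<open>d\<close> only appends letters and every smaller
  staircase is a prefix.\<close>

fun staircase :: "nat \<Rightarrow> nat \<Rightarrow> nat list" where
  "staircase n 0 = []"
| "staircase n (Suc d) = staircase n d @ [n - Suc d..<n - 1]"

lemma staircase_letters: "i \<in> set (staircase n d) \<Longrightarrow> n - d \<le> i \<and> Suc i < n"
  by (induction d) auto

lemma length_staircase: "d \<le> n \<Longrightarrow> length (staircase n d) = d choose 2"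
proof (induction d)
  case (Suc d)
  then show ?case by (simp add: numeral_2_eq_2)
qed simp

lemma fold_greedy_ascending:
  assumes "s < t" "t \<le> n"
  shows "fold greedy [s..<n - 1] (insert s {t..<n}) = {t - 1..<n}"
proof -
  have "s \<le> t - 1" using assms by simp
  then show ?thesis
  proof (induction s rule: inc_induct)
    case base
    have "insert (t - 1) {t..<n} = {n - (n - (t - 1))..<n}" using assms by auto
    moreover have "fold greedy [t - 1..<n - 1] {n - (n - (t - 1))..<n} = {n - (n - (t - 1))..<n}"
      by (rule fold_greedy_top) auto
    ultimately show ?case using assms by simp
  next
    case (step s)
    have "greedy s (insert s {t..<n}) = insert (Suc s) {t..<n}"
      using step(2) by (auto simp: greedy_def shift_def)
    then show ?case using step assms by (subst upt_conv_Cons) auto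
  qed
qed

lemma fold_greedy_insert:
  "\<forall>i\<in>set q. s < i \<Longrightarrow> fold greedy q (insert s T) = insert s (fold greedy q T)"
proof (induction q arbitrary: T)
  case (Cons i q)
  have "greedy i (insert s T) = insert s (greedy i T)"
    using Cons.prems by (auto simp: greedy_def shift_def)
  then show ?case using Cons by simp
qed simp

text \<open>By induction the particles above the lowest one are packed at the top while the lowest
  rests; the last run then carries it up to them.\<close>

lemma fold_greedy_staircase:
  "k \<le> d \<Longrightarrow> d \<le> n \<Longrightarrow> fold greedy (staircase n d) {n - d..<n - d + k} = {n - k..<n}"
proof (induction d arbitrary: k)
  case (Suc d)
  show ?case
  proof (cases k)
    case 0
    have "fold greedy (staircase n (Suc d)) {n - 0..<n} = {n - 0..<n}"
      by (rule fold_greedy_top) (use staircase_letters in blast)+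
    then show ?thesis using 0 by simp
  next
    case k: (Suc k')
    let ?s = "n - Suc d"
    have s: "n - d = Suc ?s" using Suc.prems by simp
    have "{?s..<?s + k} = insert ?s {n - d..<n - d + k'}" unfolding s k by auto
    then have "fold greedy (staircase n d) {?s..<?s + k} = insert ?s (fold greedy (staircase n d) {n - d..<n - d + k'})"
      using fold_greedy_insert[of "staircase n d" ?s] staircase_letters[of _ n d] s by fastforce
    also have "\<dots> = insert ?s {n - k'..<n}" using Suc k by simp
    finally have "fold greedy (staircase n (Suc d)) {?s..<?s + k} = fold greedy [?s..<n - 1] (insert ?s {n - k'..<n})"
      by simp
    also have "\<dots> = {n - k' - 1..<n}" by (rule fold_greedy_ascending) (use Suc.prems k in auto)
    finally show ?thesis using k by simp
  qed
qed simp

lemma factored_append: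
  assumes "factored n p A" "factored n q B"
  shows "factored n (p @ q) (A * B)"
proof -
  obtain ps qs where "map fst ps = p" "\<forall>x\<in>set ps. 0 < snd x" "A = elem_upper_prod n ps"
    "map fst qs = q" "\<forall>x\<in>set qs. 0 < snd x" "B = elem_upper_prod n qs"
    using assms unfolding factored_def by metis
  then show ?thesis
    unfolding factored_def by (intro exI[of _ "ps @ qs"]) (auto simp: elem_upper_prod_append)
qed

lemma minor_intervals:
  assumes "X \<in> carrier_mat n m" "a + k \<le> n" "b + k \<le> m"
  shows "minor X {a..<a + k} {b..<b + k} = det (mat k k (\<lambda>(r, c). X $$ (a + r, b + c)))"
proof -
  have "minor X {a..<a + k} {b..<b + k}
      = det (mat k k (\<lambda>(r, c). X $$ (pick {a..<a + k} r, pick {b..<b + k} c)))"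
    by (rule minor_eq_det[of _ n m]) (use assms in auto)
  also have "mat k k (\<lambda>(r, c). X $$ (pick {a..<a + k} r, pick {b..<b + k} c))
      = mat k k (\<lambda>(r, c). X $$ (a + r, b + c))"
    by (intro cong_mat) (auto simp: pick_interval)
  finally show ?thesis .
qed

text \<open>One round of Neville elimination on the columns: after it the solid minors in the remaining
  rows are, up to a positive factor, the solid minors of order one higher before it.\<close>

lemma det_neville_round:
  fixes x :: "nat \<Rightarrow> nat \<Rightarrow> 'a :: field"
  assumes "\<And>c. c < k \<Longrightarrow> x 0 (Suc c) = t c * x 0 c"
  shows "det (mat (Suc k) (Suc k) (\<lambda>(r, c). x r c))
    = x 0 0 * det (mat k k (\<lambda>(r, c). x (Suc r) (Suc c) - t c * x (Suc r) c))"
proof -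
  define M where "M = mat (Suc k) (Suc k) (\<lambda>(r, c). x r c)"
  define N where "N = mat (Suc k) (Suc k) (\<lambda>(r, c). if r = c then 1 else if Suc r = c then - t r else 0)"
  define Y where "Y = mat (Suc k) (Suc k) (\<lambda>(r, c). if c = 0 then x r 0 else x r c - t (c - 1) * x r (c - 1))"
  have car: "M \<in> carrier_mat (Suc k) (Suc k)" "N \<in> carrier_mat (Suc k) (Suc k)"
    "Y \<in> carrier_mat (Suc k) (Suc k)" by (simp_all add: M_def N_def Y_def)
  have "M * N = Y"
  proof (rule eq_matI)
    fix r c assume rc: "r < dim_row Y" "c < dim_col Y"
    then have rc: "r < Suc k" "c < Suc k" by (auto simp: Y_def)
    have "(M * N) $$ (r, c) = (\<Sum>l = 0..<Suc k. M $$ (r, l) * N $$ (l, c))"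
      using rc car by (simp add: scalar_prod_def)
    also have "\<dots> = (\<Sum>l = 0..<Suc k. (if l = c then x r c else 0)
        + (if l = c - 1 then if c = 0 then 0 else - t (c - 1) * x r (c - 1) else 0))"
      using rc by (intro sum.cong) (auto simp: M_def N_def)
    also have "\<dots> = Y $$ (r, c)" using rc by (subst sum.distrib) (auto simp: Y_def)
    finally show "(M * N) $$ (r, c) = Y $$ (r, c)" .
  qed (use car in auto)
  moreover have "det N = 1"
  proof -
    have "upper_triangular N" by (auto simp: N_def)
    then have "det N = prod_list (diag_mat N)" using car(2) by (rule det_upper_triangular)
    also have "\<dots> = 1" unfolding prod_list_diag_prod by (rule prod.neutral) (auto simp: N_def)
    finally show ?thesis .
  qed
  ultimately have "det M = det Y" using det_mult[OF car(1,2)] by simp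
  also have "det Y = (\<Sum>c<Suc k. Y $$ (0, c) * cofactor Y 0 c)"
    by (rule laplace_expansion_row[OF car(3)]) simp
  also have "\<dots> = (\<Sum>c<Suc k. if c = 0 then x 0 0 * cofactor Y 0 0 else 0)"
  proof (rule sum.cong[OF refl])
    fix c assume c: "c \<in> {..<Suc k}"
    show "Y $$ (0, c) * cofactor Y 0 c = (if c = 0 then x 0 0 * cofactor Y 0 0 else 0)"
    proof (cases c)
      case (Suc c')
      then show ?thesis using c assms[of c'] by (simp add: Y_def)
    qed (simp add: Y_def)
  qed
  also have "\<dots> = x 0 0 * det (mat_delete Y 0 0)" by (simp add: cofactor_def)
  also have "mat_delete Y 0 0 = mat k k (\<lambda>(r, c). x (Suc r) (Suc c) - t c * x (Suc r) c)"
    by (rule eq_matI) (auto simp: mat_delete_def Y_def)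
  finally show ?thesis by (simp add: M_def)
qed

text \<open>Here \<open>d\<close> counts the bottom rows not yet reduced. One round clears row
  \<open>n - Suc d\<close> to the right of the diagonal, and undoing its column operations is right
  multiplication by an ascending run, the last block of the staircase.\<close>

lemma factored_of_positive_solid_minors:
  assumes "X \<in> carrier_mat n n" "d \<le> n"
    and "\<And>i. i < n \<Longrightarrow> X $$ (i, i) = 1"
    and "\<And>r c. r < n \<Longrightarrow> c < r \<Longrightarrow> X $$ (r, c) = 0"
    and "\<And>r c. r < n - d \<Longrightarrow> c < n \<Longrightarrow> r < c \<Longrightarrow> X $$ (r, c) = 0"
    and "\<And>k u. u + k \<le> d \<Longrightarrow> 0 < minor X {n - d..<n - d + k} {n - d + u..<n - d + u + k}"
  shows "factored n (staircase n d) X"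
  using assms
proof (induction d arbitrary: X)
  case 0
  have "X = 1\<^sub>m n"
  proof (rule eq_matI)
    fix r c assume "r < dim_row (1\<^sub>m n :: real mat)" "c < dim_col (1\<^sub>m n :: real mat)"
    then show "X $$ (r, c) = 1\<^sub>m n $$ (r, c)"
      using 0(3)[of r] 0(4)[of r c] 0(5)[of r c] by (cases r c rule: linorder_cases) auto
  qed (use 0 in auto)
  then show ?case by (simp add: factored_Nil)
next
  case (Suc d)
  define s where "s = n - Suc d"
  have s: "n - d = Suc s" "s < n" "s + Suc d = n" using Suc.prems(2) by (auto simp: s_def)
  note cX = Suc.prems(1) and diag = Suc.prems(3) and low = Suc.prems(4)
  have rows: "X $$ (r, c) = 0" if "r < s" "c < n" "r < c" for r c
    using Suc.prems(5) that by (simp add: s_def)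
  have solid: "0 < det (mat k k (\<lambda>(r, c). X $$ (s + r, s + u + c)))" if "u + k \<le> Suc d" for u k
  proof -
    have "minor X {s..<s + k} {s + u..<s + u + k} = det (mat k k (\<lambda>(r, c). X $$ (s + r, s + u + c)))"
      by (rule minor_intervals[OF cX]) (use that s in auto)
    then show ?thesis using Suc.prems(6)[OF that] by (simp add: s_def)
  qed
  have row_pos: "0 < X $$ (s, j)" if "s \<le> j" "j < n" for j
  proof -
    have "0 < det (mat 1 1 (\<lambda>(r, c). X $$ (s + r, s + (j - s) + c)))" by (rule solid) (use that s in auto)
    then show ?thesis using that by (simp add: det_single)
  qed
  \<comment> \<open>Ratios of neighbours in the row to be cleared; they are positive as quotients of
    solid minors of order one.\<close>
  define t where "t j = X $$ (s, j) / X $$ (s, j - 1)" for j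
  have t_pos: "0 < t j" if "s < j" "j < n" for j
    unfolding t_def using row_pos[of j] row_pos[of "j - 1"] that by simp
  define X' where "X' = mat n n (\<lambda>(r, c). if s < c then X $$ (r, c) - t c * X $$ (r, c - 1) else X $$ (r, c))"
  have X'_index: "X' $$ (r, c) = (if s < c then X $$ (r, c) - t c * X $$ (r, c - 1) else X $$ (r, c))"
    if "r < n" "c < n" for r c using that by (simp add: X'_def)
  have cX': "X' \<in> carrier_mat n n" by (simp add: X'_def)
  define P where "P m = elem_upper_prod n (map (\<lambda>j. (j, t (Suc j))) [s..<m])" for m
  have P_factored: "factored n [s..<n - 1] (P (n - 1))"
    unfolding factored_def P_def using t_pos
    by (intro exI[of _ "map (\<lambda>j. (j, t (Suc j))) [s..<n - 1]"]) (auto simp: o_def)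
  \<comment> \<open>The columns are restored from left to right: when the factor at \<open>m\<close>
    acts, column \<open>m\<close> is already the original one, which is what has to be added to
    column \<open>Suc m\<close>.\<close>
  have prod: "m < n \<Longrightarrow> \<forall>r<n. \<forall>c<n. (X' * P m) $$ (r, c) = (if c \<le> m then X $$ (r, c) else X' $$ (r, c))"
    if "s \<le> m" for m
    using that
  proof (induction m rule: dec_induct)
    case base
    have "X' * P s = X'" using cX' by (simp add: P_def right_mult_one_mat[of _ n n])
    then show ?case by (simp add: X'_index)
  next
    case (step m)
    have "X' * P (Suc m) = X' * P m * elem_upper n m (t (Suc m))"
      using step.hyps cX' by (simp add: P_def elem_upper_prod_append assoc_mult_mat[of _ n n _ n _ n]
          right_mult_one_mat[of _ n n])
    moreover have "X' * P m \<in> carrier_mat n n" unfolding P_def using cX' by (rule mult_carrier_mat) simp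
    ultimately have "(X' * P (Suc m)) $$ (r, c) = (X' * P m) $$ (r, c)
        + (if c = Suc m then t (Suc m) * (X' * P m) $$ (r, m) else 0)" if "r < n" "c < n" for r c
      using that step.prems by (simp only: mult_elem_upper_index)
    then show ?case using step by (auto simp: X'_index simp del: index_mult_mat(1))
  qed
  have X_eq: "X = X' * P (n - 1)"
  proof (rule elem_upper_mult_eqI[OF cX])
    show "X' * P (n - 1) \<in> carrier_mat n n" unfolding P_def using cX' by (rule mult_carrier_mat) simp
    fix r c assume "r < n" "c < n"
    moreover have "c \<le> n - 1" using \<open>c < n\<close> by simp
    ultimately show "X $$ (r, c) = (X' * P (n - 1)) $$ (r, c)"
      using prod[of "n - 1"] s by (simp del: index_mult_mat(1))
  qed
  have "factored n (staircase n d) X'"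
  proof (rule Suc.IH[OF cX'])
    show "d \<le> n" using Suc.prems(2) by simp
    show "X' $$ (i, i) = 1" if "i < n" for i using that diag low by (simp add: X'_index)
    show "X' $$ (r, c) = 0" if "r < n" "c < r" for r c
      using that low by (simp add: X'_index)
    show "X' $$ (r, c) = 0" if "r < n - d" "c < n" "r < c" for r c
    proof (cases "r = s")
      case True
      have "0 < X $$ (s, c - 1)" by (rule row_pos) (use that True in auto)
      then show ?thesis using that True s by (simp add: X'_index t_def)
    next
      case False
      then have "r < s" using that s by simp
      then show ?thesis using that rows[of r c] rows[of r "c - 1"] s by (simp add: X'_index)
    qed
    show "0 < minor X' {n - d..<n - d + k} {n - d + u..<n - d + u + k}" if uk: "u + k \<le> d" for k u
    proof -
      let ?x = "\<lambda>r c. X $$ (s + r, s + u + c)"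
      have "?x 0 (Suc c) = t (s + u + Suc c) * ?x 0 c" if "c < k" for c
        using row_pos[of "s + u + c"] that uk s by (simp add: t_def)
      then have "det (mat (Suc k) (Suc k) (\<lambda>(r, c). ?x r c))
          = ?x 0 0 * det (mat k k (\<lambda>(r, c). ?x (Suc r) (Suc c) - t (s + u + Suc c) * ?x (Suc r) c))"
        by (rule det_neville_round)
      moreover have "mat k k (\<lambda>(r, c). ?x (Suc r) (Suc c) - t (s + u + Suc c) * ?x (Suc r) c)
          = mat k k (\<lambda>(r, c). X' $$ (n - d + r, n - d + u + c))"
        using uk s by (intro cong_mat) (auto simp: X'_index)
      moreover have "minor X' {n - d..<n - d + k} {n - d + u..<n - d + u + k}
          = det (mat k k (\<lambda>(r, c). X' $$ (n - d + r, n - d + u + c)))"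
        by (rule minor_intervals[OF cX']) (use uk s in auto)
      moreover have "0 < det (mat (Suc k) (Suc k) (\<lambda>(r, c). ?x r c))" by (rule solid) (use uk in simp)
      moreover have "0 < ?x 0 0" using row_pos[of "s + u"] uk s by simp
      ultimately show ?thesis by (simp add: zero_less_mult_iff)
    qed
  qed
  then show ?case using factored_append[OF _ P_factored] X_eq by (simp add: s_def)
qed

section \<open>Factorization from initial minors by perturbation and compactness\<close>

lemma minor_mult_elem_upper:
  assumes B: "B \<in> carrier_mat m n" and i: "Suc i < n"
    and I: "I \<subseteq> {..<m}" and J: "J \<subseteq> {..<n}" and card: "card I = card J"
  shows "minor (B * elem_upper n i a) I J
    = minor B I J + (if Suc i \<in> J \<and> i \<notin> J then a * minor B I (insert i (J - {Suc i})) else 0)"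
proof -
  have t: "transpose_mat (B * elem_upper n i a) = transpose_mat (elem_upper n i a) * transpose_mat B"
    by (rule transpose_mult[OF B elem_upper_carrier])
  have cB: "B * elem_upper n i a \<in> carrier_mat m n" using B by (rule mult_carrier_mat) simp
  have cT: "transpose_mat B \<in> carrier_mat n m" using B by simp
  have "minor (B * elem_upper n i a) I J = minor (transpose_mat (B * elem_upper n i a)) J I"
    by (rule minor_transpose[symmetric]) (use cB assms in auto)
  also have "\<dots> = minor (transpose_mat B) J I
      + (if Suc i \<in> J \<and> i \<notin> J then a * minor (transpose_mat B) (insert i (J - {Suc i})) I else 0)"
    unfolding t by (rule minor_transpose_elem_upper_mult[OF cT i J I]) (use card in simp)
  also have "minor (transpose_mat B) J I = minor B I J"
    by (rule minor_transpose) (use assms in auto)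
  also have "minor (transpose_mat B) (insert i (J - {Suc i})) I = minor B I (insert i (J - {Suc i}))"
    if "Suc i \<in> J" "i \<notin> J"
  proof (rule minor_transpose[OF B I])
    show "insert i (J - {Suc i}) \<subseteq> {..<n}" using J i by auto
    have "finite J" using J finite_subset by blast
    then show "card I = card (insert i (J - {Suc i}))"
      using that card card_Suc_Diff1[of J "Suc i"] by simp
  qed
  then have "(if Suc i \<in> J \<and> i \<notin> J then a * minor (transpose_mat B) (insert i (J - {Suc i})) I else 0)
      = (if Suc i \<in> J \<and> i \<notin> J then a * minor B I (insert i (J - {Suc i})) else 0)" by simp
  finally show ?thesis .
qed

text \<open>Right factors act on column sets only, so the argument runs with the row set
  \<open>I\<close> fixed. In the application nonnegativity is known just for initial row sets, hence
  the full pattern calculus cannot be used.\<close>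

lemma minor_mult_factored:
  assumes "B \<in> carrier_mat n n" "factored n q V" "\<forall>i\<in>set q. Suc i < n" "I \<subseteq> {..<n}" "card I = k"
    and "\<And>J. J \<subseteq> {..<n} \<Longrightarrow> card J = k \<Longrightarrow> 0 \<le> minor B I J"
    and "J \<subseteq> {..<n}" "card J = k" "0 < minor B I J" "(J, K) \<in> hops q"
  shows "0 < minor (B * V) I K"
  using assms
proof (induction q arbitrary: B V J)
  case Nil
  then have "B * V = B" by (simp add: factored_Nil right_mult_one_mat[of _ n n])
  then show ?case using Nil by simp
next
  case (Cons i q)
  note nonneg = Cons.prems(6)
  obtain a M where a: "0 < a" and M: "factored n q M" and V: "V = elem_upper n i a * M"
    using Cons.prems(2) by (auto simp: factored_Cons)
  let ?B = "B * elem_upper n i a"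
  have cB: "?B \<in> carrier_mat n n" using Cons.prems(1) by (rule mult_carrier_mat) simp
  have BV: "B * V = ?B * M"
    unfolding V using Cons.prems(1) factored_carrier[OF M] by (simp add: assoc_mult_mat[of _ n n _ n _ n])
  have i: "Suc i < n" using Cons.prems(3) by simp
  have m: "minor ?B I J = minor B I J + (if Suc i \<in> J \<and> i \<notin> J then a * minor B I (insert i (J - {Suc i})) else 0)"
    if "J \<subseteq> {..<n}" "card J = k" for J
    using that by (intro minor_mult_elem_upper[OF Cons.prems(1) i Cons.prems(4)]) (use Cons.prems(5) in auto)
  have nn: "0 \<le> (if Suc i \<in> J \<and> i \<notin> J then a * minor B I (insert i (J - {Suc i})) else 0)"
    if "J \<subseteq> {..<n}" "card J = k" for J
  proof -
    have "finite J" using that finite_subset by blast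
    then have "card (insert i (J - {Suc i})) = k" if "Suc i \<in> J" "i \<notin> J"
      using that \<open>card J = k\<close> card_Suc_Diff1[of J "Suc i"] by simp
    moreover have "insert i (J - {Suc i}) \<subseteq> {..<n}" using that i by auto
    ultimately show ?thesis using nonneg[of "insert i (J - {Suc i})"] a by simp
  qed
  have nonneg': "0 \<le> minor ?B I J" if "J \<subseteq> {..<n}" "card J = k" for J
    unfolding m[OF that] using nn[OF that] nonneg[OF that] by (rule add_nonneg_nonneg[rotated])
  obtain J' where J': "(J, J') \<in> hop i" "(J', K) \<in> hops q" using Cons.prems(10) by auto
  have J'_pos: "J' \<subseteq> {..<n} \<and> card J' = k \<and> 0 < minor ?B I J'"
  proof (cases "J' = J")
    case True
    then show ?thesis using Cons.prems(7-9) m[of J] nn[of J] by (simp add: add_pos_nonneg)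
  next
    case False
    then have hop: "i \<in> J" "Suc i \<notin> J" "J' = shift i J" using J'(1) by (auto simp: hop_def)
    have "finite J" using Cons.prems(7) finite_subset by blast
    then have c: "J' \<subseteq> {..<n}" "card J' = k"
      unfolding hop(3) using hop(1,2) Cons.prems(7,8) shift_subset[OF _ i] card_shift by simp_all
    have "insert i (J' - {Suc i}) = J" "Suc i \<in> J'" "i \<notin> J'"
      unfolding hop(3) shift_def using hop(1,2) by auto
    then have "minor ?B I J' = minor B I J' + a * minor B I J" using m[OF c] by simp
    then show ?thesis using c nonneg[OF c] a Cons.prems(9) by (simp add: add_nonneg_pos)
  qed
  show ?case
    unfolding BV
  proof (rule Cons.IH[OF cB M _ Cons.prems(4,5)])
    show "\<forall>i\<in>set q. Suc i < n" using Cons.prems(3) by simp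
    show "(J', K) \<in> hops q" by fact
    show "0 \<le> minor ?B I J" if "J \<subseteq> {..<n}" "card J = k" for J using that by (rule nonneg')
  qed (use J'_pos in auto)
qed

lemma minor_initial_unitriangular:
  assumes "X \<in> carrier_mat n n" "k \<le> n" "\<And>i. i < n \<Longrightarrow> X $$ (i, i) = 1"
    and "\<And>r c. r < n \<Longrightarrow> c < r \<Longrightarrow> X $$ (r, c) = 0"
  shows "minor X {..<k} {..<k} = 1"
proof -
  let ?M = "mat k k (\<lambda>(r, c). X $$ (r, c))"
  have "minor X {..<k} {..<k} = det ?M"
    using minor_intervals[of X n n 0 k 0] assms by (simp add: lessThan_atLeast0)
  also have "upper_triangular ?M" using assms by auto
  then have "det ?M = prod_list (diag_mat ?M)" by (rule det_upper_triangular) (rule mat_carrier)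
  also have "\<dots> = 1" unfolding prod_list_diag_prod using assms by (intro prod.neutral) auto
  finally show ?thesis .
qed

text \<open>The first \<open>k\<close> rows of the product involve only the first \<open>k\<close>
  rows of \<open>B\<close>, multiplied by the leading block of \<open>L\<close>, whose determinant
  is one.\<close>

lemma minor_unit_lower_mult:
  assumes L: "L \<in> carrier_mat n n" and B: "B \<in> carrier_mat n n" and k: "k \<le> n"
    and diag: "\<And>i. i < n \<Longrightarrow> L $$ (i, i) = 1"
    and low: "\<And>r c. c < n \<Longrightarrow> r < c \<Longrightarrow> L $$ (r, c) = 0"
    and J: "J \<subseteq> {..<n}" "card J = k"
  shows "minor (L * B) {..<k} J = minor B {..<k} J"
proof -
  let ?L = "mat k k (\<lambda>(r, c). L $$ (r, c))" and ?B = "mat k k (\<lambda>(r, c). B $$ (r, pick J c))"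
  have pJ: "pick J c < n" if "c < k" for c using that pick_less[OF J(1)] J by simp
  have cLB: "L * B \<in> carrier_mat n n" using L B by (rule mult_carrier_mat)
  have "minor (L * B) {..<k} J = det (mat k k (\<lambda>(r, c). (L * B) $$ (pick {..<k} r, pick J c)))"
    by (rule minor_eq_det[OF cLB]) (use k J in auto)
  also have "mat k k (\<lambda>(r, c). (L * B) $$ (pick {..<k} r, pick J c)) = ?L * ?B"
  proof (rule eq_matI)
    fix r c assume "r < dim_row (?L * ?B)" "c < dim_col (?L * ?B)"
    then have rc: "r < k" "c < k" by auto
    have "(L * B) $$ (r, pick J c) = (\<Sum>l = 0..<n. L $$ (r, l) * B $$ (l, pick J c))"
      using L B rc k pJ by (simp add: scalar_prod_def)
    also have "\<dots> = (\<Sum>l = 0..<k. L $$ (r, l) * B $$ (l, pick J c))"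
      using k low rc by (intro sum.mono_neutral_right) auto
    also have "\<dots> = (?L * ?B) $$ (r, c)" using rc by (simp add: scalar_prod_def)
    finally show "mat k k (\<lambda>(r, c). (L * B) $$ (pick {..<k} r, pick J c)) $$ (r, c) = (?L * ?B) $$ (r, c)"
      using rc by (simp add: pick_lessThan)
  qed auto
  also have "det (?L * ?B) = det ?L * det ?B" by (rule det_mult[of _ k]) auto
  also have "det ?L = prod_list (diag_mat ?L)"
    by (rule det_lower_triangular[of k]) (use low k in auto)
  also have "\<dots> = 1" unfolding prod_list_diag_prod using diag k by (intro prod.neutral) auto
  also have "det ?B = minor B {..<k} J"
  proof -
    have "minor B {..<k} J = det (mat k k (\<lambda>(r, c). B $$ (pick {..<k} r, pick J c)))"
      by (rule minor_eq_det[OF B]) (use k J in auto)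
    also have "mat k k (\<lambda>(r, c). B $$ (pick {..<k} r, pick J c)) = ?B"
      by (intro cong_mat) (auto simp: pick_lessThan)
    finally show ?thesis by simp
  qed
  finally show ?thesis by simp
qed

text \<open>Bolzano-Weierstrass for finitely many sequences at once, by successive monotone
  subsequences.\<close>

lemma Bseq_list_subsequence:
  fixes fs :: "(nat \<Rightarrow> real) list"
  assumes "\<forall>f\<in>set fs. Bseq f"
  shows "\<exists>r bs. strict_mono (r :: nat \<Rightarrow> nat) \<and> length bs = length fs \<and>
    (\<forall>i<length fs. (\<lambda>m. (fs ! i) (r m)) \<longlonglongrightarrow> bs ! i)"
  using assms
proof (induction fs)
  case Nil
  have "strict_mono (\<lambda>m::nat. m)" by (simp add: strict_mono_def)
  then show ?case by auto
next
  case (Cons f fs)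
  then obtain r bs where r: "strict_mono r" "length bs = length fs"
    "\<forall>i<length fs. (\<lambda>m. (fs ! i) (r m)) \<longlonglongrightarrow> bs ! i" by auto
  obtain s where s: "strict_mono s" "monoseq (\<lambda>m. f (r (s m)))"
    using seq_monosub[of "\<lambda>m. f (r m)"] by auto
  obtain c where c: "\<And>m. norm (f m) \<le> c" using Cons.prems by (auto simp: Bseq_def)
  have "Bseq (\<lambda>m. f (r (s m)))" by (rule BseqI'[of _ c]) (rule c)
  then obtain b where b: "(\<lambda>m. f (r (s m))) \<longlonglongrightarrow> b"
    using Bseq_monoseq_convergent[OF _ s(2)] by (auto simp: convergent_def)
  have "(\<lambda>m. ((f # fs) ! i) (r (s m))) \<longlonglongrightarrow> (b # bs) ! i" if "i < length (f # fs)" for i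
  proof (cases i)
    case (Suc j)
    then show ?thesis
      using LIMSEQ_subseq_LIMSEQ[OF r(3)[rule_format, of j] s(1)] that by (simp add: o_def)
  qed (use b in simp)
  moreover have "strict_mono (\<lambda>m. r (s m))" using r(1) s(1) by (simp add: strict_mono_def)
  ultimately show ?case using r(2) by (intro exI[of _ "\<lambda>m. r (s m)"] exI[of _ "b # bs"]) auto
qed

lemma elem_upper_prod_tendsto:
  assumes "length fs = length q" "length bs = length q" "\<forall>i\<in>set q. Suc i < n"
    and "\<forall>i<length q. (fs ! i) \<longlonglongrightarrow> bs ! i" "r < n" "c < n"
  shows "(\<lambda>m. elem_upper_prod n (zip q (map (\<lambda>f. f m) fs)) $$ (r, c))
    \<longlonglongrightarrow> elem_upper_prod n (zip q bs) $$ (r, c)"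
  using assms
proof (induction q arbitrary: fs bs r)
  case (Cons i q)
  obtain f fs' where fs: "fs = f # fs'" using Cons.prems(1) by (cases fs) auto
  obtain b bs' where bs: "bs = b # bs'" using Cons.prems(2) by (cases bs) auto
  have f: "f \<longlonglongrightarrow> b" using Cons.prems(4) fs bs by force
  have "\<forall>i<length q. (fs' ! i) \<longlonglongrightarrow> bs' ! i" using Cons.prems(4) fs bs by force
  then have IH: "(\<lambda>m. elem_upper_prod n (zip q (map (\<lambda>f. f m) fs')) $$ (r, c))
      \<longlonglongrightarrow> elem_upper_prod n (zip q bs') $$ (r, c)" if "r < n" for r
    using Cons.IH[of fs' bs' r] Cons.prems fs bs that by auto
  have i: "Suc i < n" using Cons.prems by simp
  show ?case
    unfolding fs bs list.map zip_Cons_Cons elem_upper_prod_Cons fst_conv snd_conv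
      elem_upper_mult_index[OF elem_upper_prod_carrier Cons.prems(5,6) i]
    by (cases "r = i") (auto intro!: tendsto_intros IH f simp: i Suc_lessD[OF i] Cons.prems)
qed simp

lemma elem_upper_prod_unitriangular:
  assumes "\<forall>p\<in>set ps. Suc (fst p) < n"
  shows "i < n \<Longrightarrow> elem_upper_prod n ps $$ (i, i) = 1"
    and "r < n \<Longrightarrow> c < r \<Longrightarrow> elem_upper_prod n ps $$ (r, c) = 0"
proof -
  have "(\<forall>i<n. elem_upper_prod n ps $$ (i, i) = 1) \<and>
    (\<forall>r<n. \<forall>c<r. elem_upper_prod n ps $$ (r, c) = 0)"
    using assms
  proof (induction ps)
    case (Cons p ps)
    then show ?case
      by (auto simp: elem_upper_mult_index[of _ n n] simp del: index_mult_mat(1))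
  qed simp
  then show "i < n \<Longrightarrow> elem_upper_prod n ps $$ (i, i) = 1"
    "r < n \<Longrightarrow> c < r \<Longrightarrow> elem_upper_prod n ps $$ (r, c) = 0" by auto
qed

text \<open>This entry is the sum of all parameters with letter \<open>j\<close>, so it bounds each
  of them; that bound supplies the compactness.\<close>

lemma elem_upper_prod_superdiagonal:
  assumes "\<forall>p\<in>set ps. Suc (fst p) < n \<and> 0 \<le> snd p" "Suc j < n"
  shows "0 \<le> elem_upper_prod n ps $$ (j, Suc j) \<and>
    (\<forall>p\<in>set ps. fst p = j \<longrightarrow> snd p \<le> elem_upper_prod n ps $$ (j, Suc j))"
  using assms(1)
proof (induction ps)
  case (Cons p ps)
  have "elem_upper_prod n ps $$ (Suc j, Suc j) = 1"
    by (rule elem_upper_prod_unitriangular) (use Cons.prems assms(2) in auto)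
  then have "elem_upper_prod n (p # ps) $$ (j, Suc j)
      = elem_upper_prod n ps $$ (j, Suc j) + (if j = fst p then snd p else 0)"
    using Cons.prems assms(2)
    by (auto simp: elem_upper_mult_index[of _ n n] simp del: index_mult_mat(1))
  then show ?case using Cons by fastforce
qed (use assms(2) in simp)

lemma elem_upper_zero: "elem_upper n i 0 = 1\<^sub>m n"
  by (rule eq_matI) (auto simp: elem_upper_index)

text \<open>Positive parameters can tend to zero; such factors become identities and are dropped
  from the limiting word.\<close>

lemma elem_upper_prod_filter:
  assumes "\<forall>p\<in>set ps. 0 \<le> snd p"
  shows "elem_upper_prod n ps = elem_upper_prod n (filter (\<lambda>p. 0 < snd p) ps)"
  using assms
proof (induction ps)
  case (Cons p ps)
  show ?case
  proof (cases "snd p = 0")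
    case True
    then show ?thesis using Cons by (simp add: elem_upper_zero left_mult_one_mat[of _ n n])
  next
    case False
    then show ?thesis using Cons by auto
  qed
qed simp

text \<open>Perturbing \<open>U\<close> by a factor \<open>V\<close> with positive parameters close to the identity makes its initial
  minors positive, hence factorizable; the parameters stay bounded by the superdiagonal entries.\<close>

lemma factored_of_nonneg_initial_minors:
  assumes U: "U \<in> carrier_mat n n"
    and diag: "\<And>i. i < n \<Longrightarrow> U $$ (i, i) = 1"
    and low: "\<And>r c. r < n \<Longrightarrow> c < r \<Longrightarrow> U $$ (r, c) = 0"
    and nonneg: "\<And>k J. k \<le> n \<Longrightarrow> J \<subseteq> {..<n} \<Longrightarrow> card J = k \<Longrightarrow> 0 \<le> minor U {..<k} J"
  shows "\<exists>q. (\<forall>i\<in>set q. Suc i < n) \<and> factored n q U"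
proof -
  define W where "W = staircase n n"
  have W: "\<forall>i\<in>set W. Suc i < n" using staircase_letters by (auto simp: W_def)
  have W_top: "fold greedy W {..<k} = {n - k..<n}" if "k \<le> n" for k
    using fold_greedy_staircase[of k n n] that by (simp add: W_def lessThan_atLeast0)
  \<comment> \<open>The parameters of the perturbation \<open>V m\<close> all equal
    \<open>1 / (m + 1)\<close>: positive, and tending to zero.\<close>
  define es where "es = replicate (length W) (\<lambda>m. inverse (real (Suc m)))"
  define V where "V m = elem_upper_prod n (zip W (map (\<lambda>f. f m) es))" for m
  have V_factored: "factored n W (V m)" for m
    unfolding factored_def V_def
    by (intro exI[of _ "zip W (map (\<lambda>f. f m) es)"]) (auto simp: es_def dest: set_zip_rightD)
  have cV: "V m \<in> carrier_mat n n" for m by (simp add: V_def)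
  have V_diag: "V m $$ (i, i) = 1" if "i < n" for m i
    unfolding V_def using W that
    by (intro elem_upper_prod_unitriangular(1)) (auto dest: set_zip_leftD)
  have V_low: "V m $$ (r, c) = 0" if "r < n" "c < r" for m r c
    unfolding V_def using W that
    by (intro elem_upper_prod_unitriangular(2)) (auto dest: set_zip_leftD)
  define X where "X m = U * V m" for m
  have cX: "X m \<in> carrier_mat n n" for m unfolding X_def using U cV by (rule mult_carrier_mat)
  have X_index: "X m $$ (r, c) = (\<Sum>l = 0..<n. U $$ (r, l) * V m $$ (l, c))" if "r < n" "c < n" for m r c
    using that U cV[of m] by (simp add: X_def scalar_prod_def)
  have X_diag: "X m $$ (i, i) = 1" if i: "i < n" for m i
  proof -
    have "X m $$ (i, i) = (\<Sum>l = 0..<n. if l = i then 1 else 0)"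
      unfolding X_index[OF i i]
    proof (rule sum.cong[OF refl])
      fix l assume "l \<in> {0..<n}"
      then show "U $$ (i, l) * V m $$ (l, i) = (if l = i then 1 else 0)"
        using diag[OF i] low[OF i, of l] V_diag[OF i, of m] V_low[of l i m]
        by (cases l i rule: linorder_cases) auto
    qed
    then show ?thesis using i by simp
  qed
  have X_low: "X m $$ (r, c) = 0" if rc: "r < n" "c < r" for m r c
  proof -
    have "U $$ (r, l) * V m $$ (l, c) = 0" if "l \<in> {0..<n}" for l
      using low[OF rc(1), of l] V_low[of l c m] rc that by (cases "l < r") auto
    then have "(\<Sum>l = 0..<n. U $$ (r, l) * V m $$ (l, c)) = 0" by (intro sum.neutral) blast
    then show ?thesis using X_index[of r c m] rc by simp
  qed
  \<comment> \<open>The word \<open>W\<close> takes the first \<open>k\<close> columns to the last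
    ones, so every \<open>J\<close> is reachable from them, and the minor of \<open>U\<close> at the
    starting columns is one.\<close>
  have X_pos: "0 < minor (X m) {..<k} J" if "J \<subseteq> {..<n}" "card J = k" for m k J
  proof -
    have k: "k \<le> n" using that card_mono[of "{..<n}" J] by simp
    have "dominated J (fold greedy W {..<k})" using dominated_top[OF that] by (simp add: W_top[OF k])
    then have "({..<k}, J) \<in> hops W"
      using that finite_subset by (intro hops_of_dominated) auto
    moreover have "0 < minor U {..<k} {..<k}"
      using minor_initial_unitriangular[OF U k diag low] by simp
    ultimately show ?thesis
      unfolding X_def using nonneg k
      by (intro minor_mult_factored[OF U V_factored W, of "{..<k}" k "{..<k}"]) auto
  qed
  have "factored n W (X m)" for m
    unfolding W_def
  proof (rule factored_of_positive_solid_minors)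
    show "0 < minor (X m) {n - n..<n - n + k} {n - n + u..<n - n + u + k}" if "u + k \<le> n" for k u
      using X_pos[of "{u..<u + k}" k m] that by (simp add: lessThan_atLeast0 subset_iff)
  qed (use cX X_diag X_low in auto)
  then have "\<forall>m. \<exists>ps. map fst ps = W \<and> (\<forall>p\<in>set ps. 0 < snd p) \<and> X m = elem_upper_prod n ps"
    unfolding factored_def by blast
  then obtain ps where ps: "\<And>m. map fst (ps m) = W" "\<And>m. \<forall>p\<in>set (ps m). 0 < snd p"
    "\<And>m. X m = elem_upper_prod n (ps m)" by metis
  have len: "length (ps m) = length W" for m using ps(1)[of m] by (metis length_map)
  define fs where "fs = map (\<lambda>i m. snd (ps m ! i)) [0..<length W]"
  have zip_fs: "zip W (map (\<lambda>f. f m) fs) = ps m" for m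
  proof -
    have "map (\<lambda>f. f m) fs = map snd (ps m)" by (rule nth_equalityI) (auto simp: fs_def len)
    then show ?thesis using zip_map_fst_snd[of "ps m"] ps(1)[of m] by simp
  qed
  have X_lim: "(\<lambda>m. X m $$ (r, c)) \<longlonglongrightarrow> U $$ (r, c)" if rc: "r < n" "c < n" for r c
  proof -
    have zero: "elem_upper_prod n (zip q (replicate (length q) 0)) = 1\<^sub>m n" for q
      by (induction q) (auto simp: elem_upper_zero left_mult_one_mat[of _ n n])
    have "(\<lambda>m. V m $$ (l, c)) \<longlonglongrightarrow> 1\<^sub>m n $$ (l, c)" if "l < n" for l
    proof -
      have "\<forall>i<length W. (es ! i) \<longlonglongrightarrow> replicate (length W) 0 ! i"
        using LIMSEQ_inverse_real_of_nat by (simp add: es_def)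
      from elem_upper_prod_tendsto[OF _ _ W this that rc(2)] show ?thesis
        unfolding V_def zero by (simp add: es_def)
    qed
    then have "(\<lambda>m. \<Sum>l = 0..<n. U $$ (r, l) * V m $$ (l, c)) \<longlonglongrightarrow> (\<Sum>l = 0..<n. U $$ (r, l) * 1\<^sub>m n $$ (l, c))"
      by (intro tendsto_sum tendsto_mult tendsto_const) auto
    moreover have "(\<Sum>l = 0..<n. U $$ (r, l) * 1\<^sub>m n $$ (l, c)) = (\<Sum>l = 0..<n. if l = c then U $$ (r, c) else 0)"
      using rc by (intro sum.cong) auto
    ultimately show ?thesis using rc by (simp add: X_index)
  qed
  have "Bseq f" if "f \<in> set fs" for f
  proof -
    obtain i where i: "i < length W" "f = (\<lambda>m. snd (ps m ! i))"
      using \<open>f \<in> set fs\<close> by (auto simp: fs_def)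
    let ?j = "W ! i"
    have j: "Suc ?j < n" using W i by auto
    have mem: "ps m ! i \<in> set (ps m)" "fst (ps m ! i) = ?j" for m
      using i len[of m] ps(1)[of m] by (metis nth_mem, metis nth_map)
    have "\<forall>p\<in>set (ps m). Suc (fst p) < n \<and> 0 \<le> snd p" for m
      using W ps(1)[of m] ps(2)[of m] by (metis imageI image_set less_imp_le)
    then have "snd (ps m ! i) \<le> X m $$ (?j, Suc ?j)" for m
      using elem_upper_prod_superdiagonal[OF _ j, of "ps m"] mem[of m] ps(3)[of m] by simp
    moreover have "0 < snd (ps m ! i)" for m using ps(2)[of m] mem(1)[of m] by blast
    moreover have "Bseq (\<lambda>m. X m $$ (?j, Suc ?j))"
      using X_lim[of ?j "Suc ?j"] j by (intro convergent_imp_Bseq convergentI) auto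
    then obtain C where "\<And>m. norm (X m $$ (?j, Suc ?j)) \<le> C" by (auto simp: Bseq_def)
    ultimately show ?thesis unfolding i(2)
      by (intro BseqI'[of _ C]) (metis abs_of_pos dual_order.trans real_norm_def abs_ge_self)
  qed
  then obtain \<rho> bs where \<rho>: "strict_mono \<rho>" "length bs = length fs"
    "\<forall>i<length fs. (\<lambda>m. (fs ! i) (\<rho> m)) \<longlonglongrightarrow> bs ! i"
    using Bseq_list_subsequence[of fs] by auto
  have len_fs: "length fs = length W" by (simp add: fs_def)
  have "U = elem_upper_prod n (zip W bs)"
  proof (rule elem_upper_mult_eqI[OF U])
    fix r c assume rc: "r < n" "c < n"
    let ?gs = "map (\<lambda>f m. f (\<rho> m)) fs"
    have "(\<lambda>m. elem_upper_prod n (zip W (map (\<lambda>f. f m) ?gs)) $$ (r, c)) \<longlonglongrightarrow> elem_upper_prod n (zip W bs) $$ (r, c)"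
      by (rule elem_upper_prod_tendsto) (use \<rho> len_fs W rc in auto)
    moreover have "elem_upper_prod n (zip W (map (\<lambda>f. f m) ?gs)) = X (\<rho> m)" for m
      by (simp add: o_def zip_fs ps(3))
    ultimately have "(\<lambda>m. X (\<rho> m) $$ (r, c)) \<longlonglongrightarrow> elem_upper_prod n (zip W bs) $$ (r, c)"
      by (simp only:)
    moreover have "(\<lambda>m. X (\<rho> m) $$ (r, c)) \<longlonglongrightarrow> U $$ (r, c)"
      using LIMSEQ_subseq_LIMSEQ[OF X_lim[OF rc] \<rho>(1)] by (simp add: o_def)
    ultimately show "U $$ (r, c) = elem_upper_prod n (zip W bs) $$ (r, c)"
      using LIMSEQ_unique by blast
  qed simp
  moreover have "\<forall>p\<in>set (zip W bs). 0 \<le> snd p"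
  proof
    fix p assume "p \<in> set (zip W bs)"
    then obtain i where i: "i < length W" "snd p = bs ! i"
      using \<rho>(2) len_fs by (auto simp: set_zip)
    have "0 \<le> (fs ! i) m" for m
    proof -
      have "ps m ! i \<in> set (ps m)" using i len by simp
      then have "0 < snd (ps m ! i)" using ps(2) by blast
      then show ?thesis using i by (simp add: fs_def)
    qed
    then have "0 \<le> bs ! i"
      using \<rho>(3) i len_fs by (intro LIMSEQ_le_const[of "\<lambda>m. (fs ! i) (\<rho> m)"]) auto
    then show "0 \<le> snd p" using i by simp
  qed
  ultimately have eq: "U = elem_upper_prod n (filter (\<lambda>p. 0 < snd p) (zip W bs))"
    by (rule trans[OF _ elem_upper_prod_filter])
  let ?ps = "filter (\<lambda>p. 0 < snd p) (zip W bs)"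
  have "factored n (map fst ?ps) U" unfolding factored_def using eq by (intro exI[of _ ?ps]) auto
  moreover have "\<forall>i\<in>set (map fst ?ps). Suc i < n" using W by (auto dest: set_zip_leftD)
  ultimately show ?thesis by blast
qed

text \<open>In the first \<open>k\<close> rows the left factor \<open>transpose_mat U\<close> does
  not change minors and \<open>D\<close> scales them by a positive number, so the minors of
  \<open>U\<close> with initial rows inherit their signs from the product.\<close>

lemma factored_of_totally_nonnegative:
  assumes U: "U \<in> carrier_mat n n" "unit_upper_triangular U" and D: "D \<in> carrier_mat n n" "positive_diagonal D"
    and tn: "totally_nonnegative (transpose_mat U * D * U)"
  shows "\<exists>q. (\<forall>i\<in>set q. Suc i < n) \<and> factored n q U"
proof (rule factored_of_nonneg_initial_minors[OF U(1)])
  show diag: "U $$ (i, i) = 1" if "i < n" for i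
    using U that by (auto simp: unit_upper_triangular_def)
  show low: "U $$ (r, c) = 0" if "r < n" "c < r" for r c
    using U that by (auto simp: unit_upper_triangular_def upper_triangular_def)
  show "0 \<le> minor U {..<k} J" if k: "k \<le> n" and J: "J \<subseteq> {..<n}" "card J = k" for k J
  proof (cases "k = 0")
    \<comment> \<open>Total nonnegativity speaks only of orders at least one; the empty minor is
      handled separately and equals one.\<close>
    case True
    then have "minor U {..<k} J = det (mat 0 0 (\<lambda>(r, c). U $$ (pick {..<k} r, pick J c)))"
      using J by (intro minor_eq_det[OF U(1)]) auto
    then show ?thesis by simp
  next
    case False
    let ?A = "transpose_mat U * D * U"
    have cDU: "D * U \<in> carrier_mat n n" using D(1) U(1) by (rule mult_carrier_mat)
    have cUt: "transpose_mat U \<in> carrier_mat n n" using U(1) by simp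
    have A: "?A = transpose_mat U * (D * U)" using cUt D(1) U(1) by (rule assoc_mult_mat)
    have dA: "dim_row ?A = n" "dim_col ?A = n" using U(1) by auto
    have "minor ?A {..<k} J \<in> minors_of_order k ?A"
      unfolding minors_of_order_def dA using k J by force
    moreover have "1 \<le> k" using False by simp
    ultimately have "0 \<le> minor ?A {..<k} J" using tn unfolding totally_nonnegative_def by blast
    also have "minor ?A {..<k} J = minor (D * U) {..<k} J"
      unfolding A by (rule minor_unit_lower_mult[OF cUt cDU k _ _ J]) (use U(1) diag low in auto)
    also have "\<dots> = (\<Prod>r = 0..<k. D $$ (pick {..<k} r, pick {..<k} r)) * minor U {..<k} J"
      by (rule minor_diagonal_mult[OF D(1) _ U(1)]) (use D(2) k J in \<open>auto simp: positive_diagonal_def\<close>)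
    finally have "0 \<le> (\<Prod>r = 0..<k. D $$ (pick {..<k} r, pick {..<k} r)) * minor U {..<k} J" .
    moreover have "0 < (\<Prod>r = 0..<k. D $$ (pick {..<k} r, pick {..<k} r))"
      by (rule prod_pos) (use D k in \<open>auto simp: positive_diagonal_def pick_lessThan\<close>)
    ultimately show ?thesis by (simp add: zero_le_mult_iff)
  qed
qed

section \<open>Exponents\<close>

context symmetric_factorization
begin

lemma sum_minor_exponents_le:
  assumes ex: "\<And>k. k \<in> {1..<n} \<Longrightarrow> \<exists>m\<ge>1. (fold greedy q ^^ m) {..<k} = {n - k..<n}"
  shows "(\<Sum>k\<in>{1..<n}. minor_exponent k A) + card (inversions n (word_perm q)) \<le> (n choose 2) + (n - 1)"
proof (rule sum_exponents_le[OF letters])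
  fix k assume k: "k \<in> {1..<n}"
  let ?P = "\<lambda>m. m \<ge> 1 \<and> (fold greedy q ^^ m) {..<k} = {n - k..<n}"
  have e: "minor_exponent k A = (LEAST m. ?P m)" using k by (intro minor_exponent_eq) simp
  have "?P (LEAST m. ?P m)" by (rule LeastI_ex) (use ex[OF k] in blast)
  then show "1 \<le> minor_exponent k A" unfolding e by blast
  show "\<exists>m. (fold greedy q ^^ m) {..<k} = {n - k..<n}" using ex[OF k] by blast
  show "(fold greedy q ^^ m) {..<k} \<noteq> {n - k..<n}" if "1 \<le> m" "m < minor_exponent k A" for m
    using not_less_Least[of m ?P] that unfolding e by blast
qed

lemma oscillatory_exponents:
  assumes "oscillatory A" "k \<in> {1..<n}"
  shows "\<exists>m\<ge>1. (fold greedy q ^^ m) {..<k} = {n - k..<n}"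
proof -
  obtain m where "m \<ge> 1" "totally_positive (A ^\<^sub>m m)" using assms(1) by (auto simp: oscillatory_def)
  then have "\<forall>x\<in>minors_of_order k (A ^\<^sub>m m). 0 < x"
    using assms(2) unfolding totally_positive_def by auto
  then show ?thesis using minors_positive_iff[of k m] assms(2) \<open>m \<ge> 1\<close> by auto
qed

lemma oscillatoryI:
  assumes m: "m \<ge> 1" and top: "\<And>k. k \<le> n \<Longrightarrow> (fold greedy q ^^ m) {..<k} = {n - k..<n}"
  shows "oscillatory A"
  unfolding oscillatory_def
proof (intro conjI exI[of _ m])
  have dA: "dim_row A = n" "dim_col A = n" using A_carrier unfolding carrier_mat_def by blast+
  show "square_mat A" by (simp add: dA)
  have "A ^\<^sub>m 1 = A" by (simp add: dA left_mult_one_mat[OF A_carrier])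
  then have nonneg: "nonneg_minors k n A" for k :: nat using pos_minors_pow_iff(1)[of k 1] by simp
  show "totally_nonnegative A"
    unfolding totally_nonnegative_def minors_of_order_def dA
    using nonneg unfolding nonneg_minors_def by blast
  show "totally_positive (A ^\<^sub>m m)"
    unfolding totally_positive_def
  proof (intro allI impI)
    fix k :: nat assume "1 \<le> k"
    show "\<forall>x\<in>minors_of_order k (A ^\<^sub>m m). 0 < x"
    proof (cases "k \<le> n")
      case True
      then show ?thesis using minors_positive_iff[OF True] top[OF True] by blast
    next
      case False
      \<comment> \<open>There are no minors of order above \<open>n\<close>, so total positivity is
        vacuous there.\<close>
      have "card I \<noteq> k" if "I \<subseteq> {..<n}" for I
        using card_mono[OF finite_lessThan that] False by simp
      then show ?thesis unfolding minors_of_order_pow by blast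
    qed
  qed
qed (rule m)

end

section \<open>Extremal words and their exponents\<close>

lemma fold_greedy_descending:
  assumes "j + k < n"
  shows "fold greedy (rev [0..<n - 1]) {j..<j + k} = {Suc j..<Suc j + k}"
proof -
  \<comment> \<open>The configuration when only the letters below \<open>m\<close> are still to act:
    particles that started at \<open>m\<close> or higher have advanced. The topmost goes first, so
    each finds its next site free.\<close>
  define S where "S m = (if m \<le> j then {Suc j..<Suc (j + k)}
    else {j..<min m (j + k)} \<union> {Suc (min m (j + k))..<Suc (j + k)})" for m
  have step: "greedy m (S (Suc m)) = S m" for m
  proof -
    consider "m < j" | "j \<le> m" "m < j + k" | "j + k \<le> m" by linarith
    then show ?thesis
    proof cases
      case 2
      then have S: "S (Suc m) = {j..<Suc m} \<union> {Suc (Suc m)..<Suc (j + k)}"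
        "S m = {j..<m} \<union> {Suc m..<Suc (j + k)}"
        by (auto simp: S_def)
      have "greedy m (S (Suc m)) = shift m (S (Suc m))" unfolding greedy_def S(1) using 2 by simp
      also have "\<dots> = S m" unfolding S shift_def using 2 by auto
      finally show ?thesis .
    qed (auto simp: S_def greedy_def)
  qed
  have "fold greedy (rev [0..<m]) (S m) = S 0" for m
    by (induction m) (simp_all add: step)
  moreover have "S (n - 1) = {j..<j + k}" using assms by (auto simp: S_def)
  moreover have "S 0 = {Suc j..<Suc j + k}" by (simp add: S_def)
  ultimately show ?thesis by metis
qed

text \<open>A particle moving without obstruction bounds the position of the lowest particle.\<close>

definition free_move :: "nat \<Rightarrow> nat \<Rightarrow> nat" where
  "free_move i x = (if x = i then Suc x else x)"

text \<open>A blocked particle only falls behind the free one; if it hops past a letter while the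
  free one rests, the free one was strictly ahead.\<close>

lemma fold_greedy_lowest:
  "y \<in> S \<Longrightarrow> y \<le> x \<Longrightarrow> \<exists>z\<in>fold greedy q S. z \<le> fold free_move q x"
proof (induction q arbitrary: S x y)
  case (Cons i q)
  have "\<exists>z\<in>greedy i S. z \<le> free_move i x"
  proof (cases "y = i \<and> Suc i \<notin> S")
    case True
    then have "Suc i \<in> greedy i S" using Cons.prems by (simp add: greedy_def shift_def)
    then show ?thesis using True Cons.prems by (intro bexI[of _ "Suc i"]) (auto simp: free_move_def)
  next
    case False
    then have "y \<in> greedy i S" using Cons.prems by (auto simp: greedy_def shift_def)
    then show ?thesis using Cons.prems by (intro bexI[of _ y]) (auto simp: free_move_def)
  qed
  then show ?case using Cons.IH by auto
qed auto

lemma fold_free_move_idle: "x \<notin> set q \<Longrightarrow> fold free_move q x = x"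
  by (induction q) (auto simp: free_move_def)

text \<open>After the hop at \<open>x\<close> only smaller letters follow, so a descending run moves
  a particle at most once, while an ascending run carries it along.\<close>

lemma fold_free_move_descending: "fold free_move (rev [0..<m]) x = (if x < m then Suc x else x)"
  by (induction m arbitrary: x) (auto simp: free_move_def)

lemma fold_free_move_ascending: "fold free_move [a..<a + m] a = a + m"
  by (induction m) (auto simp: free_move_def)

text \<open>The descending run ensures progress in every pass. The staircase has no letter below
  \<open>s\<close>, and the final run of \<open>t\<close> letters starts at \<open>s - 1\<close>, so
  particles below \<open>s - 1\<close> profit from neither until they arrive there.\<close>

definition extremal_word :: "nat \<Rightarrow> nat \<Rightarrow> nat \<Rightarrow> nat list" where
  "extremal_word n s t = rev [0..<n - 1] @ staircase n (n - s) @ [s - 1..<s - 1 + t]"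

lemma staircase_prefix: "d \<le> d' \<Longrightarrow> \<exists>z. staircase n d' = staircase n d @ z"
  by (induction d' rule: dec_induct) auto

context
  fixes n s t :: nat
  assumes s: "2 \<le> s" and t: "s + t \<le> n"
begin

lemma extremal_letters: "\<forall>i\<in>set (extremal_word n s t). Suc i < n"
  using s t staircase_letters[of _ n "n - s"] by (auto simp: extremal_word_def)

lemma length_extremal: "length (extremal_word n s t) = (n - 1) + ((n - s) choose 2) + t"
  by (simp add: extremal_word_def length_staircase)

text \<open>The final run is the beginning of the next staircase block, so the word is a prefix of
  \<open>?Q\<close>, a reduced word of the longest permutation; prefixes of reduced words are
  reduced.\<close>

lemma extremal_reduced: "length (extremal_word n s t) \<le> card (inversions n (word_perm (extremal_word n s t)))"
proof -
  let ?Q = "rev [0..<n - 1] @ staircase n (n - 1)"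
  have Q: "\<forall>i\<in>set ?Q. Suc i < n" using staircase_letters[of _ n "n - 1"] by auto
  have top: "fold greedy ?Q {..<k} = {n - k..<n}" if "k \<le> n" for k
  proof (cases "k = n")
    case True
    then show ?thesis using fold_greedy_top[OF Q, of n] by (simp add: lessThan_atLeast0)
  next
    case False
    then have "fold greedy (rev [0..<n - 1]) {..<k} = {n - (n - 1)..<n - (n - 1) + k}"
      using fold_greedy_descending[of 0 k n] that by (simp add: lessThan_atLeast0)
    then show ?thesis using fold_greedy_staircase[of k "n - 1" n] False that by simp
  qed
  have "card (inversions n (word_perm ?Q)) = n choose 2"
    by (rule card_inversions_longest) (use top bij_word_perm in \<open>auto simp: word_perm_image bij_is_inj\<close>)
  moreover have "length ?Q = n choose 2"
    using s t by (cases n) (auto simp: length_staircase numeral_2_eq_2)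
  moreover obtain z where z: "?Q = extremal_word n s t @ z"
  proof -
    have "Suc (n - s) \<le> n - 1" using s t by simp
    then obtain z where z: "staircase n (n - 1) = staircase n (Suc (n - s)) @ z"
      using staircase_prefix by blast
    have "n - Suc (n - s) = s - 1" using s t by simp
    moreover have "[s - 1..<n - 1] = [s - 1..<s - 1 + t] @ [s - 1 + t..<n - 1]"
      using upt_add_eq_append[of "s - 1" "s - 1 + t" "n - 1 - (s - 1 + t)"] s t by simp
    ultimately have "?Q = extremal_word n s t @ [s - 1 + t..<n - 1] @ z" unfolding z extremal_word_def by simp
    then show ?thesis using that by blast
  qed
  ultimately have "length (extremal_word n s t @ z) \<le> card (inversions n (word_perm (extremal_word n s t @ z)))"
    by (metis order_refl)
  then show ?thesis using card_inversions_word_perm_append[of n "extremal_word n s t" z] by simp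
qed

text \<open>The descending run alone lifts a block of \<open>k\<close> particles by one site per
  pass; by monotonicity all other letters only help, so \<open>n\<close> passes suffice.\<close>

lemma extremal_top:
  assumes "k \<le> n"
  shows "(fold greedy (extremal_word n s t) ^^ n) {..<k} = {n - k..<n}"
proof (rule dominated_antisym)
  let ?g = "fold greedy (extremal_word n s t)"
  have fin: "finite ((?g ^^ m) {..<k})" for m by (induction m) auto
  have sub: "(?g ^^ m) {..<k} \<subseteq> {..<n} \<and> card ((?g ^^ m) {..<k}) = k" for m
  proof (induction m)
    case (Suc m)
    then show ?case using fold_greedy_subset[OF _ extremal_letters] fin by simp
  qed (use assms in auto)
  have "dominated {min m (n - k)..<min m (n - k) + k} ((?g ^^ m) {..<k})" for m
  proof (induction m)
    case 0
    then show ?case by (simp add: lessThan_atLeast0)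
  next
    case (Suc m)
    let ?a = "min m (n - k)"
    have step: "dominated (?g {?a..<?a + k}) ((?g ^^ Suc m) {..<k})"
      using Suc fin by (auto intro: dominated_fold_greedy_mono)
    show ?case
    proof (cases "m < n - k")
      case True
      then have "?g {?a..<?a + k} = fold greedy (staircase n (n - s) @ [s - 1..<s - 1 + t]) {Suc m..<Suc m + k}"
        using fold_greedy_descending[of m k n] by (simp add: extremal_word_def)
      then have shifted: "dominated {Suc m..<Suc m + k} (?g {?a..<?a + k})"
        by (simp only: dominated_fold_greedy finite_atLeastLessThan)
      have "min (Suc m) (n - k) = Suc m" using True by simp
      then show ?thesis using dominated_trans[OF shifted step] by simp
    next
      case False
      then have "min (Suc m) (n - k) = ?a" by simp
      then show ?thesis
        using dominated_trans[OF dominated_fold_greedy[of "{?a..<?a + k}" "extremal_word n s t"] step] by simp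
    qed
  qed
  from this[of n] show "dominated {n - k..<n} ((?g ^^ n) {..<k})" using assms by simp
  show "dominated ((?g ^^ n) {..<k}) {n - k..<n}" using dominated_top sub by blast
  show "finite ((?g ^^ n) {..<k})" by (rule fin)
qed simp

lemma free_pass: "x < s - 1 \<Longrightarrow> fold free_move (extremal_word n s t) x = (if Suc x < s - 1 then Suc x else s - 1 + t)"
proof -
  assume x: "x < s - 1"
  have "fold free_move (extremal_word n s t) x = fold free_move [s - 1..<s - 1 + t] (fold free_move (staircase n (n - s)) (Suc x))"
    using x s t by (simp add: extremal_word_def fold_free_move_descending)
  also have "fold free_move (staircase n (n - s)) (Suc x) = Suc x"
    by (rule fold_free_move_idle) (use staircase_letters[of "Suc x" n "n - s"] x s t in auto)
  finally show ?thesis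
    using x fold_free_move_ascending[of "s - 1" t] fold_free_move_idle[of "Suc x" "[s - 1..<s - 1 + t]"]
    by (cases "Suc x < s - 1") (auto simp: not_less le_Suc_eq)
qed

lemma extremal_exponent_ge:
  assumes k: "k \<in> {1..<n}" and top: "(fold greedy (extremal_word n s t) ^^ m) {..<k} = {n - k..<n}"
  shows "min (n - k) (s - 1) + (if s - 1 + t < n - k then 1 else 0) \<le> m"
proof -
  have low: "\<exists>z\<in>(fold greedy (extremal_word n s t) ^^ m) {..<k}. z \<le> (fold free_move (extremal_word n s t) ^^ m) 0" for m
  proof (induction m)
    case (Suc m)
    then show ?case using fold_greedy_lowest[of _ "(fold greedy (extremal_word n s t) ^^ m) {..<k}"] by force
  qed (use k in auto)
  have bound: "n - k \<le> (fold free_move (extremal_word n s t) ^^ m) 0" using low[of m] top by auto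
  have pos: "m < s - 1 \<Longrightarrow> (fold free_move (extremal_word n s t) ^^ m) 0 = m" for m
    by (induction m) (auto simp: free_pass)
  show ?thesis
  \<comment> \<open>The lowest particle must come from \<open>0\<close> to \<open>n - k\<close>. A
    free one is at \<open>m\<close> after \<open>m < s - 1\<close> passes and at
    \<open>s - 1 + t\<close> after \<open>s - 1\<close> passes; for larger \<open>m\<close> the
    claimed bound, which is at most \<open>s\<close>, holds outright.\<close>
  proof (cases "m < s - 1")
    case True
    then show ?thesis using bound pos[OF True] by simp
  next
    case False
    have last: "(fold free_move (extremal_word n s t) ^^ (s - 1)) 0 = s - 1 + t"
    proof -
      obtain s' where s': "s - 1 = Suc s'" using s by (cases "s - 1") auto
      then show ?thesis using pos[of s'] free_pass[of s'] by simp
    qed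
    show ?thesis
    proof (cases "m = s - 1")
      case True
      then show ?thesis using bound last by auto
    next
      case neq: False
      then show ?thesis using False by (auto simp: min_def)
    qed
  qed
qed

end

section \<open>Arithmetic of the extremal sum\<close>

lemma sum_min: "s \<le> n \<Longrightarrow> 1 \<le> s \<Longrightarrow> (\<Sum>d\<in>{1..<n}. min d (s - 1)) + ((n - s) choose 2) + (n - s) = n choose 2"
proof (induction n rule: dec_induct)
  case base
  have "(\<Sum>d\<in>{1..<s}. min d (s - 1)) = (\<Sum>d\<in>{1..<s}. d)" by (rule sum.cong) auto
  also have "\<dots> = s choose 2"
  proof (induction s)
    case (Suc s)
    then show ?case by (cases s) (auto simp: numeral_2_eq_2)
  qed simp
  finally show ?case by simp
next
  case (step n)
  have "Suc n - s = Suc (n - s)" using step by simp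
  moreover have "min n (s - 1) = s - 1" "{1..<Suc n} = insert n {1..<n}" using step by auto
  ultimately show ?case using step by (simp add: numeral_2_eq_2)
qed

text \<open>Substituting \<open>d = n - k\<close>, exactly \<open>n - s - t\<close> indices earn the
  additional pass. The subtracted letters are those of the extremal word beyond the descending
  run.\<close>

lemma sum_exponent_bounds:
  assumes "2 \<le> s" "s + t \<le> (n::nat)"
  shows "(\<Sum>k\<in>{1..<n}. min (n - k) (s - 1) + (if s - 1 + t < n - k then 1 else 0))
    + ((n - s) choose 2) + t = n choose 2"
proof -
  have "(\<Sum>k\<in>{1..<n}. min (n - k) (s - 1) + (if s - 1 + t < n - k then 1 else 0))
      = (\<Sum>d\<in>{1..<n}. min d (s - 1) + (if s - 1 + t < d then 1 else 0))"
    by (rule sum.reindex_bij_witness[of _ "\<lambda>d. n - d" "\<lambda>k. n - k"]) auto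
  also have "\<dots> = (\<Sum>d\<in>{1..<n}. min d (s - 1)) + card ({1..<n} \<inter> {d. s - 1 + t < d})"
    by (simp add: sum.distrib sum.If_cases)
  also have "{1..<n} \<inter> {d. s - 1 + t < d} = {s + t..<n}" using assms by auto
  finally show ?thesis using sum_min[of s n] assms unfolding card_atLeastLessThan by linarith
qed

text \<open>Triangular numbers leave gaps of length \<open>b\<close>, filled by
  \<open>t \<le> b\<close>; thus every admissible number of surplus letters is a full staircase plus
  a partial run.\<close>

lemma triangular_decomposition: "R \<le> Suc N choose 2 \<Longrightarrow> \<exists>b\<le>N. \<exists>t\<le>b. R = (b choose 2) + t"
proof (induction N)
  case (Suc N)
  show ?case
  proof (cases "R \<le> Suc N choose 2")
    case True
    then show ?thesis using Suc.IH le_SucI by blast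
  next
    case False
    then show ?thesis using Suc.prems
      by (intro exI[of _ "Suc N"] conjI exI[of _ "R - (Suc N choose 2)"]) (auto simp: numeral_2_eq_2)
  qed
qed (simp add: numeral_2_eq_2)

lemma elem_upper_prod_Ints:
  assumes "\<forall>p\<in>set ps. Suc (fst p) < n \<and> snd p \<in> \<int>" "r < n" "c < n"
  shows "elem_upper_prod n ps $$ (r, c) \<in> \<int>"
  using assms
proof (induction ps arbitrary: r)
  case (Cons p ps)
  then show ?case
    by (auto simp: elem_upper_mult_index[of _ n n] simp del: index_mult_mat(1))
qed (simp add: one_mat_def)

section \<open>The upper bound and its attainment\<close>

lemma sum_minor_exponents_upper:
  assumes A: "A \<in> sym_oscillatory_of_length n L" and n: "2 \<le> n"
  shows "(\<Sum>k\<in>{1..<n}. minor_exponent k A) + L \<le> (n choose 2) + (n - 1)"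
proof -
  obtain U D where U: "U \<in> carrier_mat n n" "unit_upper_triangular U"
    and D: "D \<in> carrier_mat n n" "positive_diagonal D"
    and osc: "oscillatory A" and A_eq: "A = transpose_mat U * D * U" and L: "factor_length U = L"
    using A unfolding sym_oscillatory_of_length_def by blast
  have "totally_nonnegative (transpose_mat U * D * U)" using osc A_eq by (simp add: oscillatory_def)
  then obtain p where p: "\<forall>i\<in>set p. Suc i < n" "factored n p U"
    using factored_of_totally_nonnegative[OF U D] by blast
  have "0 < n" using n by simp
  then obtain q where q: "factored n q U" "\<forall>i\<in>set q. Suc i < n"
    "factor_length U = card (inversions n (word_perm q))"
    using factored_reduced p by metis
  interpret F: symmetric_factorization n q U D
    by unfold_locales (use q D in auto)
  have FA: "F.A = A" by (simp add: F.A_def A_eq)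
  show ?thesis
    using F.sum_minor_exponents_le[OF F.oscillatory_exponents] osc L q(3) by (simp add: FA)
qed

lemma sum_minor_exponents_attained:
  assumes n: "2 \<le> n" and L: "n - 1 \<le> L" "L \<le> n choose 2"
  shows "\<exists>A \<in> sym_oscillatory_of_length n L.
    (n choose 2) + (n - 1) \<le> (\<Sum>k\<in>{1..<n}. minor_exponent k A) + L \<and>
    (\<forall>i<n. \<forall>j<n. A $$ (i, j) \<in> \<int>) \<and> det A = 1"
proof -
  \<comment> \<open>After the \<open>n - 1\<close> letters of the descending run at most
    \<open>(n - 1) choose 2\<close> remain, which keeps \<open>b \<le> n - 2\<close> and hence
    \<open>s \<ge> 2\<close>.\<close>
  have "n choose 2 = (n - 1) + (Suc (n - 2) choose 2)" using n by (cases n) (auto simp: numeral_2_eq_2 Suc_diff_Suc)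
  then have "L - (n - 1) \<le> Suc (n - 2) choose 2" using L by simp
  then obtain b t where b: "b \<le> n - 2" "t \<le> b" "L - (n - 1) = (b choose 2) + t"
    using triangular_decomposition by blast
  define s where "s = n - b"
  have s: "2 \<le> s" "s + t \<le> n" "n - s = b" using b n by (auto simp: s_def)
  define q where "q = extremal_word n s t"
  have len: "length q = L" using length_extremal[OF s(1,2)] b L s(3) by (simp add: q_def)
  have letters: "\<forall>i\<in>set q. Suc i < n" using extremal_letters[OF s(1,2)] by (simp add: q_def)
  \<comment> \<open>Unit parameters, together with the identity as diagonal factor, make the matrix
    integral with determinant one.\<close>
  define ps where "ps = map (\<lambda>i. (i, 1::real)) q"
  have ps: "\<forall>p\<in>set ps. Suc (fst p) < n" "\<forall>p\<in>set ps. snd p = 1" using letters by (auto simp: ps_def)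
  define U where "U = elem_upper_prod n ps"
  have cU: "U \<in> carrier_mat n n" by (simp add: U_def)
  have U: "factored n q U"
    unfolding factored_def by (intro exI[of _ ps]) (auto simp: U_def ps_def o_def)
  have dD: "positive_diagonal (1\<^sub>m n)" by (auto simp: positive_diagonal_def diagonal_mat_def)
  interpret F: symmetric_factorization n q U "1\<^sub>m n"
    by unfold_locales (use letters U dD in auto)
  have cUt: "transpose_mat U \<in> carrier_mat n n" using cU by simp
  have FA: "F.A = transpose_mat U * U" by (simp add: F.A_def right_mult_one_mat[OF cUt])
  have diag: "U $$ (i, i) = 1" if "i < n" for i
    unfolding U_def using ps that by (intro elem_upper_prod_unitriangular) auto
  have low: "U $$ (r, c) = 0" if "r < n" "c < r" for r c
    unfolding U_def using ps that by (intro elem_upper_prod_unitriangular) auto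
  have upper: "unit_upper_triangular U"
    using cU diag low by (auto simp: unit_upper_triangular_def upper_triangular_def)
  have top: "(fold greedy q ^^ n) {..<k} = {n - k..<n}" if "k \<le> n" for k
    unfolding q_def using s(1,2) that by (rule extremal_top)
  have osc: "oscillatory F.A" by (rule F.oscillatoryI[of n]) (use n top in auto)
  have "length q \<le> card (inversions n (word_perm q))"
    using extremal_reduced[OF s(1,2)] by (simp add: q_def)
  then have "factor_length U = L"
    using factor_length_le[OF U letters] factor_length_ge[OF U letters] len by simp
  moreover have "transpose_mat F.A = F.A"
    unfolding FA by (simp add: transpose_mult[OF cUt cU])
  ultimately have mem: "F.A \<in> sym_oscillatory_of_length n L"
    unfolding sym_oscillatory_of_length_def mem_Collect_eq
    using osc upper dD
    by (intro conjI bexI[of _ U] bexI[of _ "1\<^sub>m n"] F.A_carrier F.A_def cU one_carrier_mat) simp_all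
  have "(\<Sum>k\<in>{1..<n}. min (n - k) (s - 1) + (if s - 1 + t < n - k then 1 else 0))
      \<le> (\<Sum>k\<in>{1..<n}. minor_exponent k F.A)"
  proof (rule sum_mono)
    fix k assume k: "k \<in> {1..<n}"
    let ?P = "\<lambda>m. m \<ge> 1 \<and> (fold greedy q ^^ m) {..<k} = {n - k..<n}"
    have "?P (LEAST m. ?P m)" by (rule LeastI[of ?P n]) (use n top k in auto)
    then have "(fold greedy q ^^ minor_exponent k F.A) {..<k} = {n - k..<n}"
      using F.minor_exponent_eq[of k] k by simp
    then show "min (n - k) (s - 1) + (if s - 1 + t < n - k then 1 else 0) \<le> minor_exponent k F.A"
      unfolding q_def using s(1,2) k by (intro extremal_exponent_ge)
  qed
  then have "(n choose 2) + (n - 1) \<le> (\<Sum>k\<in>{1..<n}. minor_exponent k F.A) + L"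
    using sum_exponent_bounds[OF s(1,2)] b(3) s(3) L(1) by simp
  moreover have "F.A $$ (i, j) \<in> \<int>" if "i < n" "j < n" for i j
  proof -
    have "F.A $$ (i, j) = (\<Sum>l = 0..<n. U $$ (l, i) * U $$ (l, j))"
      using that cU by (simp add: FA scalar_prod_def)
    also have "\<dots> \<in> \<int>"
      unfolding U_def using ps that by (intro Ints_sum Ints_mult elem_upper_prod_Ints) auto
    finally show ?thesis .
  qed
  moreover have "det F.A = 1"
  proof -
    have "upper_triangular U" using cU low by (auto simp: upper_triangular_def)
    then have "det U = prod_list (diag_mat U)" using cU by (rule det_upper_triangular)
    also have "\<dots> = 1" unfolding prod_list_diag_prod using cU diag by (intro prod.neutral) auto
    finally show ?thesis by (simp add: FA det_mult[OF cUt cU] det_transpose[OF cU])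
  qed
  ultimately show ?thesis using mem by blast
qed

theorem corollary3p9:
  fixes n L :: nat
  assumes "2 \<le> n"
    and "n - 1 \<le> L"
    and "L \<le> n choose 2"
  shows "(\<forall>A \<in> sym_oscillatory_of_length n L.
            (\<Sum>k = 1..n - 1. minor_exponent k A) \<le> (n choose 2) + n - 1 - L) \<and>
         (\<exists>A \<in> sym_oscillatory_of_length n L.
            (\<Sum>k = 1..n - 1. minor_exponent k A) = (n choose 2) + n - 1 - L \<and>
            (\<forall>i<n. \<forall>j<n. A $$ (i, j) \<in> \<int>) \<and> det A = 1)"
proof -
  have range: "{1..n - 1} = {1..<n}" using assms(1) by auto
  \<comment> \<open>The natural subtraction is not truncated, because \<open>L\<close> is at most
    \<open>n choose 2\<close>.\<close>
  have upper: "(\<Sum>k = 1..n - 1. minor_exponent k A) \<le> (n choose 2) + n - 1 - L"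
    if "A \<in> sym_oscillatory_of_length n L" for A
    using sum_minor_exponents_upper[OF that assms(1)] assms(1) unfolding range by linarith
  obtain A where A: "A \<in> sym_oscillatory_of_length n L"
    "(n choose 2) + (n - 1) \<le> (\<Sum>k\<in>{1..<n}. minor_exponent k A) + L"
    "\<forall>i<n. \<forall>j<n. A $$ (i, j) \<in> \<int>" "det A = 1"
    using sum_minor_exponents_attained[OF assms] by blast
  have "(\<Sum>k = 1..n - 1. minor_exponent k A) = (n choose 2) + n - 1 - L"
    using upper[OF A(1)] A(2) assms(1) unfolding range by linarith
  then show ?thesis using upper A by blast
qed

end
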